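(* Let $k$ be an algebraically closed field of characteristic zero and let $L$ be a nilpotent Lie algebra over $k$ of dimension $n$. (1) If $n\le 7$, then $L$ satisfies Rentschler's property. More precisely, for $n\le 7$: (a) $\alpha(L)=c(L)$ if $F(L)$ is abelian; if in addition $L$ is nonsingular, then $F(L)$ is the only CP of $L$. (b) $\alpha(L)=c(L)-1$ if $F(L)$ is not abelian. (2) Assume $n=8$. Then $L$ satisfies Rentschler's property if one of the following holds: (i) $i(L)\neq 4$; (ii) $i(L)=4$ and $L$ is not quasi quadratic.
   Context: All Lie algebras are finite dimensional over $k$. For $\xi\in L^*$ put $L(\xi)=\{x\in L : \xi([x,y])=0 \text{ for all } y\in L\}$; the index is $i(L)=\min_{\xi\in L^*}\dim L(\xi)$; $\xi$ is regular if $\dim L(\xi)=i(L)$. The set $L^*_{\mathrm{reg}}$ of regular elements is open and dense in $L^*$; put $L^*_{\mathrm{sing}}=L^*\setminus L^*_{\mathrm{reg}}$. $L$ is called singular if $\operatorname{codim} L^*_{\mathrm{sing}}=1$ and nonsingular otherwise. The magic number is $c(L)=(\dim L+i(L))/2$ (an integer). The Frobenius semiradical is $F(L)=\sum_{\xi\in L^*_{\mathrm{reg}}}L(\xi)$, and $L$ is quasi quadratic if $F(L)=L$. $\alpha(L)$ denotes the maximum dimension of an abelian subalgebra of $L$. A CP (commutative polarization) of $L$ is a commutative subalgebra $P$ of $L$ with $\dim P=c(L)$. $L$ satisfies Rentschler's property if $\alpha(L)\ge c(L)-1$. *)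

theory Defs
  imports Complex_Main "HOL-Computational_Algebra.Polynomial" "HOL-Library.Extended_Nat"
begin

text \<open>
  A finite-dimensional Lie algebra over the field \<open>'k\<close>, whose underlying vector space is the
  whole type \<open>'v\<close> with scalar multiplication \<open>scale\<close>. The parameter \<open>Basis\<close> only witnesses
  finite dimensionality; no definition below refers to it.
\<close>

locale lie_algebra = finite_dimensional_vector_space scale Basis
  for scale :: "'k::field \<Rightarrow> 'v::ab_group_add \<Rightarrow> 'v"
    and Basis :: "'v set" +
  fixes bracket :: "'v \<Rightarrow> 'v \<Rightarrow> 'v"
  assumes bracket_linear_right: "Vector_Spaces.linear scale scale (\<lambda>y. bracket x y)"
    and bracket_linear_left: "Vector_Spaces.linear scale scale (\<lambda>x. bracket x y)"
    and bracket_self: "bracket x x = 0"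
    and jacobi: "bracket x (bracket y z) + bracket y (bracket z x) + bracket z (bracket x y) = 0"
begin

definition subalgebra :: "'v set \<Rightarrow> bool" where
  "subalgebra A \<longleftrightarrow> subspace A \<and> (\<forall>x\<in>A. \<forall>y\<in>A. bracket x y \<in> A)"

definition abelian :: "'v set \<Rightarrow> bool" where
  "abelian A \<longleftrightarrow> (\<forall>x\<in>A. \<forall>y\<in>A. bracket x y = 0)"

text \<open>\<open>lower_central 0\<close> is the whole algebra \<open>L\<close>, \<open>lower_central 1\<close> is \<open>[L, L]\<close>, and so on.\<close>

primrec lower_central :: "nat \<Rightarrow> 'v set" where
  "lower_central 0 = UNIV"
| "lower_central (Suc m) = span {bracket x y |x y. y \<in> lower_central m}"

definition nilpotent :: bool where
  "nilpotent \<longleftrightarrow> (\<exists>m. lower_central m = {0})"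

definition dual :: "('v \<Rightarrow> 'k) set" where
  "dual = {\<xi>. Vector_Spaces.linear scale (*) \<xi>}"

definition stabilizer :: "('v \<Rightarrow> 'k) \<Rightarrow> 'v set" where
  "stabilizer \<xi> = {x. \<forall>y. \<xi> (bracket x y) = 0}"

definition index :: nat where
  "index = Min ((\<lambda>\<xi>. dim (stabilizer \<xi>)) ` dual)"

definition dual_reg :: "('v \<Rightarrow> 'k) set" where
  "dual_reg = {\<xi> \<in> dual. dim (stabilizer \<xi>) = index}"

definition dual_sing :: "('v \<Rightarrow> 'k) set" where
  "dual_sing = dual - dual_reg"

text \<open>
  Polynomial functions on the dual space are those generated, as a \<open>'k\<close>-algebra, by evaluations
  at vectors. They are represented as functions on all of \<open>'v \<Rightarrow> 'k\<close>; only their values on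
  \<open>dual\<close> are used.
\<close>

inductive_set poly_functions :: "(('v \<Rightarrow> 'k) \<Rightarrow> 'k) set" where
  const: "(\<lambda>\<xi>. c) \<in> poly_functions"
| eval_at: "(\<lambda>\<xi>. \<xi> x) \<in> poly_functions"
| add: "p \<in> poly_functions \<Longrightarrow> q \<in> poly_functions \<Longrightarrow> (\<lambda>\<xi>. p \<xi> + q \<xi>) \<in> poly_functions"
| mult: "p \<in> poly_functions \<Longrightarrow> q \<in> poly_functions \<Longrightarrow> (\<lambda>\<xi>. p \<xi> * q \<xi>) \<in> poly_functions"

definition zariski_closed :: "('v \<Rightarrow> 'k) set \<Rightarrow> bool" where
  "zariski_closed Z \<longleftrightarrow> (\<exists>P\<subseteq>poly_functions. Z = {\<xi> \<in> dual. \<forall>p\<in>P. p \<xi> = 0})"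

definition irreducible_closed :: "('v \<Rightarrow> 'k) set \<Rightarrow> bool" where
  "irreducible_closed Z \<longleftrightarrow> zariski_closed Z \<and> Z \<noteq> {} \<and>
     (\<forall>A B. zariski_closed A \<longrightarrow> zariski_closed B \<longrightarrow> Z = A \<union> B \<longrightarrow> Z = A \<or> Z = B)"

text \<open>
  Codimension in the dual space, in the usual topological sense: for irreducible closed \<open>Z\<close>, the
  supremum of the lengths of chains of irreducible closed sets ascending strictly from \<open>Z\<close>; for
  closed \<open>S\<close>, the infimum over the irreducible closed subsets of \<open>S\<close>. The empty set has
  codimension \<open>\<infinity>\<close>.
\<close>

definition codim_irreducible :: "('v \<Rightarrow> 'k) set \<Rightarrow> enat" where
  "codim_irreducible Z =
     Sup {enat m |m. \<exists>C. C 0 = Z \<and> (\<forall>i\<le>m. irreducible_closed (C i)) \<and> (\<forall>i<m. C i \<subset> C (Suc i))}"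

definition codim :: "('v \<Rightarrow> 'k) set \<Rightarrow> enat" where
  "codim S = (INF Z \<in> {Z. irreducible_closed Z \<and> Z \<subseteq> S}. codim_irreducible Z)"

definition singular :: bool where
  "singular \<longleftrightarrow> codim dual_sing = 1"

text \<open>
  This number is an integer, since the alternating form \<open>(x, y) \<mapsto> \<xi> (bracket x y)\<close> has even
  rank; it is real-valued here so that the definition involves no rounding.
\<close>

definition magic_number :: real where
  "magic_number = (real (dim UNIV) + real index) / 2"

definition frobenius_semiradical :: "'v set" where
  "frobenius_semiradical = span (\<Union>\<xi>\<in>dual_reg. stabilizer \<xi>)"

definition quasi_quadratic :: bool where
  "quasi_quadratic \<longleftrightarrow> frobenius_semiradical = UNIV"

definition max_abelian_dim :: nat where
  "max_abelian_dim = Max (dim ` {A. subalgebra A \<and> abelian A})"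

definition commutative_polarization :: "'v set \<Rightarrow> bool" where
  "commutative_polarization P \<longleftrightarrow> subalgebra P \<and> abelian P \<and> real (dim P) = magic_number"

definition rentschler :: bool where
  "rentschler \<longleftrightarrow> real max_abelian_dim \<ge> magic_number - 1"

end

end

theory Submission
  imports Defs
begin

text \<open>
  Write \<open>n\<close> for the dimension, \<open>i\<close> for the index and \<open>n = i + 2s\<close>; this defines \<open>s\<close> because each
  functional \<open>\<xi>\<close> gives an alternating form \<open>(x, y) \<mapsto> \<xi> [x; y]\<close> of even rank, whose radical is the
  stabilizer of \<open>\<xi>\<close>. A commutative polarization is an abelian subspace of codimension \<open>s\<close>. No
  abelian subspace is larger, since it is isotropic for the form of a regular \<open>\<xi>\<close>; and one of
  codimension \<open>s\<close> is maximal isotropic, hence contains the stabilizers of all regular \<open>\<xi>\<close> and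
  with them the Frobenius semiradical \<open>F\<close>. So if \<open>F\<close> is not abelian then \<open>\<alpha>(L) < c(L)\<close>. What
  remains is to find large abelian subspaces.

  A nilpotent algebra with a maximal abelian ideal of dimension \<open>j\<close> has dimension at most
  \<open>j(j + 1)/2\<close>. This gives abelian ideals of dimension 3 for \<open>n \<ge> 4\<close> and of dimension 4 for
  \<open>n \<ge> 7\<close>. That settles \<open>s = 3\<close>, and the inequality \<open>\<alpha>(L) \<ge> c(L) - 1\<close> for \<open>s = 2\<close> and \<open>n \<le> 7\<close>. Since the
  center of a nonzero nilpotent algebra forces \<open>i > 0\<close>, larger \<open>s\<close> do not occur for \<open>n \<le> 8\<close>.

  For \<open>s = 1\<close> on \<open>H = L\<close>, and for \<open>s = 2\<close> on any hyperplane \<open>H\<close> containing \<open>F \<noteq> L\<close>, all the forms have rank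
  at most two. A space of alternating forms of rank at most two either has a common linear divisor
  or lives on a three-dimensional quotient (\<open>pfaffian_dichotomy\<close>). In the first case \<open>H\<close> has an
  abelian hyperplane, that is, one gets a commutative polarization. In the second case one loses one
  dimension, which is enough for the inequality \<open>\<alpha>(L) \<ge> c(L) - 1\<close>. If moreover \<open>F\<close> is abelian,
  the second case is impossible for \<open>s = 1\<close>, and for \<open>s = 2\<close> it forces the center to have
  codimension 4; then, for \<open>i \<le> 3\<close>, nilpotency provides two independent commuting vectors modulo the
  center (\<open>max_abelian_dim_index_codim_4\<close>), which together with it span a commutative polarization.

  For uniqueness, let \<open>P\<close> be a commutative polarization different from \<open>F\<close>. If \<open>s \<le> 2\<close> or \<open>i = 1\<close>, which
  holds for \<open>n \<le> 7\<close>, then the singular functionals contain a hyperplane or a quadric cone, and such a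
  set contains an irreducible closed set of codimension one
  (\<open>singular_if_contains_hyperplane\<close>, \<open>singular_if_contains_quadric\<close>), so
  \<open>L\<close> is singular. The irreducible set is found as the closure of the graph of a rational function.
\<close>

section \<open>Linear functionals and dimension counts\<close>

context finite_dimensional_vector_space
begin

lemma functional_iff:
  "Vector_Spaces.linear scale (*) \<xi> \<longleftrightarrow>
     (\<forall>x y. \<xi> (x + y) = \<xi> x + \<xi> y) \<and> (\<forall>c x. \<xi> (scale c x) = c * \<xi> x)"
proof -
  have "vector_space ((*) :: 'a \<Rightarrow> 'a \<Rightarrow> 'a)"
    by unfold_locales (simp_all add: algebra_simps)
  then show ?thesis
    using vector_space_axioms by (simp add: Vector_Spaces.linear_iff)
qed

lemma functional_zero: "Vector_Spaces.linear scale (*) \<xi> \<Longrightarrow> \<xi> 0 = 0"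
  unfolding functional_iff by (metis mult_zero_left scale_zero_left)

lemma dim_span_insert_le: "dim (span (insert x S)) \<le> dim S + 1"
  by (simp add: dim_insert)

lemma dim_kernel_functional:
  assumes S: "subspace S" and f: "Vector_Spaces.linear scale (*) f"
  shows "dim S \<le> dim {x \<in> S. f x = 0} + 1"
proof (cases "\<forall>x\<in>S. f x = 0")
  case True
  then have "{x \<in> S. f x = 0} = S" by auto
  then show ?thesis by simp
next
  case False
  then obtain a where a: "a \<in> S" "f a \<noteq> 0" by auto
  have "S \<subseteq> span (insert a {x \<in> S. f x = 0})"
  proof
    fix x assume x: "x \<in> S"
    have "f (x - scale (f x / f a) a) = 0"
    proof -
      have "f (x - scale (f x / f a) a) + f (scale (f x / f a) a) = f x"
        using f unfolding functional_iff by (metis diff_add_cancel)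
      moreover have "f (scale (f x / f a) a) = f x"
        using f a unfolding functional_iff by simp
      ultimately show ?thesis by simp
    qed
    then have "x - scale (f x / f a) a \<in> span {x \<in> S. f x = 0}"
      using S x a by (auto intro!: span_base subspace_diff subspace_scale)
    then show "x \<in> span (insert a {x \<in> S. f x = 0})"
      unfolding span_breakdown_eq by blast
  qed
  then have "dim S \<le> dim (span (insert a {x \<in> S. f x = 0}))"
    by (metis dim_mono dim_span)
  then show ?thesis using dim_span_insert_le le_trans by blast
qed

lemma subspace_kernel_functional:
  assumes "subspace S" "Vector_Spaces.linear scale (*) f"
  shows "subspace {x \<in> S. f x = 0}"
  using assms functional_zero unfolding functional_iff subspace_def by simp

text \<open>
  Each linear equation lowers the dimension by at most one. The estimates for
  kernels, isotropic subspaces and centralizers come from this, the equations being given by a basis.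
\<close>

lemma dim_kernel_functionals:
  assumes S: "subspace S" and "finite F" and "\<And>f. f \<in> F \<Longrightarrow> Vector_Spaces.linear scale (*) f"
  shows "subspace {x \<in> S. \<forall>f\<in>F. f x = 0} \<and> dim S \<le> dim {x \<in> S. \<forall>f\<in>F. f x = 0} + card F"
  using assms(2,3)
proof (induction F)
  case empty
  then show ?case using S by simp
next
  case (insert g F)
  let ?K = "{x \<in> S. \<forall>f\<in>F. f x = 0}"
  have eq: "{x \<in> S. \<forall>f\<in>insert g F. f x = 0} = {x \<in> ?K. g x = 0}" by auto
  have g: "Vector_Spaces.linear scale (*) g" using insert by auto
  have K: "subspace ?K" "dim S \<le> dim ?K + card F" using insert by auto
  have "dim ?K \<le> dim {x \<in> ?K. g x = 0} + 1"
    by (rule dim_kernel_functional[OF K(1) g])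
  then show ?case
    using subspace_kernel_functional[OF K(1) g] K(2) insert.hyps unfolding eq by simp
qed

lemma separating_functionals:
  assumes T: "subspace T"
  obtains F where "finite F" "card F \<le> dim T"
    "\<And>f. f \<in> F \<Longrightarrow> Vector_Spaces.linear scale (*) f"
    "\<And>v. v \<in> T \<Longrightarrow> (\<And>f. f \<in> F \<Longrightarrow> f v = 0) \<Longrightarrow> v = 0"
proof -
  obtain C where C: "C \<subseteq> T" "independent C" "T \<subseteq> span C" "card C = dim T"
    by (rule basis_exists[of T])
  define D where "D = extend_basis C"
  have D: "independent D" "span D = UNIV" "C \<subseteq> D"
    using C(2) by (auto simp: D_def independent_extend_basis span_extend_basis extend_basis_superset)
  let ?F = "(\<lambda>c v. representation D v c) ` C"
  have fC: "finite C" using C(2) finiteI_independent by blast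
  show thesis
  proof
    show "finite ?F" using fC by simp
    show "card ?F \<le> dim T" using card_image_le[OF fC] C(4) by metis
    show "Vector_Spaces.linear scale (*) f" if "f \<in> ?F" for f
      using that linear_representation[OF D(1,2)] by auto
    show "v = 0" if v: "v \<in> T" and 0: "\<And>f. f \<in> ?F \<Longrightarrow> f v = 0" for v
    proof -
      have "v \<in> span C" using v C(3) by blast
      then have rep: "representation D v = representation C v"
        by (rule representation_extend[OF D(1) _ D(3)])
      have "(\<Sum>b\<in>C. scale (representation C v b) b) = v"
        using sum_representation_eq[OF C(2) \<open>v \<in> span C\<close> fC order_refl] .
      moreover have "(\<Sum>b\<in>C. scale (representation C v b) b) = 0"
        using 0 by (intro sum.neutral) (auto simp: rep[symmetric])
      ultimately show ?thesis by simp
    qed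
  qed
qed

lemma functional_compose:
  "Vector_Spaces.linear scale scale g \<Longrightarrow> Vector_Spaces.linear scale (*) f \<Longrightarrow>
   Vector_Spaces.linear scale (*) (\<lambda>x. f (g x))"
  by (simp add: functional_iff Vector_Spaces.linear_iff)

text \<open>
  Separating functionals on the target turn the vector-valued equation into \<open>dim T\<close> scalar equations.
\<close>

lemma rank_nullity_le:
  assumes S: "subspace S" and T: "subspace T" and g: "Vector_Spaces.linear scale scale g"
    and gS: "g ` S \<subseteq> T"
  shows "dim S \<le> dim {x \<in> S. g x = 0} + dim T"
proof -
  obtain F where F: "finite F" "card F \<le> dim T"
    "\<And>f. f \<in> F \<Longrightarrow> Vector_Spaces.linear scale (*) f"
    "\<And>v. v \<in> T \<Longrightarrow> (\<And>f. f \<in> F \<Longrightarrow> f v = 0) \<Longrightarrow> v = 0"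
    using separating_functionals[OF T] by blast
  let ?G = "(\<lambda>f x. f (g x)) ` F"
  have "dim S \<le> dim {x \<in> S. \<forall>h\<in>?G. h x = 0} + card ?G"
  proof -
    have "Vector_Spaces.linear scale (*) h" if "h \<in> ?G" for h
      using that functional_compose[OF g F(3)] by auto
    then show ?thesis using dim_kernel_functionals[OF S, of ?G] F(1) by blast
  qed
  moreover have "{x \<in> S. \<forall>h\<in>?G. h x = 0} = {x \<in> S. g x = 0}"
  proof (intro Collect_cong conj_cong refl iffI)
    fix x assume x: "x \<in> S" and 0: "\<forall>h\<in>?G. h x = 0"
    have "g x \<in> T" using x gS by auto
    then show "g x = 0"
    proof (rule F(4))
      show "f (g x) = 0" if "f \<in> F" for f using 0 that by simp
    qed
  next
    fix x assume "g x = 0"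
    then show "\<forall>h\<in>?G. h x = 0"
      using functional_zero[OF F(3)] by simp
  qed
  moreover have "card ?G \<le> dim T"
    using card_image_le[OF F(1)] F(2) le_trans by blast
  ultimately show ?thesis by simp
qed

lemma separate_point:
  assumes S: "subspace S" and v: "v \<notin> S"
  obtains \<xi> where "Vector_Spaces.linear scale (*) \<xi>" "\<And>x. x \<in> S \<Longrightarrow> \<xi> x = 0" "\<xi> v = 1"
proof -
  obtain C where C: "C \<subseteq> S" "independent C" "S \<subseteq> span C" "card C = dim S"
    by (rule basis_exists[of S])
  have spC: "span C = S" using C S by (simp add: span_subspace)
  have ind: "independent (insert v C)"
    using C(2) v spC by (simp add: independent_insertI)
  define D where "D = extend_basis (insert v C)"
  have D: "independent D" "span D = UNIV" "insert v C \<subseteq> D"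
    using ind extend_basis_superset[OF ind]
    by (auto simp: D_def independent_extend_basis span_extend_basis)
  show thesis
  proof
    show "Vector_Spaces.linear scale (*) (\<lambda>x. representation D x v)"
      by (rule linear_representation[OF D(1,2)])
    show "representation D v v = 1" using representation_basis[OF D(1)] D(3) by simp
    show "representation D x v = 0" if "x \<in> S" for x
    proof -
      have "representation D x = representation C x"
        using representation_extend[OF D(1)] that spC D(3) by auto
      moreover have "v \<notin> C" using v C(1) by blast
      ultimately show ?thesis using representation_ne_zero by metis
    qed
  qed
qed

lemma dim_span_insert:
  "subspace S \<Longrightarrow> x \<notin> S \<Longrightarrow> dim (span (insert x S)) = dim S + 1"
  by (simp add: dim_insert span_eq_iff[THEN iffD2])

lemma mem_span_insert:
  "subspace S \<Longrightarrow> y \<in> span (insert x S) \<longleftrightarrow> (\<exists>k. y - scale k x \<in> S)"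
  by (simp add: span_breakdown_eq span_eq_iff[THEN iffD2])

lemma hyperplane_through:
  assumes S: "subspace S" and V: "subspace V" and SV: "S \<subset> V"
  obtains H where "subspace H" "S \<subseteq> H" "H \<subseteq> V" "dim V = dim H + 1"
proof -
  obtain v where v: "v \<in> V" "v \<notin> S" using SV by blast
  obtain f where f: "Vector_Spaces.linear scale (*) f" "\<And>x. x \<in> S \<Longrightarrow> f x = 0" "f v = 1"
    using separate_point[OF S v(2)] by blast
  let ?H = "{x \<in> V. f x = 0}"
  have H: "subspace ?H" by (rule subspace_kernel_functional[OF V f(1)])
  have "v \<notin> ?H" using f(3) by simp
  then have "?H \<subset> V" using v(1) by blast
  then have "dim ?H < dim V" using dim_psubset H V by (metis span_eq_iff)
  moreover have "dim V \<le> dim ?H + 1" by (rule dim_kernel_functional[OF V f(1)])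
  ultimately have "dim V = dim ?H + 1" by simp
  then show thesis using that[of ?H] H SV f(2) by auto
qed

end

section \<open>Brackets, functionals and stabilizers\<close>

context lie_algebra
begin

notation scale (infixr "*s" 75)
notation bracket ("[_;_]")

lemma bracket_add_left: "[x + y; z] = [x; z] + [y; z]"
  and bracket_scale_left: "[c *s x; z] = c *s [x; z]"
  using bracket_linear_left by (simp_all add: Vector_Spaces.linear_iff)

lemma bracket_add_right: "[z; x + y] = [z; x] + [z; y]"
  and bracket_scale_right: "[z; c *s x] = c *s [z; x]"
  using bracket_linear_right by (simp_all add: Vector_Spaces.linear_iff)

lemma bracket_zero_left: "[0; z] = 0"
  using bracket_scale_left[of 0 0 z] by simp

lemma bracket_zero_right: "[z; 0] = 0"
  using bracket_scale_right[of z 0 0] by simp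

lemma bracket_minus_left: "[- x; z] = - [x; z]"
  using bracket_scale_left[of "-1" x z] by simp

lemma bracket_minus_right: "[z; - x] = - [z; x]"
  using bracket_scale_right[of z "-1" x] by simp

lemma bracket_diff_left: "[x - y; z] = [x; z] - [y; z]"
  using bracket_add_left[of x "- y" z] by (simp add: bracket_minus_left)

lemma bracket_diff_right: "[z; x - y] = [z; x] - [z; y]"
  using bracket_add_right[of z x "- y"] by (simp add: bracket_minus_right)

lemmas bracket_simps = bracket_add_left bracket_scale_left bracket_add_right bracket_scale_right
  bracket_zero_left bracket_zero_right bracket_minus_left bracket_minus_right
  bracket_diff_left bracket_diff_right bracket_self

lemma bracket_anticommute: "[x; y] = - [y; x]"
proof -
  have "[x; y] + [y; x] = [x + y; x + y]"
    unfolding bracket_add_left bracket_add_right by (simp add: bracket_self)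
  then show ?thesis by (simp add: bracket_self eq_neg_iff_add_eq_0)
qed

lemma dual_iff: "\<xi> \<in> dual \<longleftrightarrow> (\<forall>x y. \<xi> (x + y) = \<xi> x + \<xi> y) \<and> (\<forall>c x. \<xi> (c *s x) = c * \<xi> x)"
  by (simp add: dual_def functional_iff)

lemma dual_linear: "\<xi> \<in> dual \<Longrightarrow> Vector_Spaces.linear scale (*) \<xi>"
  by (simp add: dual_def)

lemma dual_add: "\<xi> \<in> dual \<Longrightarrow> \<xi> (x + y) = \<xi> x + \<xi> y"
  and dual_scale: "\<xi> \<in> dual \<Longrightarrow> \<xi> (c *s x) = c * \<xi> x"
  and dual_zero: "\<xi> \<in> dual \<Longrightarrow> \<xi> 0 = 0"
  using functional_zero[OF dual_linear] by (auto simp: dual_iff)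

lemma dual_minus: "\<xi> \<in> dual \<Longrightarrow> \<xi> (- x) = - \<xi> x"
  using dual_scale[of \<xi> "-1" x] by simp

lemma dual_diff: "\<xi> \<in> dual \<Longrightarrow> \<xi> (x - y) = \<xi> x - \<xi> y"
  using dual_add[of \<xi> x "- y"] by (simp add: dual_minus)

lemmas dual_simps = dual_add dual_scale dual_zero dual_minus dual_diff

lemma zero_in_dual: "(\<lambda>x. 0) \<in> dual"
  by (simp add: dual_iff)

lemma dual_closed_add: "\<xi> \<in> dual \<Longrightarrow> \<eta> \<in> dual \<Longrightarrow> (\<lambda>x. \<xi> x + \<eta> x) \<in> dual"
  by (simp add: dual_iff algebra_simps)

lemma dual_bracket: "\<xi> \<in> dual \<Longrightarrow> (\<lambda>x. \<xi> [a; x]) \<in> dual"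
  by (simp add: dual_iff bracket_simps)

lemma dual_anticommute: "\<xi> \<in> dual \<Longrightarrow> \<xi> [x; y] = - \<xi> [y; x]"
  using bracket_anticommute[of x y] dual_minus by simp

lemma subspace_stabilizer: "\<xi> \<in> dual \<Longrightarrow> subspace (stabilizer \<xi>)"
  by (auto simp: subspace_def stabilizer_def bracket_simps dual_simps)

section \<open>Isotropic subspaces\<close>

text \<open>
  The form pairs an isotropic subspace with a complement only, so lying in the stabilizer costs
  at most \<open>dim UNIV - dim A\<close> equations on \<open>A\<close>.
\<close>

lemma dim_isotropic_le:
  assumes \<xi>: "\<xi> \<in> dual" and A: "subspace A" and iso: "\<And>x y. x \<in> A \<Longrightarrow> y \<in> A \<Longrightarrow> \<xi> [x; y] = 0"
  shows "2 * dim A \<le> dim UNIV + dim (A \<inter> stabilizer \<xi>)"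
proof -
  obtain C where C: "C \<subseteq> A" "independent C" "A \<subseteq> span C" "card C = dim A"
    by (rule basis_exists[of A])
  define D where "D = extend_basis C"
  have D: "independent D" "span D = UNIV" "C \<subseteq> D"
    using C(2) by (auto simp: D_def independent_extend_basis span_extend_basis extend_basis_superset)
  have fD: "finite D" using D(1) finiteI_independent by blast
  have cD: "card D = dim UNIV"
    using dim_eq_card[OF _ D(1), of UNIV] D(2) by simp
  let ?F = "(\<lambda>c x. \<xi> [c; x]) ` (D - C)"
  have cF: "card ?F \<le> dim UNIV - dim A"
  proof -
    have "card ?F \<le> card (D - C)" using fD by (simp add: card_image_le)
    also have "\<dots> = dim UNIV - dim A" using D(3) fD C(4) cD by (metis card_Diff_subset finite_subset)
    finally show ?thesis .
  qed
  have le: "dim A \<le> dim UNIV" by (rule dim_subset) simp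
  have "dim A \<le> dim {x \<in> A. \<forall>f\<in>?F. f x = 0} + card ?F"
    using dim_kernel_functionals[OF A, of ?F] fD dual_bracket[OF \<xi>] by (auto simp: dual_def)
  moreover have "{x \<in> A. \<forall>f\<in>?F. f x = 0} \<subseteq> A \<inter> stabilizer \<xi>"
  proof safe
    fix x assume x: "x \<in> A" and 0: "\<forall>f\<in>?F. f x = 0"
    have "\<xi> [x; y] = 0" for y
    proof -
      have "y \<in> span D" using D(2) by simp
      then show ?thesis
      proof (induction rule: span_induct_alt)
        case base
        then show ?case using \<xi> by (simp add: bracket_simps dual_simps)
      next
        case (step c u v)
        have "\<xi> [u; x] = 0"
        proof (cases "u \<in> C")
          case True
          then show ?thesis using iso C(1) x by blast
        next
          case False
          then show ?thesis using 0 step.hyps by auto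
        qed
        then show ?case using \<xi> step dual_anticommute[OF \<xi>, of x u] by (simp add: bracket_simps dual_simps)
      qed
    qed
    then show "x \<in> stabilizer \<xi>" by (simp add: stabilizer_def)
  qed
  then have "dim {x \<in> A. \<forall>f\<in>?F. f x = 0} \<le> dim (A \<inter> stabilizer \<xi>)" by (rule dim_subset)
  ultimately show ?thesis using cF le by linarith
qed

lemma hyperbolic_component:
  assumes \<xi>: "\<xi> \<in> dual" and ne: "\<xi> [x; y] \<noteq> 0"
  obtains a b where "\<xi> [x; w - a *s x - b *s y] = 0" "\<xi> [y; w - a *s x - b *s y] = 0"
proof
  have "\<xi> [y; x] = - \<xi> [x; y]" by (rule dual_anticommute[OF \<xi>])
  then show "\<xi> [x; w - (\<xi> [y; w] / \<xi> [y; x]) *s x - (\<xi> [x; w] / \<xi> [x; y]) *s y] = 0"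
    "\<xi> [y; w - (\<xi> [y; w] / \<xi> [y; x]) *s x - (\<xi> [x; w] / \<xi> [x; y]) *s y] = 0"
    using \<xi> ne by (simp_all add: bracket_simps dual_simps)
qed

text \<open>
  A hyperbolic plane splits off orthogonally. This is the induction step for the parity of the rank and
  also produces Pfaffians that do not vanish.
\<close>

lemma hyperbolic_complement:
  assumes \<xi>: "\<xi> \<in> dual" and ne: "\<xi> [x; y] \<noteq> 0" and V: "subspace V" "x \<in> V" "y \<in> V"
  defines "V' \<equiv> {v \<in> V. \<xi> [x; v] = 0 \<and> \<xi> [y; v] = 0}"
  shows "subspace V'" and "dim V = dim V' + 2"
    and "{v \<in> V'. \<forall>w\<in>V'. \<xi> [v; w] = 0} = {v \<in> V. \<forall>w\<in>V. \<xi> [v; w] = 0}"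
proof -
  have yx: "\<xi> [y; x] = - \<xi> [x; y]" by (rule dual_anticommute[OF \<xi>])
  show sub: "subspace V'"
    unfolding V'_def using V(1) \<xi> by (auto simp: subspace_def bracket_simps dual_simps)
  have x: "x \<notin> V'" using ne yx by (simp add: V'_def)
  have y: "y \<notin> span (insert x V')"
  proof
    assume "y \<in> span (insert x V')"
    then obtain k where "y - k *s x \<in> V'" using mem_span_insert[OF sub] by blast
    then show False using ne \<xi> by (simp add: V'_def bracket_simps dual_simps)
  qed
  have span: "span (insert y (span (insert x V'))) = V"
  proof
    have "V' \<subseteq> V" by (auto simp: V'_def)
    then have "span (insert x V') \<subseteq> V" by (intro span_minimal) (use V in auto)
    then show "span (insert y (span (insert x V'))) \<subseteq> V"
      by (intro span_minimal) (use V in auto)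
    show "V \<subseteq> span (insert y (span (insert x V')))"
    proof
      fix w assume w: "w \<in> V"
      obtain a b where ab: "\<xi> [x; w - a *s x - b *s y] = 0" "\<xi> [y; w - a *s x - b *s y] = 0"
        using hyperbolic_component[OF \<xi> ne] by blast
      have "w - a *s x - b *s y \<in> V'"
        using ab w V by (auto simp: V'_def intro!: subspace_diff subspace_scale)
      then have "w - b *s y - a *s x \<in> V'" by (simp add: algebra_simps)
      then show "w \<in> span (insert y (span (insert x V')))"
        using mem_span_insert[OF sub] mem_span_insert[OF subspace_span] by blast
    qed
  qed
  show "dim V = dim V' + 2"
    using dim_span_insert[OF sub x] dim_span_insert[OF subspace_span y] unfolding span by simp
  show "{v \<in> V'. \<forall>w\<in>V'. \<xi> [v; w] = 0} = {v \<in> V. \<forall>w\<in>V. \<xi> [v; w] = 0}"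
  proof (intro set_eqI iffI)
    fix v assume v: "v \<in> {v \<in> V'. \<forall>w\<in>V'. \<xi> [v; w] = 0}"
    have "\<xi> [v; w] = 0" if w: "w \<in> V" for w
    proof -
      obtain a b where ab: "\<xi> [x; w - a *s x - b *s y] = 0" "\<xi> [y; w - a *s x - b *s y] = 0"
        using hyperbolic_component[OF \<xi> ne] by blast
      have "w - a *s x - b *s y \<in> V'"
        using ab w V by (auto simp: V'_def intro!: subspace_diff subspace_scale)
      then have "\<xi> [v; w - a *s x - b *s y] = 0" using v by blast
      moreover have "\<xi> [v; x] = 0" "\<xi> [v; y] = 0"
        using v dual_anticommute[OF \<xi>, of v] by (auto simp: V'_def)
      ultimately show ?thesis using \<xi> by (simp add: bracket_simps dual_simps)
    qed
    then show "v \<in> {v \<in> V. \<forall>w\<in>V. \<xi> [v; w] = 0}" using v by (auto simp: V'_def)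
  next
    fix v assume v: "v \<in> {v \<in> V. \<forall>w\<in>V. \<xi> [v; w] = 0}"
    then have "\<xi> [x; v] = 0" "\<xi> [y; v] = 0"
      using V dual_anticommute[OF \<xi>, of _ v] by auto
    then show "v \<in> {v \<in> V'. \<forall>w\<in>V'. \<xi> [v; w] = 0}" using v by (auto simp: V'_def)
  qed
qed

lemma even_rank:
  assumes \<xi>: "\<xi> \<in> dual" and V: "subspace V"
  shows "\<exists>k. dim V = dim {v \<in> V. \<forall>w\<in>V. \<xi> [v; w] = 0} + 2 * k"
  using V
proof (induction "dim V" arbitrary: V rule: less_induct)
  case less
  show ?case
  proof (cases "\<forall>x\<in>V. \<forall>y\<in>V. \<xi> [x; y] = 0")
    case True
    then have "{v \<in> V. \<forall>w\<in>V. \<xi> [v; w] = 0} = V" by auto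
    then show ?thesis by auto
  next
    case False
    then obtain x y where xy: "x \<in> V" "y \<in> V" "\<xi> [x; y] \<noteq> 0" by blast
    note split = hyperbolic_complement[OF \<xi> xy(3) less.prems xy(1,2)]
    obtain k where "dim {v \<in> V. \<xi> [x; v] = 0 \<and> \<xi> [y; v] = 0}
        = dim {v \<in> V. \<forall>w\<in>V. \<xi> [v; w] = 0} + 2 * k"
      using less.hyps[OF _ split(1)] split(2,3) by auto
    then have "dim V = dim {v \<in> V. \<forall>w\<in>V. \<xi> [v; w] = 0} + 2 * (k + 1)"
      using split(2) by simp
    then show ?thesis by blast
  qed
qed

lemma even_codim_stabilizer:
  assumes "\<xi> \<in> dual"
  shows "\<exists>k. dim UNIV = dim (stabilizer \<xi>) + 2 * k"
  using even_rank[OF assms subspace_UNIV] by (simp add: stabilizer_def)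

section \<open>Pfaffians of four vectors\<close>

text \<open>
  The Pfaffian of the \<open>4 \<times> 4\<close> Gram matrix of the form of \<open>\<xi>\<close> on the four vectors.
\<close>

definition pfaffian :: "('v \<Rightarrow> 'k) \<Rightarrow> 'v \<Rightarrow> 'v \<Rightarrow> 'v \<Rightarrow> 'v \<Rightarrow> 'k" where
  "pfaffian \<xi> w x y z = \<xi> [w; x] * \<xi> [y; z] - \<xi> [w; y] * \<xi> [x; z] + \<xi> [w; z] * \<xi> [x; y]"

text \<open>
  If the Pfaffian is nonzero, the form is nondegenerate on the four vectors, so they are linearly
  independent modulo the radical. The subspace \<open>H\<close> is kept general because the vectors will be
  taken from a hyperplane that contains the stabilizer.
\<close>

lemma dim_stabilizer_pfaffian:
  assumes \<xi>: "\<xi> \<in> dual" and pf: "pfaffian \<xi> w x y z \<noteq> 0"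
    and H: "subspace H" "stabilizer \<xi> \<subseteq> H" "w \<in> H" "x \<in> H" "y \<in> H" "z \<in> H"
  shows "dim (stabilizer \<xi>) + 4 \<le> dim H"
proof -
  let ?S = "stabilizer \<xi>"
  have stab: "\<xi> [s; t] = 0" "\<xi> [t; s] = 0" if "s \<in> ?S" for s t
    using that dual_anticommute[OF \<xi>, of t s] by (auto simp: stabilizer_def)
  have S: "subspace ?S" by (rule subspace_stabilizer[OF \<xi>])
  define S1 where "S1 = span (insert z ?S)"
  define S2 where "S2 = span (insert y S1)"
  define S3 where "S3 = span (insert x S2)"
  define S4 where "S4 = span (insert w S3)"
  have sub: "subspace S1" "subspace S2" "subspace S3" by (auto simp: S1_def S2_def S3_def)
  have a: "[a; b] = - [b; a]" for a b by (rule bracket_anticommute)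
  \<comment> \<open>The vectors are added one at a time; a linear relation modulo the radical at any stage makes the Pfaffian vanish.\<close>
  have z: "z \<notin> ?S"
    using pf stab(2)[of z] by (auto simp: pfaffian_def)
  have y: "y \<notin> S1"
  proof
    assume "y \<in> S1"
    then obtain k where "y - k *s z \<in> ?S" using mem_span_insert[OF S] S1_def by blast
    from stab[OF this] have "\<xi> [w; y] = k * \<xi> [w; z]" "\<xi> [x; y] = k * \<xi> [x; z]" "\<xi> [y; z] = 0"
      using \<xi> by (simp_all add: bracket_simps dual_simps)
    then show False using pf by (simp add: pfaffian_def)
  qed
  have x: "x \<notin> S2"
  proof
    assume "x \<in> S2"
    then obtain k l where "x - k *s y - l *s z \<in> ?S"
      using mem_span_insert[OF S] mem_span_insert[OF sub(1)] S1_def S2_def by blast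
    from stab(2)[OF this, of w] stab(2)[OF this, of y] stab(2)[OF this, of z]
    have eqs: "\<xi> [w; x] = k * \<xi> [w; y] + l * \<xi> [w; z]" "- \<xi> [x; y] = l * \<xi> [y; z]"
      "\<xi> [x; z] = k * \<xi> [y; z]"
      using \<xi> a[of y x] a[of z x] a[of z y] by (simp_all add: bracket_simps dual_simps algebra_simps)
    have "\<xi> [x; y] = - l * \<xi> [y; z]" using eqs(2) by (metis minus_minus mult_minus_left)
    with eqs show False using pf by (simp add: pfaffian_def algebra_simps)
  qed
  have w: "w \<notin> S3"
  proof
    assume "w \<in> S3"
    then obtain k l m where "w - k *s x - l *s y - m *s z \<in> ?S"
      using mem_span_insert[OF S] mem_span_insert[OF sub(1)] mem_span_insert[OF sub(2)] S1_def S2_def S3_def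
      by blast
    from stab(1)[OF this, of x] stab(1)[OF this, of y] stab(1)[OF this, of z]
    have eqs: "\<xi> [w; x] + (l * \<xi> [x; y] + m * \<xi> [x; z]) = 0" "\<xi> [w; y] = k * \<xi> [x; y] - m * \<xi> [y; z]"
      "\<xi> [w; z] = k * \<xi> [x; z] + l * \<xi> [y; z]"
      using \<xi> a[of y x] a[of z x] a[of z y] by (simp_all add: bracket_simps dual_simps algebra_simps)
    have wx: "\<xi> [w; x] = - (l * \<xi> [x; y] + m * \<xi> [x; z])"
      using eqs(1) by (simp only: eq_neg_iff_add_eq_0)
    have "pfaffian \<xi> w x y z = 0"
      unfolding pfaffian_def wx eqs(2,3) by (simp add: algebra_simps)
    with pf show False by simp
  qed
  have "S4 \<subseteq> H"
    unfolding S4_def S3_def S2_def S1_def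
    by (intro span_minimal insert_subsetI) (use H in auto)
  then have "dim S4 \<le> dim H" by (rule dim_subset)
  moreover have "dim S4 = dim ?S + 4"
    using dim_span_insert[OF S z] dim_span_insert[OF sub(1) y] dim_span_insert[OF sub(2) x]
      dim_span_insert[OF sub(3) w] by (simp add: S1_def S2_def S3_def S4_def)
  ultimately show ?thesis by simp
qed

text \<open>
  Rank at least four leaves room for a second hyperbolic plane orthogonal to a first one.
\<close>

lemma pfaffian_nonzero_exists:
  assumes \<xi>: "\<xi> \<in> dual" and small: "dim (stabilizer \<xi>) + 2 < dim UNIV"
  obtains w x y z where "pfaffian \<xi> w x y z \<noteq> 0"
proof -
  have "stabilizer \<xi> \<noteq> UNIV" using small by auto
  then obtain x y where xy: "\<xi> [x; y] \<noteq> 0" by (auto simp: stabilizer_def)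
  let ?V = "{v \<in> UNIV. \<xi> [x; v] = 0 \<and> \<xi> [y; v] = 0}"
  note split = hyperbolic_complement[OF \<xi> xy subspace_UNIV UNIV_I UNIV_I]
  have "\<exists>u\<in>?V. \<exists>v\<in>?V. \<xi> [u; v] \<noteq> 0"
  proof (rule ccontr)
    assume "\<not> ?thesis"
    then have "{v \<in> ?V. \<forall>w\<in>?V. \<xi> [v; w] = 0} = ?V" by blast
    then have "?V = stabilizer \<xi>" using split(3) by (simp add: stabilizer_def)
    then show False using split(2) small by simp
  qed
  then obtain u v where "\<xi> [x; u] = 0" "\<xi> [y; u] = 0" "\<xi> [x; v] = 0" "\<xi> [y; v] = 0" "\<xi> [u; v] \<noteq> 0"
    by auto
  then have "pfaffian \<xi> x y u v \<noteq> 0" using xy by (simp add: pfaffian_def)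
  then show thesis using that by blast
qed

section \<open>Index and commutative polarizations\<close>

lemma dim_le_UNIV: "dim A \<le> dim UNIV"
  by (rule dim_subset) simp

lemma finite_dims: "finite (dim ` \<A>)"
proof -
  have "dim ` \<A> \<subseteq> {..dim UNIV}" using dim_le_UNIV by blast
  then show ?thesis by (rule finite_subset) simp
qed

lemma index_le: "\<xi> \<in> dual \<Longrightarrow> index \<le> dim (stabilizer \<xi>)"
  using finite_dims[of "stabilizer ` dual"] unfolding index_def image_image by (intro Min_le) auto

lemma dual_reg_subset: "dual_reg \<subseteq> dual"
  by (auto simp: dual_reg_def)

lemma dual_reg_nonempty: obtains \<xi> where "\<xi> \<in> dual_reg"
proof -
  have "index \<in> (\<lambda>\<xi>. dim (stabilizer \<xi>)) ` dual"
    unfolding index_def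
  proof (rule Min_in)
    show "finite ((\<lambda>\<xi>. dim (stabilizer \<xi>)) ` dual)"
      using finite_dims[of "stabilizer ` dual"] by (simp add: image_image)
    show "(\<lambda>\<xi>. dim (stabilizer \<xi>)) ` dual \<noteq> {}" using zero_in_dual by blast
  qed
  then obtain \<xi> where "\<xi> \<in> dual" "index = dim (stabilizer \<xi>)" by blast
  then show thesis using that[of \<xi>] by (simp add: dual_reg_def)
qed

lemma even_codim_index: obtains s where "dim UNIV = index + 2 * s"
proof -
  obtain \<xi> where \<xi>: "\<xi> \<in> dual_reg" by (rule dual_reg_nonempty)
  then obtain k where "dim UNIV = dim (stabilizer \<xi>) + 2 * k"
    using even_codim_stabilizer[of \<xi>] dual_reg_subset by blast
  then show thesis using \<xi> that[of k] by (simp add: dual_reg_def)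
qed

lemma subspace_zero_abelian: "subalgebra {0} \<and> abelian {0}"
  by (simp add: subalgebra_def abelian_def bracket_simps)

lemma abelian_subalgebra: "subspace A \<Longrightarrow> abelian A \<Longrightarrow> subalgebra A"
  by (simp add: subalgebra_def abelian_def subspace_0)

lemma dim_le_max_abelian_dim: "subspace A \<Longrightarrow> abelian A \<Longrightarrow> dim A \<le> max_abelian_dim"
  unfolding max_abelian_dim_def using abelian_subalgebra finite_dims by (intro Max_ge) auto

lemma max_abelian_dim_attained:
  obtains A where "subspace A" "abelian A" "dim A = max_abelian_dim"
proof -
  have "max_abelian_dim \<in> dim ` {A. subalgebra A \<and> abelian A}"
    unfolding max_abelian_dim_def
  proof (rule Max_in)
    show "finite (dim ` {A. subalgebra A \<and> abelian A})" by (rule finite_dims)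
    show "dim ` {A. subalgebra A \<and> abelian A} \<noteq> {}" using subspace_zero_abelian by blast
  qed
  then obtain A where "subalgebra A" "abelian A" "max_abelian_dim = dim A" by blast
  then show thesis using that[of A] by (simp add: subalgebra_def)
qed

lemma abelian_isotropic:
  assumes "\<xi> \<in> dual" "subspace A" "abelian A"
  shows "2 * dim A \<le> dim UNIV + dim (A \<inter> stabilizer \<xi>)"
  using dim_isotropic_le[OF assms(1,2)] assms dual_zero unfolding abelian_def by simp

lemma twice_dim_abelian_le:
  assumes "subspace A" "abelian A"
  shows "2 * dim A \<le> dim UNIV + index"
proof -
  obtain \<xi> where \<xi>: "\<xi> \<in> dual_reg" by (rule dual_reg_nonempty)
  have "dim (A \<inter> stabilizer \<xi>) \<le> dim (stabilizer \<xi>)" by (intro dim_subset) simp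
  then show ?thesis using abelian_isotropic[OF _ assms, of \<xi>] \<xi> by (simp add: dual_reg_def)
qed

lemma isotropic_implies_singular:
  assumes \<xi>: "\<xi> \<in> dual" and A: "subspace A" and iso: "\<And>x y. x \<in> A \<Longrightarrow> y \<in> A \<Longrightarrow> \<xi> [x; y] = 0"
    and big: "dim UNIV + index < 2 * dim A"
  shows "\<xi> \<in> dual_sing"
proof -
  have "dim (A \<inter> stabilizer \<xi>) \<le> dim (stabilizer \<xi>)" by (intro dim_subset) simp
  then have "index < dim (stabilizer \<xi>)" using dim_isotropic_le[OF \<xi> A iso] big by simp
  then show ?thesis using \<xi> by (simp add: dual_sing_def dual_reg_def)
qed

lemma commutative_polarization_iff:
  "commutative_polarization P \<longleftrightarrow> subspace P \<and> abelian P \<and> 2 * dim P = dim UNIV + index"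
proof -
  have "real (dim P) = magic_number \<longleftrightarrow> 2 * dim P = dim UNIV + index"
  proof -
    have "real (dim P) = magic_number \<longleftrightarrow> real (2 * dim P) = real (dim UNIV + index)"
      unfolding magic_number_def by (simp add: field_simps)
    then show ?thesis by (simp only: of_nat_eq_iff)
  qed
  then show ?thesis
    using abelian_subalgebra by (auto simp: commutative_polarization_def subalgebra_def)
qed

text \<open>
  For a polarization the inequality \<open>dim_isotropic_le\<close> is an equality, which forces the whole radical
  into it.
\<close>

lemma polarization_contains_stabilizer:
  assumes P: "commutative_polarization P" and \<xi>: "\<xi> \<in> dual_reg"
  shows "stabilizer \<xi> \<subseteq> P"
proof -
  have sP: "subspace P" "abelian P" "2 * dim P = dim UNIV + index"
    using P commutative_polarization_iff by auto
  have \<xi>': "\<xi> \<in> dual" "dim (stabilizer \<xi>) = index" using \<xi> by (auto simp: dual_reg_def)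
  have "dim (stabilizer \<xi>) \<le> dim (P \<inter> stabilizer \<xi>)"
    using abelian_isotropic[OF \<xi>'(1) sP(1,2)] sP(3) \<xi>'(2) by simp
  then have "P \<inter> stabilizer \<xi> = stabilizer \<xi>"
    by (intro subspace_dim_equal) (use sP \<xi>' subspace_stabilizer in \<open>auto intro: subspace_inter\<close>)
  then show ?thesis by blast
qed

lemma polarization_contains_semiradical:
  assumes "commutative_polarization P"
  shows "frobenius_semiradical \<subseteq> P"
  unfolding frobenius_semiradical_def using assms polarization_contains_stabilizer[OF assms]
  by (intro span_minimal) (auto simp: commutative_polarization_iff)

lemma abelian_subset: "abelian B \<Longrightarrow> A \<subseteq> B \<Longrightarrow> abelian A"
  by (auto simp: abelian_def)

lemma subspace_semiradical: "subspace frobenius_semiradical"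
  by (simp add: frobenius_semiradical_def)

lemma stabilizer_subset_semiradical: "\<xi> \<in> dual_reg \<Longrightarrow> stabilizer \<xi> \<subseteq> frobenius_semiradical"
  unfolding frobenius_semiradical_def using span_superset by blast

section \<open>Centers and abelian ideals of nilpotent algebras\<close>

definition centralizer :: "'v set \<Rightarrow> 'v set" where
  "centralizer A = {x. \<forall>a\<in>A. [x; a] = 0}"

lemma subspace_centralizer: "subspace (centralizer A)"
  by (auto simp: subspace_def centralizer_def bracket_simps)

lemma abelian_centralizer: "abelian A \<Longrightarrow> A \<subseteq> centralizer A"
  by (auto simp: abelian_def centralizer_def)

lemma abelian_span_insert:
  assumes A: "subspace A" "abelian A" and e: "e \<in> centralizer A"
  shows "abelian (span (insert e A))"
  unfolding abelian_def
proof (intro ballI)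
  fix x y assume "x \<in> span (insert e A)" "y \<in> span (insert e A)"
  then obtain k l where k: "x - k *s e \<in> A" and l: "y - l *s e \<in> A"
    using mem_span_insert[OF A(1)] by blast
  obtain a b where a: "a \<in> A" "x = a + k *s e" and b: "b \<in> A" "y = b + l *s e"
    using k l by (metis diff_add_cancel)
  have "[a; e] = 0" using e a(1) bracket_anticommute[of a e] by (simp add: centralizer_def)
  then show "[x; y] = 0"
    using a b A(2) e by (simp add: bracket_simps abelian_def centralizer_def)
qed

text \<open>
  If bracketing always led out of \<open>A\<close>, iterated brackets would stay outside \<open>A\<close> while descending
  through the lower central series, which ends at \<open>0\<close>.
\<close>

lemma nilpotent_central_step:
  assumes nil: "nilpotent" and A: "subspace A" "A \<subset> N" and N: "\<And>x y. y \<in> N \<Longrightarrow> [x; y] \<in> N"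
  shows "\<exists>e. e \<in> N \<and> e \<notin> A \<and> (\<forall>x. [x; e] \<in> A)"
proof (rule ccontr)
  assume neg: "\<not> ?thesis"
  have "\<exists>e. e \<in> N \<and> e \<notin> A \<and> e \<in> lower_central m" for m
  proof (induction m)
    case 0
    then show ?case using A(2) by auto
  next
    case (Suc m)
    then obtain e where e: "e \<in> N" "e \<notin> A" "e \<in> lower_central m" by blast
    then obtain x where "[x; e] \<notin> A" using neg by blast
    moreover have "[x; e] \<in> lower_central (Suc m)" using e by (auto intro!: span_base)
    ultimately show ?case using N e(1) by blast
  qed
  moreover obtain m where "lower_central m = {0}" using nil unfolding nilpotent_def by blast
  ultimately obtain e where "e \<notin> A" "e = 0" by blast
  then show False using subspace_0[OF A(1)] by simp
qed

text \<open>
  The ideal is enlarged one vector at a time by a vector of its centralizer that is central modulo the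
  ideal. Adding \<open>e\<close> to an ideal of dimension \<open>j\<close> shrinks the centralizer by at most \<open>j\<close>, since
  \<open>[x; e]\<close> lies in that ideal. This goes on as long as the centralizer is larger than the ideal.
\<close>

lemma nilpotent_abelian_ideal:
  assumes nil: "nilpotent" and "j * (j - 1) < 2 * dim UNIV \<or> j = 0"
  shows "\<exists>A. subspace A \<and> abelian A \<and> (\<forall>x. \<forall>a\<in>A. [x; a] \<in> A) \<and> dim A = j \<and>
    2 * dim UNIV \<le> 2 * dim (centralizer A) + j * (j - 1)"
  using assms(2)
proof (induction j)
  case 0
  have "centralizer {0} = UNIV" by (simp add: centralizer_def bracket_simps)
  then show ?case using subspace_zero_abelian
    by (intro exI[of _ "{0}"]) (auto simp: bracket_simps)
next
  case (Suc j)
  have lt: "Suc j * j < 2 * dim UNIV" using Suc.prems by simp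
  moreover have "j * (j - 1) \<le> Suc j * j" by (intro mult_mono) auto
  ultimately have "j * (j - 1) < 2 * dim UNIV" by simp
  then obtain A where A: "subspace A" "abelian A" "\<And>x a. a \<in> A \<Longrightarrow> [x; a] \<in> A" "dim A = j"
    "2 * dim UNIV \<le> 2 * dim (centralizer A) + j * (j - 1)"
    using Suc.IH by blast
  let ?C = "centralizer A"
  have jj: "Suc j * j = j * (j - 1) + 2 * j" by (cases j) auto
  then have "j < dim ?C" using A(5) lt by simp
  then have "A \<subset> ?C" using abelian_centralizer[OF A(2)] A(4) by auto
  moreover have "[x; y] \<in> ?C" if y: "y \<in> ?C" for x y
  proof -
    have "[[x; y]; a] = 0" if a: "a \<in> A" for a
    proof -
      have "[y; a] = 0" "[y; [a; x]] = 0"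
        using y a A(3)[OF a, of x] bracket_anticommute[of a x]
        by (auto simp: centralizer_def bracket_simps)
      then have "[a; [x; y]] = 0" using jacobi[of x y a] by (simp add: bracket_simps)
      then show ?thesis using bracket_anticommute[of "[x; y]" a] by simp
    qed
    then show ?thesis by (simp add: centralizer_def)
  qed
  ultimately obtain e where e: "e \<in> ?C" "e \<notin> A" "\<And>x. [x; e] \<in> A"
    using nilpotent_central_step[OF nil A(1), of ?C] by blast
  let ?B = "span (insert e A)"
  have B: "\<exists>k. \<exists>a\<in>A. b = a + k *s e" if "b \<in> ?B" for b
    using that mem_span_insert[OF A(1)] by (metis diff_add_cancel)
  have "[x; b] \<in> ?B" if b: "b \<in> ?B" for x b
  proof -
    obtain k a where "a \<in> A" "b = a + k *s e" using B[OF b] by blast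
    then have "[x; b] \<in> A" using A(1,3) e(3) by (simp add: bracket_simps subspace_add subspace_scale)
    then show ?thesis by (intro span_base) simp
  qed
  moreover have "dim ?B = Suc j" using dim_span_insert[OF A(1) e(2)] A(4) by simp
  moreover have "abelian ?B" by (rule abelian_span_insert[OF A(1,2) e(1)])
  moreover have "2 * dim UNIV \<le> 2 * dim (centralizer ?B) + Suc j * j"
  proof -
    have "dim ?C \<le> dim {x \<in> ?C. [x; e] = 0} + dim A"
      by (rule rank_nullity_le[OF subspace_centralizer A(1) bracket_linear_left]) (use e(3) in auto)
    moreover have "{x \<in> ?C. [x; e] = 0} \<subseteq> centralizer ?B"
    proof
      fix x assume x: "x \<in> {x \<in> ?C. [x; e] = 0}"
      have "[x; b] = 0" if b: "b \<in> ?B" for b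
      proof -
        obtain k a where "a \<in> A" "b = a + k *s e" using B[OF b] by blast
        then show ?thesis using x by (simp add: bracket_simps centralizer_def)
      qed
      then show "x \<in> centralizer ?B" by (simp add: centralizer_def)
    qed
    then have "dim {x \<in> ?C. [x; e] = 0} \<le> dim (centralizer ?B)" by (rule dim_subset)
    ultimately show ?thesis using A(4,5) jj by simp
  qed
  ultimately show ?case by (intro exI[of _ ?B]) simp
qed

lemma nilpotent_max_abelian_dim_ge:
  assumes "nilpotent" "j * (j - 1) < 2 * dim UNIV"
  shows "j \<le> max_abelian_dim"
proof -
  obtain A where "subspace A" "abelian A" "dim A = j"
    using nilpotent_abelian_ideal[OF assms(1) disjI1[OF assms(2)]] by blast
  then show ?thesis using dim_le_max_abelian_dim[of A] by simp
qed

definition center :: "'v set" where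
  "center = {z. \<forall>x. [z; x] = 0}"

lemma subspace_center: "subspace center"
  by (auto simp: subspace_def center_def bracket_simps)

lemma center_subset_stabilizer: "\<xi> \<in> dual \<Longrightarrow> center \<subseteq> stabilizer \<xi>"
  by (auto simp: center_def stabilizer_def dual_zero)

lemma nilpotent_center_nontrivial:
  assumes nil: "nilpotent" and "0 < dim UNIV"
  obtains z where "z \<in> center" "z \<noteq> 0"
proof -
  have "{0} \<subset> (UNIV :: 'v set)" using assms(2) dim_eq_0[of UNIV] by (auto simp del: dim_eq_0 dim_UNIV)
  then obtain e where e: "e \<notin> {0}" "\<And>x. [x; e] \<in> {0}"
    using nilpotent_central_step[OF nil subspace_single_0, of UNIV] by blast
  then have "[e; x] = 0" for x using bracket_anticommute[of e x] by simp
  then show thesis using e(1) that[of e] by (simp add: center_def)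
qed

lemma nilpotent_second_center:
  assumes nil: "nilpotent" and "center \<noteq> UNIV"
  shows "\<exists>x. x \<notin> center \<and> (\<forall>y. [x; y] \<in> center)"
proof -
  have "center \<subset> UNIV" using assms(2) by blast
  then obtain e where e: "e \<notin> center" "\<And>x. [x; e] \<in> center"
    using nilpotent_central_step[OF nil subspace_center, of UNIV] by blast
  then have "[e; x] \<in> center" for x
    using bracket_anticommute[of e x] subspace_neg[OF subspace_center] by metis
  then show ?thesis using e(1) by blast
qed

lemma index_pos:
  assumes "nilpotent" "0 < dim UNIV"
  shows "0 < index"
proof -
  obtain z where z: "z \<in> center" "z \<noteq> 0" using nilpotent_center_nontrivial[OF assms] .
  obtain \<xi> where "\<xi> \<in> dual_reg" by (rule dual_reg_nonempty)
  then have \<xi>: "\<xi> \<in> dual" "dim (stabilizer \<xi>) = index" by (auto simp: dual_reg_def)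
  have "z \<in> stabilizer \<xi>" using center_subset_stabilizer[OF \<xi>(1)] z(1) by blast
  then have "\<not> stabilizer \<xi> \<subseteq> {0}" using z(2) by blast
  then show ?thesis using \<xi>(2) dim_eq_0[of "stabilizer \<xi>"] by simp
qed

end

section \<open>Polynomial functions on the dual\<close>

text \<open>
  A separate locale, because it constrains the sort of the scalar field: polynomial functions
  behave like polynomials only over infinite fields, eigenvectors and points of quadrics need roots of
  quadratic polynomials, and polarization needs \<open>2 \<noteq> 0\<close>.
\<close>

locale acf_lie_algebra = lie_algebra scale Basis bracket
  for scale :: "'k::{alg_closed_field, field_char_0} \<Rightarrow> 'v::ab_group_add \<Rightarrow> 'v"
    and Basis :: "'v set"
    and bracket :: "'v \<Rightarrow> 'v \<Rightarrow> 'v"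
begin

lemma dual_line: "\<xi> \<in> dual \<Longrightarrow> \<eta> \<in> dual \<Longrightarrow> (\<lambda>x. \<xi> x + t * \<eta> x) \<in> dual"
  by (simp add: dual_iff algebra_simps)

lemma poly_function_on_line:
  assumes "p \<in> poly_functions"
  shows "\<exists>P. \<forall>t. p (\<lambda>x. \<xi> x + t * \<eta> x) = poly P t"
  using assms
proof induction
  case (const c)
  show ?case by (rule exI[of _ "[:c:]"]) simp
next
  case (eval_at x)
  show ?case by (rule exI[of _ "[:\<xi> x, \<eta> x:]"]) simp
next
  case (add p q)
  then show ?case by (metis poly_add)
next
  case (mult p q)
  then show ?case by (metis poly_mult)
qed

text \<open>
  The dual space is irreducible: restrict both functions to the line through the two points, where
  they are nonzero polynomials in one variable.
\<close>

lemma poly_functions_common_nonzero: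
  assumes p: "p \<in> poly_functions" "\<xi> \<in> dual" "p \<xi> \<noteq> 0"
    and q: "q \<in> poly_functions" "\<eta> \<in> dual" "q \<eta> \<noteq> 0"
  obtains \<zeta> where "\<zeta> \<in> dual" "p \<zeta> \<noteq> 0" "q \<zeta> \<noteq> 0"
proof -
  define \<delta> where "\<delta> = (\<lambda>x. \<eta> x + (-1) * \<xi> x)"
  have \<delta>: "\<delta> \<in> dual" unfolding \<delta>_def by (rule dual_line[OF q(2) p(2)])
  obtain P where P: "\<And>t. p (\<lambda>x. \<xi> x + t * \<delta> x) = poly P t"
    using poly_function_on_line[OF p(1)] by blast
  obtain Q where Q: "\<And>t. q (\<lambda>x. \<xi> x + t * \<delta> x) = poly Q t"
    using poly_function_on_line[OF q(1)] by blast
  have "poly P 0 \<noteq> 0" using P[of 0] p(3) by simp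
  moreover have "poly Q 1 \<noteq> 0" using Q[of 1] q(3) by (simp add: \<delta>_def)
  ultimately have "P * Q \<noteq> 0" by auto
  then obtain t where "poly (P * Q) t \<noteq> 0" using poly_all_0_iff_0 by blast
  then show thesis
    using that[of "\<lambda>x. \<xi> x + t * \<delta> x"] P[of t] Q[of t] dual_line[OF p(2) \<delta>] by simp
qed

lemma pfaffian_poly: "(\<lambda>\<xi>. pfaffian \<xi> w x y z) \<in> poly_functions"
proof -
  have "(\<lambda>\<xi>. \<xi> [w; x] * \<xi> [y; z] + (-1) * (\<xi> [w; y] * \<xi> [x; z]) + \<xi> [w; z] * \<xi> [x; y]) \<in> poly_functions"
    by (intro poly_functions.intros)
  then show ?thesis by (simp add: pfaffian_def)
qed

lemma dual_separates: "(\<And>\<xi>. \<xi> \<in> dual \<Longrightarrow> \<xi> x = \<xi> y) \<Longrightarrow> x = y"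
  using separate_point[of "{0}" "x - y"] dual_diff
  by (metis dual_def eq_iff_diff_eq_0 mem_Collect_eq singletonD subspace_single_0 zero_neq_one)

lemma dual_nonzero:
  assumes "x \<noteq> 0" obtains \<xi> where "\<xi> \<in> dual" "\<xi> x \<noteq> 0"
  using dual_separates[of x 0] assms dual_zero by metis

lemma product_zero:
  assumes "\<And>\<xi>. \<xi> \<in> dual \<Longrightarrow> \<xi> a * \<xi> b = 0"
  shows "a = 0 \<or> b = 0"
proof (rule ccontr)
  assume ne: "\<not> ?thesis"
  obtain \<xi> where \<xi>: "\<xi> \<in> dual" "\<xi> a \<noteq> 0" using dual_nonzero ne by blast
  obtain \<eta> where \<eta>: "\<eta> \<in> dual" "\<eta> b \<noteq> 0" using dual_nonzero ne by blast
  obtain \<zeta> where "\<zeta> \<in> dual" "\<zeta> a \<noteq> 0" "\<zeta> b \<noteq> 0"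
    using poly_functions_common_nonzero[OF poly_functions.eval_at \<xi> poly_functions.eval_at \<eta>] .
  then show False using assms[of \<zeta>] by simp
qed

section \<open>Syzygies of linear forms\<close>

definition independent2 :: "'v \<Rightarrow> 'v \<Rightarrow> bool" where
  "independent2 u v \<longleftrightarrow> (\<forall>a b. a *s u + b *s v = 0 \<longrightarrow> a = 0 \<and> b = 0)"

definition independent3 :: "'v \<Rightarrow> 'v \<Rightarrow> 'v \<Rightarrow> bool" where
  "independent3 u v w \<longleftrightarrow> (\<forall>a b c. a *s u + b *s v + c *s w = 0 \<longrightarrow> a = 0 \<and> b = 0 \<and> c = 0)"

lemma dual_triple_first:
  assumes "independent3 u v w"
  obtains \<alpha> where "\<alpha> \<in> dual" "\<alpha> u = 1" "\<alpha> v = 0" "\<alpha> w = 0"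
proof -
  have "u \<notin> span {v, w}"
  proof
    assume "u \<in> span {v, w}"
    then obtain b c where "u - b *s v - c *s w = 0"
      by (auto simp: span_breakdown_eq)
    then have "1 *s u + (- b) *s v + (- c) *s w = 0" by simp
    then show False using assms unfolding independent3_def by (metis zero_neq_one)
  qed
  then obtain \<alpha> where \<alpha>: "Vector_Spaces.linear scale (*) \<alpha>"
    "\<And>x. x \<in> span {v, w} \<Longrightarrow> \<alpha> x = 0" "\<alpha> u = 1"
    using separate_point[OF subspace_span] by blast
  have "v \<in> span {v, w}" "w \<in> span {v, w}" by (auto intro: span_base)
  then show thesis using that \<alpha> by (simp add: dual_def)
qed

lemma independent3_rotate: "independent3 u v w \<Longrightarrow> independent3 v w u"
  unfolding independent3_def by (metis add.assoc add.commute)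

lemma independent3_swap: "independent3 u v w \<Longrightarrow> independent3 v u w"
  unfolding independent3_def by (metis add.commute)

lemma dual_pair_first:
  assumes "independent2 u v"
  obtains \<alpha> where "\<alpha> \<in> dual" "\<alpha> u = 1" "\<alpha> v = 0"
proof -
  have "u \<notin> span {v}"
  proof
    assume "u \<in> span {v}"
    then obtain b where "u - b *s v = 0"
      by (auto simp: span_breakdown_eq)
    then have "1 *s u + (- b) *s v = 0" by simp
    then show False using assms unfolding independent2_def by (metis zero_neq_one)
  qed
  then obtain \<alpha> where \<alpha>: "Vector_Spaces.linear scale (*) \<alpha>"
    "\<And>x. x \<in> span {v} \<Longrightarrow> \<alpha> x = 0" "\<alpha> u = 1"
    using separate_point[OF subspace_span] by blast
  have "v \<in> span {v}" by (auto intro: span_base)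
  then show thesis using that \<alpha> by (simp add: dual_def)
qed

lemma independent2_swap: "independent2 u v \<Longrightarrow> independent2 v u"
  unfolding independent2_def by (metis add.commute)

text \<open>
  Independent linear forms \<open>u\<close>, \<open>v\<close> on the dual are coprime, so \<open>p v = q u\<close> makes \<open>p\<close> and \<open>q\<close> the same
  multiple of \<open>u\<close> and \<open>v\<close>. As everything has degree one, it suffices to polarize the identity and
  evaluate it on dual vectors.
\<close>

lemma syzygy2:
  assumes ind: "independent2 u v"
    and eq: "\<And>\<xi>. \<xi> \<in> dual \<Longrightarrow> \<xi> p * \<xi> v = \<xi> q * \<xi> u"
  obtains c where "p = c *s u" "q = c *s v"
proof -
  obtain \<alpha> where \<alpha>: "\<alpha> \<in> dual" "\<alpha> u = 1" "\<alpha> v = 0" using dual_pair_first[OF ind] .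
  obtain \<beta> where \<beta>: "\<beta> \<in> dual" "\<beta> v = 1" "\<beta> u = 0"
    using dual_pair_first[OF independent2_swap[OF ind]] .
  have polar: "\<xi> p * \<eta> v + \<eta> p * \<xi> v = \<xi> q * \<eta> u + \<eta> q * \<xi> u"
    if "\<xi> \<in> dual" "\<eta> \<in> dual" for \<xi> \<eta>
    using eq[OF dual_closed_add[OF that]] eq[OF that(1)] eq[OF that(2)] by (simp add: algebra_simps)
  have 1: "\<alpha> q = 0" "\<beta> p = 0" "\<alpha> p = \<beta> q"
    using eq[OF \<alpha>(1)] eq[OF \<beta>(1)] polar[OF \<alpha>(1) \<beta>(1)] \<alpha> \<beta> by simp_all
  have 2: "\<xi> p = \<alpha> p * \<xi> u \<and> \<xi> q = \<alpha> p * \<xi> v" if \<xi>: "\<xi> \<in> dual" for \<xi>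
  proof -
    let ?\<xi> = "\<lambda>x. (\<xi> x + (- \<xi> u) * \<alpha> x) + (- \<xi> v) * \<beta> x"
    have d: "?\<xi> \<in> dual" by (intro dual_line \<xi> \<alpha> \<beta>)
    show ?thesis using polar[OF d \<alpha>(1)] polar[OF d \<beta>(1)] 1 \<alpha> \<beta> by (simp add: algebra_simps)
  qed
  show thesis
    by (rule that[of "\<alpha> p"]; rule dual_separates) (use 2 dual_scale in auto)
qed

text \<open>
  The linear case of the exactness of the Koszul complex of three independent linear forms, by
  polarization as in \<open>syzygy2\<close>.
\<close>

lemma syzygy3:
  assumes ind: "independent3 A B C"
    and eq: "\<And>\<xi>. \<xi> \<in> dual \<Longrightarrow> \<xi> a * \<xi> A - \<xi> b * \<xi> B + \<xi> c * \<xi> C = 0"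
  obtains p q r where "a = p *s B + q *s C" "b = p *s A - r *s C" "c = - (q *s A) - r *s B"
proof -
  obtain \<alpha> where \<alpha>: "\<alpha> \<in> dual" "\<alpha> A = 1" "\<alpha> B = 0" "\<alpha> C = 0" using dual_triple_first[OF ind] .
  obtain \<beta> where \<beta>: "\<beta> \<in> dual" "\<beta> B = 1" "\<beta> A = 0" "\<beta> C = 0"
    using dual_triple_first[OF independent3_swap[OF ind]] .
  obtain \<gamma> where \<gamma>: "\<gamma> \<in> dual" "\<gamma> C = 1" "\<gamma> A = 0" "\<gamma> B = 0"
    using dual_triple_first[OF independent3_rotate[OF independent3_rotate[OF ind]]] .
  have polar: "\<xi> a * \<eta> A + \<eta> a * \<xi> A - (\<xi> b * \<eta> B + \<eta> b * \<xi> B) + (\<xi> c * \<eta> C + \<eta> c * \<xi> C) = 0"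
    if "\<xi> \<in> dual" "\<eta> \<in> dual" for \<xi> \<eta>
  proof -
    have "\<xi> a * \<eta> A + \<eta> a * \<xi> A - (\<xi> b * \<eta> B + \<eta> b * \<xi> B) + (\<xi> c * \<eta> C + \<eta> c * \<xi> C)
      = ((\<xi> a + \<eta> a) * (\<xi> A + \<eta> A) - (\<xi> b + \<eta> b) * (\<xi> B + \<eta> B) + (\<xi> c + \<eta> c) * (\<xi> C + \<eta> C))
        - (\<xi> a * \<xi> A - \<xi> b * \<xi> B + \<xi> c * \<xi> C) - (\<eta> a * \<eta> A - \<eta> b * \<eta> B + \<eta> c * \<eta> C)"
      by (simp add: algebra_simps)
    also have "\<dots> = 0"
      using eq[OF dual_closed_add[OF that]] eq[OF that(1)] eq[OF that(2)] by simp
    finally show ?thesis .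
  qed
  have 1: "\<alpha> a = 0" "\<beta> b = 0" "\<gamma> c = 0" "\<alpha> b = \<beta> a" "\<alpha> c = - \<gamma> a" "\<beta> c = \<gamma> b"
    using eq[OF \<alpha>(1)] eq[OF \<beta>(1)] eq[OF \<gamma>(1)] polar[OF \<alpha>(1) \<beta>(1)] polar[OF \<alpha>(1) \<gamma>(1)]
      polar[OF \<beta>(1) \<gamma>(1)] \<alpha> \<beta> \<gamma> by (simp_all add: algebra_simps eq_neg_iff_add_eq_0)
  have 2: "\<xi> a = \<beta> a * \<xi> B + \<gamma> a * \<xi> C \<and> \<xi> b = \<beta> a * \<xi> A + \<gamma> b * \<xi> C
      \<and> \<xi> c = - (\<gamma> a * \<xi> A) + \<gamma> b * \<xi> B" if \<xi>: "\<xi> \<in> dual" for \<xi>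
  proof -
    let ?\<xi> = "\<lambda>x. ((\<xi> x + (- \<xi> A) * \<alpha> x) + (- \<xi> B) * \<beta> x) + (- \<xi> C) * \<gamma> x"
    have d: "?\<xi> \<in> dual" by (intro dual_line \<xi> \<alpha> \<beta> \<gamma>)
    show ?thesis
      using polar[OF d \<alpha>(1)] polar[OF d \<beta>(1)] polar[OF d \<gamma>(1)] 1 \<alpha> \<beta> \<gamma>
      by (simp add: algebra_simps)
  qed
  show thesis
    by (rule that[of "\<beta> a" "\<gamma> a" "- \<gamma> b"]; rule dual_separates) (use 2 dual_simps in auto)
qed

section \<open>Brackets whose forms have rank at most two\<close>

text \<open>
  Under these assumptions the Pfaffian is the product \<open>\<xi> [w; w'] * \<xi> [x; y]\<close>, and the polynomial functions on
  the dual have no zero divisors.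
\<close>

lemma commute_if_pfaffian_zero:
  assumes pf: "\<And>\<xi>. \<xi> \<in> dual \<Longrightarrow> pfaffian \<xi> w w' x y = 0"
    and "[w; y] = 0" "[w'; y] = 0" "[x; y] \<noteq> 0"
  shows "[w; w'] = 0"
proof -
  have "\<xi> [w; w'] * \<xi> [x; y] = 0" if "\<xi> \<in> dual" for \<xi>
    using pf[OF that] assms(2,3) dual_zero[OF that] by (simp add: pfaffian_def)
  then show ?thesis using product_zero assms(4) by blast
qed

lemma subspace_commutant: "subspace H \<Longrightarrow> subspace {w \<in> H. [w; y] = 0}"
  by (auto simp: subspace_def bracket_simps)

text \<open>
  The vectors of \<open>H\<close> commuting with \<open>y\<close> form an abelian subspace as soon as \<open>y\<close> does not commute with
  all of \<open>H\<close>, by \<open>commute_if_pfaffian_zero\<close>; the hypothesis on \<open>[w; y]\<close> makes it a hyperplane.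
\<close>

lemma pfaffian_hyperplane:
  assumes H: "subspace H"
    and pf: "\<And>\<xi> w x y z. \<xi> \<in> dual \<Longrightarrow> w \<in> H \<Longrightarrow> x \<in> H \<Longrightarrow> y \<in> H \<Longrightarrow> z \<in> H \<Longrightarrow> pfaffian \<xi> w x y z = 0"
    and xy: "x \<in> H" "y \<in> H" "[x; y] \<noteq> 0"
    and rank1: "\<And>w. w \<in> H \<Longrightarrow> \<exists>c. [w; y] = c *s [x; y]"
  shows "\<exists>A. subspace A \<and> A \<subseteq> H \<and> abelian A \<and> dim H \<le> dim A + 1"
proof -
  let ?A = "{w \<in> H. [w; y] = 0}"
  have A: "subspace ?A" by (rule subspace_commutant[OF H])
  have "H \<subseteq> span (insert x ?A)"
  proof
    fix w assume w: "w \<in> H"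
    then obtain c where "[w; y] = c *s [x; y]" using rank1 by blast
    then have "w - c *s x \<in> ?A" using w xy H by (simp add: bracket_simps subspace_diff subspace_scale)
    then show "w \<in> span (insert x ?A)" using mem_span_insert[OF A] by blast
  qed
  then have "dim H \<le> dim ?A + 1" using dim_mono[of H "insert x ?A"] dim_span_insert_le[of x ?A] by simp
  moreover have "abelian ?A"
    unfolding abelian_def using commute_if_pfaffian_zero[OF pf, of _ _ x y] xy by blast
  ultimately show ?thesis using A by blast
qed

text \<open>
  The bracket of \<open>H\<close> factors through the three-dimensional space \<open>H/K\<close> and is injective on
  its exterior square, as in the free two-step nilpotent algebra on three generators. In dimension
  three all bivectors are decomposable, so it is enough to say that commuting vectors are proportional.
\<close>

definition free_modulo :: "'v set \<Rightarrow> 'v set \<Rightarrow> bool" where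
  "free_modulo K H \<longleftrightarrow> subspace K \<and> K \<subseteq> H \<and> dim H = dim K + 3 \<and> (\<forall>k\<in>K. \<forall>h\<in>H. [k; h] = 0) \<and>
     (\<forall>x\<in>H. \<forall>y\<in>H. [x; y] = 0 \<longrightarrow> (\<exists>a b. (a \<noteq> 0 \<or> b \<noteq> 0) \<and> a *s x + b *s y \<in> K))"

text \<open>
  Vanishing of the Pfaffian of \<open>w, x, y, z\<close> is a linear relation among the three independent forms
  \<open>[y; z]\<close>, \<open>[x; z]\<close>, \<open>[x; y]\<close>. The Koszul relations say exactly that \<open>w\<close> can be corrected by a
  combination of \<open>x, y, z\<close> to a vector commuting with all three.
\<close>

lemma pfaffian_free:
  assumes H: "subspace H"
    and pf: "\<And>\<xi> w x y z. \<xi> \<in> dual \<Longrightarrow> w \<in> H \<Longrightarrow> x \<in> H \<Longrightarrow> y \<in> H \<Longrightarrow> z \<in> H \<Longrightarrow> pfaffian \<xi> w x y z = 0"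
    and xyz: "x \<in> H" "y \<in> H" "z \<in> H"
    and ind: "independent3 [y; z] [x; z] [x; y]"
  shows "\<exists>K. free_modulo K H"
proof -
  define K where "K = {w \<in> H. [w; x] = 0 \<and> [w; y] = 0 \<and> [w; z] = 0}"
  have K: "subspace K" "K \<subseteq> H"
    using H by (auto simp: K_def subspace_def bracket_simps)
  have ind': "a = 0 \<and> b = 0 \<and> c = 0" if "a *s [y; z] + b *s [x; z] + c *s [x; y] = 0" for a b c
    using ind that unfolding independent3_def by blast
  have xy: "[x; y] \<noteq> 0" using ind'[of 0 0 1] by auto
  have flip: "[y; x] = - [x; y]" "[z; x] = - [x; z]" "[z; y] = - [y; z]"
    by (rule bracket_anticommute)+
  have decomp: "\<exists>k\<in>K. \<exists>a b c. w = k + a *s x + b *s y + c *s z" if w: "w \<in> H" for w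
  proof -
    have "\<xi> [w; x] * \<xi> [y; z] - \<xi> [w; y] * \<xi> [x; z] + \<xi> [w; z] * \<xi> [x; y] = 0" if "\<xi> \<in> dual" for \<xi>
      using pf[OF that w xyz] by (simp add: pfaffian_def)
    then obtain p q r where pqr: "[w; x] = p *s [x; z] + q *s [x; y]"
      "[w; y] = p *s [y; z] - r *s [x; y]" "[w; z] = - (q *s [y; z]) - r *s [x; z]"
      using syzygy3[OF ind] by blast
    \<comment> \<open>The coefficients of the syzygy are those of the correction.\<close>
    define k where "k = w + r *s x + q *s y + p *s z"
    have "k \<in> K"
      unfolding K_def k_def using w xyz H
      by (simp add: bracket_simps pqr flip subspace_add subspace_scale algebra_simps)
    moreover have "w = k + (- r) *s x + (- q) *s y + (- p) *s z" by (simp add: k_def)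
    ultimately show ?thesis by blast
  qed
  have KK: "[k; k'] = 0" if "k \<in> K" "k' \<in> K" for k k'
    by (rule commute_if_pfaffian_zero[of k k' x y]) (use that xyz xy pf in \<open>auto simp: K_def\<close>)
  have central: "[k; h] = 0" if k: "k \<in> K" and h: "h \<in> H" for k h
  proof -
    obtain k' a b c where "k' \<in> K" "h = k' + a *s x + b *s y + c *s z" using decomp[OF h] by blast
    then show ?thesis using KK[OF k] k by (simp add: bracket_simps K_def)
  qed
  have dimH: "dim H = dim K + 3"
  proof -
    have z: "z \<notin> K" using ind'[of 0 1 0] flip by (auto simp: K_def)
    define S1 where "S1 = span (insert z K)"
    define S2 where "S2 = span (insert y S1)"
    define S3 where "S3 = span (insert x S2)"
    have sub: "subspace S1" "subspace S2" by (auto simp: S1_def S2_def)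
    have y: "y \<notin> S1"
    proof
      assume "y \<in> S1"
      then obtain c where "y - c *s z \<in> K" using mem_span_insert[OF K(1)] S1_def by blast
      then have "[y; z] = 0" by (simp add: K_def bracket_simps)
      then show False using ind'[of 1 0 0] by simp
    qed
    have x: "x \<notin> S2"
    proof
      assume "x \<in> S2"
      then obtain b c where "x - b *s y - c *s z \<in> K"
        using mem_span_insert[OF K(1)] mem_span_insert[OF sub(1)] S1_def S2_def by blast
      then have "[x; y] + c *s [y; z] = 0" by (simp add: K_def bracket_simps flip)
      then show False using ind'[of c 0 1] by (simp add: add.commute)
    qed
    have "S3 \<subseteq> H"
      unfolding S3_def S2_def S1_def
      by (intro span_minimal insert_subsetI) (use H K xyz in auto)
    moreover have "w \<in> S3" if w: "w \<in> H" for w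
    proof -
      obtain k a b c where k: "k \<in> K" "w = k + a *s x + b *s y + c *s z" using decomp[OF w] by blast
      then have "w - a *s x - b *s y - c *s z \<in> K" by simp
      then show ?thesis
        using mem_span_insert[OF K(1)] mem_span_insert[OF sub(1)] mem_span_insert[OF sub(2)]
          S1_def S2_def S3_def by blast
    qed
    ultimately have "S3 = H" by blast
    then show ?thesis
      using dim_span_insert[OF K(1) z] dim_span_insert[OF sub(1) y] dim_span_insert[OF sub(2) x]
      by (simp add: S1_def S2_def S3_def)
  qed
  have inj: "\<exists>s t. (s \<noteq> 0 \<or> t \<noteq> 0) \<and> s *s h + t *s h' \<in> K"
    if h: "h \<in> H" "h' \<in> H" "[h; h'] = 0" for h h'
  proof -
    obtain k a b c where k: "k \<in> K" "h = k + a *s x + b *s y + c *s z" using decomp[OF h(1)] by blast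
    obtain k' a' b' c' where k': "k' \<in> K" "h' = k' + a' *s x + b' *s y + c' *s z"
      using decomp[OF h(2)] by blast
    have kh: "[k; h'] = 0" "[h; k'] = 0"
      using central k k' h bracket_anticommute[of h k'] by auto
    have kx: "[k; x] = 0" "[k; y] = 0" "[k; z] = 0" using k by (auto simp: K_def)
    have "[h; h'] = [h; a' *s x + b' *s y + c' *s z]"
      unfolding k'(2) using kh(2) by (simp add: bracket_simps)
    also have "\<dots> = (b * c' - b' * c) *s [y; z] + (a * c' - a' * c) *s [x; z] + (a * b' - a' * b) *s [x; y]"
      unfolding k(2) using kx by (simp add: bracket_simps flip algebra_simps)
    finally have 0: "b * c' - b' * c = 0" "a * c' - a' * c = 0" "a * b' - a' * b = 0"
      using ind' h(3) by metis+
    have comb: "s *s h + t *s h' = (s *s k + t *s k') + (s * a + t * a') *s x + (s * b + t * b') *s y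
      + (s * c + t * c') *s z" for s t
      unfolding k(2) k'(2) by (simp add: algebra_simps)
    have kk: "s *s k + t *s k' \<in> K" for s t
      using K(1) k(1) k'(1) by (simp add: subspace_add subspace_scale)
    consider "a = 0" "b = 0" "c = 0" | "a \<noteq> 0" | "b \<noteq> 0" | "c \<noteq> 0" by blast
    then show ?thesis
    proof cases
      case 1
      then show ?thesis using kk[of 1 0] comb[of 1 0] by (intro exI[of _ 1] exI[of _ 0]) simp
    next
      case 2
      have "(- a') *s h + a *s h' \<in> K"
        unfolding comb using kk[of "- a'" a] 0 by (simp add: mult.commute)
      then show ?thesis using 2 by blast
    next
      case 3
      have "(- b') *s h + b *s h' \<in> K"
        unfolding comb using kk[of "- b'" b] 0 by (simp add: mult.commute)
      then show ?thesis using 3 by blast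
    next
      case 4
      have "(- c') *s h + c *s h' \<in> K"
        unfolding comb using kk[of "- c'" c] 0 by (simp add: mult.commute)
      then show ?thesis using 4 by blast
    qed
  qed
  show ?thesis unfolding free_modulo_def using K dimH central inj by blast
qed

text \<open>
  A linear space of alternating forms of rank at most two consists of multiples of one linear form, or
  of forms in three variables. Here the choice is made by the triples
  \<open>[y; z]\<close>, \<open>[x; z]\<close>, \<open>[x; y]\<close>: an independent one gives the second alternative, and in a dependent one,
  with \<open>[x; y]\<close> and \<open>[x; z]\<close> independent, \<open>y\<close> and \<open>z\<close> commute after adding multiples of \<open>x\<close>.
\<close>

lemma pfaffian_dichotomy:
  assumes H: "subspace H"
    and pf: "\<And>\<xi> w x y z. \<xi> \<in> dual \<Longrightarrow> w \<in> H \<Longrightarrow> x \<in> H \<Longrightarrow> y \<in> H \<Longrightarrow> z \<in> H \<Longrightarrow> pfaffian \<xi> w x y z = 0"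
  shows "(\<exists>A. subspace A \<and> A \<subseteq> H \<and> abelian A \<and> dim H \<le> dim A + 1) \<or> (\<exists>K. free_modulo K H)"
proof (cases "abelian H")
  case True
  then show ?thesis using H by (intro disjI1 exI[of _ H]) simp
next
  case False
  then obtain x y where xy: "x \<in> H" "y \<in> H" "[x; y] \<noteq> 0" by (auto simp: abelian_def)
  show ?thesis
  proof (cases "\<forall>w\<in>H. \<exists>c. [w; x] = c *s [y; x]")
    case True
    have "[y; x] \<noteq> 0" using xy(3) bracket_anticommute[of x y] by auto
    then show ?thesis using pfaffian_hyperplane[OF H pf xy(2,1)] True by blast
  next
    case False
    then obtain z where z: "z \<in> H" "\<And>c. [z; x] \<noteq> c *s [y; x]" by blast
    have zx: "[x; z] \<noteq> c *s [x; y]" for c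
      using z(2)[of c] bracket_anticommute[of z x] bracket_anticommute[of y x] by simp
    have ind2: "b = 0 \<and> a = 0" if ab: "a *s [x; y] + b *s [x; z] = 0" for a b
    proof -
      have b: "b = 0"
      proof (rule ccontr)
        assume b: "b \<noteq> 0"
        have "b *s [x; z] = (- a) *s [x; y]" using ab by (simp add: add.commute eq_neg_iff_add_eq_0)
        then have "inverse b *s (b *s [x; z]) = inverse b *s ((- a) *s [x; y])" by simp
        then have "[x; z] = (inverse b * - a) *s [x; y]" using b by simp
        then show False using zx by blast
      qed
      then show ?thesis using ab xy(3) by simp
    qed
    show ?thesis
    proof (cases "independent3 [y; z] [x; z] [x; y]")
      case True
      then show ?thesis using pfaffian_free[OF H pf xy(1,2) z(1)] by blast
    next
      case False
      then obtain a b c where abc: "a *s [y; z] + b *s [x; z] + c *s [x; y] = 0"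
        and nz: "a \<noteq> 0 \<or> b \<noteq> 0 \<or> c \<noteq> 0" by (auto simp: independent3_def)
      have a: "a \<noteq> 0" using ind2[of c b] abc nz by (auto simp: add.commute)
      \<comment> \<open>The bracket of \<open>y + s x\<close> and \<open>z + t x\<close> is \<open>[y; z] + s [x; z] - t [x; y]\<close>; these \<open>s\<close>, \<open>t\<close> cancel the dependence.\<close>
      define y' where "y' = y + (b / a) *s x"
      define z' where "z' = z - (c / a) *s x"
      have yz': "[y'; z'] = 0"
      proof -
        have "[y'; z'] = [y; z] + (b / a) *s [x; z] + (c / a) *s [x; y]"
          unfolding y'_def z'_def using bracket_anticommute[of y x] by (simp add: bracket_simps)
        also have "\<dots> = inverse a *s (a *s [y; z] + b *s [x; z] + c *s [x; y])"
          using a by (simp add: scale_right_distrib field_simps)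
        finally show ?thesis using abc by simp
      qed
      have xy': "[x; y'] = [x; y]" "[x; z'] = [x; z]" by (simp_all add: y'_def z'_def bracket_simps)
      have H': "y' \<in> H" "z' \<in> H"
        using xy z H by (simp_all add: y'_def z'_def subspace_add subspace_diff subspace_scale)
      have "\<exists>c. [w; y'] = c *s [x; y']" if w: "w \<in> H" for w
      proof -
        have "\<xi> [w; y'] * \<xi> [x; z] = \<xi> [w; z'] * \<xi> [x; y]" if "\<xi> \<in> dual" for \<xi>
          using pf[OF that w xy(1) H'] yz' dual_zero[OF that] by (simp add: pfaffian_def xy')
        moreover have "independent2 [x; y] [x; z]"
          unfolding independent2_def using ind2 by blast
        ultimately obtain d where "[w; y'] = d *s [x; y]" using syzygy2 by blast
        then show ?thesis using xy' by auto
      qed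
      then show ?thesis using pfaffian_hyperplane[OF H pf xy(1) H'(1)] xy' xy(3) by auto
    qed
  qed
qed

section \<open>Abelian subspaces from the Frobenius semiradical\<close>

text \<open>
  A basic open set of regular functionals. It serves to extend what is known for regular
  functionals to all of them, by density.
\<close>

definition regularity_witness :: "(('v \<Rightarrow> 'k) \<Rightarrow> 'k) \<Rightarrow> bool" where
  "regularity_witness r \<longleftrightarrow> r \<in> poly_functions \<and> (\<exists>\<xi>\<in>dual. r \<xi> \<noteq> 0) \<and>
     (\<forall>\<xi>\<in>dual. r \<xi> \<noteq> 0 \<longrightarrow> \<xi> \<in> dual_reg)"

lemma regularity_witness_exists:
  assumes "dim UNIV = index + 2 \<or> dim UNIV = index + 4"
  shows "\<exists>r. regularity_witness r"
proof -
  obtain \<eta> where "\<eta> \<in> dual_reg" by (rule dual_reg_nonempty)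
  then have \<eta>: "\<eta> \<in> dual" "dim (stabilizer \<eta>) = index" by (auto simp: dual_reg_def)
  have reg: "\<xi> \<in> dual_reg" if "\<xi> \<in> dual" "dim (stabilizer \<xi>) \<le> index" for \<xi>
    using that index_le[OF that(1)] by (simp add: dual_reg_def)
  show ?thesis using assms
  proof
    assume n: "dim UNIV = index + 2"
    then have "stabilizer \<eta> \<noteq> UNIV" using \<eta>(2) by auto
    then obtain x y where xy: "\<eta> [x; y] \<noteq> 0" by (auto simp: stabilizer_def)
    have "\<xi> \<in> dual_reg" if \<xi>: "\<xi> \<in> dual" "\<xi> [x; y] \<noteq> 0" for \<xi>
    proof -
      have "dim (stabilizer \<xi>) \<noteq> dim UNIV"
      proof
        assume "dim (stabilizer \<xi>) = dim UNIV"
        then have "stabilizer \<xi> = UNIV"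
          using subspace_dim_equal[OF subspace_stabilizer[OF \<xi>(1)] subspace_UNIV] by simp
        then show False using \<xi>(2) by (auto simp: stabilizer_def)
      qed
      moreover obtain k where "dim UNIV = dim (stabilizer \<xi>) + 2 * k"
        using even_codim_stabilizer[OF \<xi>(1)] by blast
      ultimately have "dim (stabilizer \<xi>) \<le> index" using n by (cases k) auto
      then show ?thesis using reg \<xi>(1) by blast
    qed
    then have "regularity_witness (\<lambda>\<xi>. \<xi> [x; y])"
      unfolding regularity_witness_def using poly_functions.eval_at \<eta>(1) xy by auto
    then show ?thesis by blast
  next
    assume n: "dim UNIV = index + 4"
    have "dim (stabilizer \<eta>) + 2 < dim UNIV" using n \<eta>(2) by linarith
    then obtain w x y z where pf: "pfaffian \<eta> w x y z \<noteq> 0"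
      by (rule pfaffian_nonzero_exists[OF \<eta>(1)])
    have "\<xi> \<in> dual_reg" if \<xi>: "\<xi> \<in> dual" "pfaffian \<xi> w x y z \<noteq> 0" for \<xi>
    proof -
      have "dim (stabilizer \<xi>) + 4 \<le> dim UNIV"
        by (rule dim_stabilizer_pfaffian[OF \<xi>]) auto
      then show ?thesis using reg \<xi>(1) n by simp
    qed
    then have "regularity_witness (\<lambda>\<xi>. pfaffian \<xi> w x y z)"
      unfolding regularity_witness_def using pfaffian_poly \<eta>(1) pf by auto
    then show ?thesis by blast
  qed
qed

lemma regular_common_nonzero:
  assumes r: "regularity_witness r" and q: "q \<in> poly_functions" "\<eta> \<in> dual" "q \<eta> \<noteq> 0"
  obtains \<zeta> where "\<zeta> \<in> dual" "r \<zeta> \<noteq> 0" "\<zeta> \<in> dual_reg" "q \<zeta> \<noteq> 0"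
proof -
  have r': "r \<in> poly_functions" "\<exists>\<xi>\<in>dual. r \<xi> \<noteq> 0" "\<forall>\<xi>\<in>dual. r \<xi> \<noteq> 0 \<longrightarrow> \<xi> \<in> dual_reg"
    using r by (auto simp: regularity_witness_def)
  obtain \<xi> where \<xi>: "\<xi> \<in> dual" "r \<xi> \<noteq> 0" using r'(2) by (rule bexE)
  obtain \<zeta> where \<zeta>: "\<zeta> \<in> dual" "r \<zeta> \<noteq> 0" "q \<zeta> \<noteq> 0"
    by (rule poly_functions_common_nonzero[OF r'(1) \<xi> q])
  have "\<zeta> \<in> dual_reg" using r'(3) \<zeta>(1,2) by simp
  then show thesis using \<zeta> that[of \<zeta>] by simp
qed

text \<open>
  Proportionality of commuting vectors leaves room for only one direction \<open>f\<close> of an abelian \<open>F\<close> outside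
  \<open>K\<close>, and \<open>f\<close> can only lie in the radical of forms with \<open>\<xi> [f; g] = 0\<close>.
\<close>

lemma free_modulo_abelian_semiradical:
  assumes free: "free_modulo K H" and H: "subspace H" and FH: "frobenius_semiradical \<subseteq> H"
    and ab: "abelian frobenius_semiradical"
  shows "\<exists>f g. [f; g] \<noteq> 0 \<and> (\<forall>\<xi>\<in>dual_reg. \<xi> [f; g] \<noteq> 0 \<longrightarrow> stabilizer \<xi> \<subseteq> K)"
proof -
  let ?F = frobenius_semiradical
  have K: "subspace K" "K \<subseteq> H" "dim H = dim K + 3" "\<And>k h. k \<in> K \<Longrightarrow> h \<in> H \<Longrightarrow> [k; h] = 0"
    "\<And>x y. x \<in> H \<Longrightarrow> y \<in> H \<Longrightarrow> [x; y] = 0 \<Longrightarrow> \<exists>a b. (a \<noteq> 0 \<or> b \<noteq> 0) \<and> a *s x + b *s y \<in> K"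
    using free unfolding free_modulo_def by blast+
  have line: "y \<in> span (insert f K)" if f: "f \<in> H" "f \<notin> K" and y: "y \<in> H" "[f; y] = 0" for f y
  proof -
    obtain a b where ab: "a \<noteq> 0 \<or> b \<noteq> 0" "a *s f + b *s y \<in> K" using K(5)[OF f(1) y] by blast
    have b: "b \<noteq> 0"
    proof
      assume "b = 0"
      then have a: "a *s f \<in> K" "a \<noteq> 0" using ab by auto
      have "inverse a *s (a *s f) \<in> K" by (rule subspace_scale[OF K(1) a(1)])
      then show False using f(2) a(2) by simp
    qed
    have "inverse b *s (a *s f + b *s y) \<in> K" using ab(2) subspace_scale[OF K(1)] by blast
    then have "y - (- (inverse b * a)) *s f \<in> K" using b by (simp add: scale_right_distrib add.commute)
    then show ?thesis using mem_span_insert[OF K(1)] by blast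
  qed
  have noncentral: "\<exists>g\<in>H. [f; g] \<noteq> 0" if f: "f \<in> H" "f \<notin> K" for f
  proof (rule ccontr)
    assume "\<not> ?thesis"
    then have "H \<subseteq> span (insert f K)" using line[OF f] by blast
    then have "dim H \<le> dim (span (insert f K))" using dim_mono by simp
    then show False using dim_span_insert[OF K(1) f(2)] K(3) by simp
  qed
  obtain f where f: "f \<in> H" "f \<notin> K" "?F \<subseteq> span (insert f K)"
  proof (cases "?F \<subseteq> K")
    case True
    have "H \<noteq> K" using K(3) by auto
    then obtain f where "f \<in> H" "f \<notin> K" using K(2) by blast
    moreover have "?F \<subseteq> span (insert f K)"
      using True span_superset[of "insert f K"] by blast
    ultimately show thesis using that by blast
  next
    case False
    then obtain f where f: "f \<in> ?F" "f \<notin> K" by blast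
    have "?F \<subseteq> span (insert f K)"
      using line[of f] f FH ab by (auto simp: abelian_def)
    then show thesis using that f FH by blast
  qed
  obtain g where g: "g \<in> H" "[f; g] \<noteq> 0" using noncentral[OF f(1,2)] by blast
  have "stabilizer \<xi> \<subseteq> K" if \<xi>: "\<xi> \<in> dual_reg" "\<xi> [f; g] \<noteq> 0" for \<xi>
  proof -
    have \<xi>': "\<xi> \<in> dual" using \<xi>(1) by (simp add: dual_reg_def)
    show ?thesis
    proof
      fix x assume x: "x \<in> stabilizer \<xi>"
      then have "x \<in> span (insert f K)" using stabilizer_subset_semiradical[OF \<xi>(1)] f(3) by blast
      then obtain c where c: "x - c *s f \<in> K" using mem_span_insert[OF K(1)] by blast
      have "[x - c *s f; g] = 0" using K(4)[OF c g(1)] .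
      then have "\<xi> ([x; g] - c *s [f; g]) = 0" using dual_zero[OF \<xi>'] by (simp add: bracket_simps)
      then have "c = 0" using x \<xi> \<xi>' by (simp add: dual_simps stabilizer_def)
      then show "x \<in> K" using c by simp
    qed
  qed
  then show ?thesis using g(2) by blast
qed

lemma free_modulo_abelian:
  assumes "free_modulo K H"
  obtains A where "subspace A" "abelian A" "dim H = dim A + 2"
proof -
  have K: "subspace K" "K \<subseteq> H" "dim H = dim K + 3" "\<And>k h. k \<in> K \<Longrightarrow> h \<in> H \<Longrightarrow> [k; h] = 0"
    using assms unfolding free_modulo_def by blast+
  have "K \<noteq> H" using K(3) by auto
  then obtain h where h: "h \<in> H" "h \<notin> K" using K(2) by blast
  have "abelian K" using K(2,4) by (auto simp: abelian_def)
  moreover have "h \<in> centralizer K"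
    using K(4)[OF _ h(1)] bracket_anticommute[of h] by (simp add: centralizer_def)
  ultimately have "abelian (span (insert h K))" using abelian_span_insert[OF K(1)] by blast
  moreover have "dim (span (insert h K)) = dim K + 1" by (rule dim_span_insert[OF K(1) h(2)])
  ultimately show thesis using that[of "span (insert h K)"] K(3) by simp
qed

lemma pfaffian_zero_index:
  assumes "dim UNIV = index + 2" "\<xi> \<in> dual"
  shows "pfaffian \<xi> w x y z = 0"
proof (rule ccontr)
  assume "pfaffian \<xi> w x y z \<noteq> 0"
  then have "dim (stabilizer \<xi>) + 4 \<le> dim UNIV"
    by (intro dim_stabilizer_pfaffian[OF assms(2)]) auto
  then show False using index_le[OF assms(2)] assms(1) by simp
qed

text \<open>
  On a proper subspace \<open>H\<close> containing all regular stabilizers, a regular form has smaller rank than on the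
  whole algebra: rank four on \<open>H\<close> would give \<open>dim H = dim UNIV\<close>. Density extends this to all \<open>\<xi>\<close>.
\<close>

lemma pfaffian_zero_hyperplane:
  assumes n: "dim UNIV = index + 4" and H: "subspace H" "frobenius_semiradical \<subseteq> H" "dim H < dim UNIV"
    and \<xi>: "\<xi> \<in> dual" and wxyz: "w \<in> H" "x \<in> H" "y \<in> H" "z \<in> H"
  shows "pfaffian \<xi> w x y z = 0"
proof (rule ccontr)
  assume ne: "pfaffian \<xi> w x y z \<noteq> 0"
  obtain r where r: "regularity_witness r"
      using regularity_witness_exists n by blast
  obtain \<zeta> where \<zeta>: "\<zeta> \<in> dual" "r \<zeta> \<noteq> 0" and reg: "\<zeta> \<in> dual_reg" and pf: "pfaffian \<zeta> w x y z \<noteq> 0"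
    by (rule regular_common_nonzero[OF r pfaffian_poly \<xi> ne])
  have "dim (stabilizer \<zeta>) + 4 \<le> dim H"
    using dim_stabilizer_pfaffian[OF \<zeta>(1) pf H(1)] stabilizer_subset_semiradical[OF reg] H(2) wxyz by blast
  then show False using reg n H(3) by (simp add: dual_reg_def)
qed

text \<open>
  Here \<open>H = L\<close> in the dichotomy. In the free case with abelian \<open>F\<close>, a regular stabilizer of
  codimension 2 would fit into a subspace of codimension 3.
\<close>

lemma max_abelian_dim_index_codim_2:
  assumes n: "dim UNIV = index + 2"
  shows "dim UNIV \<le> max_abelian_dim + 2"
    and "abelian frobenius_semiradical \<Longrightarrow> dim UNIV \<le> max_abelian_dim + 1"
proof -
  have dich: "(\<exists>A. subspace A \<and> A \<subseteq> UNIV \<and> abelian A \<and> dim UNIV \<le> dim A + 1) \<or> (\<exists>K. free_modulo K UNIV)"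
    by (rule pfaffian_dichotomy) (use pfaffian_zero_index[OF n] in auto)
  show "dim UNIV \<le> max_abelian_dim + 2" using dich
  proof (elim disjE exE conjE)
    fix A assume "subspace A" "abelian A" "dim UNIV \<le> dim A + 1"
    then show ?thesis using dim_le_max_abelian_dim[of A] by simp
  next
    fix K assume "free_modulo K UNIV"
    then obtain A where "subspace A" "abelian A" "dim UNIV = dim A + 2" by (rule free_modulo_abelian)
    then show ?thesis using dim_le_max_abelian_dim[of A] by simp
  qed
  assume ab: "abelian frobenius_semiradical"
  show "dim UNIV \<le> max_abelian_dim + 1" using dich
  proof (elim disjE exE conjE)
    fix A assume "subspace A" "abelian A" "dim UNIV \<le> dim A + 1"
    then show ?thesis using dim_le_max_abelian_dim[of A] by simp
  next
    fix K assume K: "free_modulo K UNIV"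
    obtain f g where fg: "[f; g] \<noteq> 0"
      "\<And>\<xi>. \<xi> \<in> dual_reg \<Longrightarrow> \<xi> [f; g] \<noteq> 0 \<Longrightarrow> stabilizer \<xi> \<subseteq> K"
      using free_modulo_abelian_semiradical[OF K subspace_UNIV subset_UNIV ab] by auto
    obtain r where r: "regularity_witness r"
      using regularity_witness_exists n by blast
    obtain \<theta> where \<theta>: "\<theta> \<in> dual" "\<theta> [f; g] \<noteq> 0" using dual_nonzero[OF fg(1)] .
    obtain \<zeta> where "\<zeta> \<in> dual" "r \<zeta> \<noteq> 0" and \<zeta>: "\<zeta> \<in> dual_reg" "\<zeta> [f; g] \<noteq> 0"
      by (rule regular_common_nonzero[OF r poly_functions.eval_at \<theta>])
    have "dim (stabilizer \<zeta>) = index" "stabilizer \<zeta> \<subseteq> K"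
      using fg(2)[OF \<zeta>] \<zeta>(1) by (simp_all add: dual_reg_def)
    then have "index \<le> dim K" using dim_subset by metis
    moreover have "dim UNIV = dim K + 3" using K unfolding free_modulo_def by blast
    ultimately show ?thesis using n by simp
  qed
qed

text \<open>
  Generic stabilizers are contained in \<open>K\<close> and have its dimension, hence equal \<open>K\<close>; so \<open>K\<close> lies in the
  radical of every form in a dense set, and is central.
\<close>

lemma dim_center_if_free_hyperplane:
  assumes n: "dim UNIV = index + 4" and H: "subspace H" "frobenius_semiradical \<subseteq> H" "dim UNIV = dim H + 1"
    and K: "free_modulo K H" and ab: "abelian frobenius_semiradical"
  shows "dim UNIV = dim center + 4"
proof -
  have sK: "subspace K" "dim K = index" using K n H(3) unfolding free_modulo_def by auto
  obtain f g where fg: "[f; g] \<noteq> 0"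
    "\<And>\<xi>. \<xi> \<in> dual_reg \<Longrightarrow> \<xi> [f; g] \<noteq> 0 \<Longrightarrow> stabilizer \<xi> \<subseteq> K"
    using free_modulo_abelian_semiradical[OF K H(1,2) ab] by auto
  obtain r where r: "regularity_witness r"
      using regularity_witness_exists n by blast
  obtain \<theta> where \<theta>: "\<theta> \<in> dual" "\<theta> [f; g] \<noteq> 0" using dual_nonzero[OF fg(1)] .
  have eq: "stabilizer \<xi> = K" if reg: "\<xi> \<in> dual_reg" and \<xi>: "\<xi> [f; g] \<noteq> 0" for \<xi>
  proof -
    have \<xi>d: "\<xi> \<in> dual" using reg by (simp add: dual_reg_def)
    show ?thesis
      by (rule subspace_dim_equal[OF subspace_stabilizer[OF \<xi>d] sK(1) fg(2)[OF reg \<xi>]])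
        (use reg sK(2) in \<open>simp add: dual_reg_def\<close>)
  qed
  obtain \<zeta> where \<zeta>: "\<zeta> \<in> dual" "r \<zeta> \<noteq> 0" "\<zeta> \<in> dual_reg" "\<zeta> [f; g] \<noteq> 0"
    by (rule regular_common_nonzero[OF r poly_functions.eval_at \<theta>])
  have "center \<subseteq> K" using center_subset_stabilizer[OF \<zeta>(1)] eq[OF \<zeta>(3,4)] by simp
  moreover have "K \<subseteq> center"
  proof
    fix k assume k: "k \<in> K"
    have "[k; x] = 0" for x
    proof (rule ccontr)
      assume "[k; x] \<noteq> 0"
      then obtain \<kappa> where \<kappa>: "\<kappa> \<in> dual" "\<kappa> [k; x] \<noteq> 0" by (rule dual_nonzero)
      obtain \<nu> where \<nu>: "\<nu> \<in> dual" "\<nu> [f; g] \<noteq> 0" "\<nu> [k; x] \<noteq> 0"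
        by (rule poly_functions_common_nonzero[OF poly_functions.eval_at \<theta> poly_functions.eval_at \<kappa>])
      have p: "(\<lambda>\<xi>. \<xi> [f; g] * \<xi> [k; x]) \<in> poly_functions" by (intro poly_functions.intros)
      have ne: "\<nu> [f; g] * \<nu> [k; x] \<noteq> 0" using \<nu> by simp
      obtain \<mu> where \<mu>: "\<mu> \<in> dual" "r \<mu> \<noteq> 0" "\<mu> \<in> dual_reg" "\<mu> [f; g] * \<mu> [k; x] \<noteq> 0"
        by (rule regular_common_nonzero[OF r p \<nu>(1) ne])
      have "k \<in> stabilizer \<mu>" using eq[OF \<mu>(3)] \<mu>(4) k by simp
      then show False using \<mu>(4) by (simp add: stabilizer_def)
    qed
    then show "k \<in> center" by (simp add: center_def)
  qed
  ultimately show ?thesis using sK n by simp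
qed

end

section \<open>Extending the center by an abelian plane\<close>

text \<open>
  The eigenvector is \<open>(0, 1)\<close> if \<open>b1 = 0\<close>, and \<open>(b1, t - a1)\<close> for a root \<open>t\<close> of the characteristic
  polynomial otherwise.
\<close>

lemma eigenvector_2x2:
  fixes a1 a2 b1 b2 :: "'a::alg_closed_field"
  shows "\<exists>t c1 c2. (c1 \<noteq> 0 \<or> c2 \<noteq> 0) \<and> c1 * a1 + c2 * b1 = t * c1 \<and> c1 * a2 + c2 * b2 = t * c2"
proof (cases "b1 = 0")
  case True
  then show ?thesis by (intro exI[of _ b2] exI[of _ 0] exI[of _ 1]) simp
next
  case False
  have "degree [:a1 * b2 - a2 * b1, - (a1 + b2), 1:] > 0" by simp
  then obtain t where "poly [:a1 * b2 - a2 * b1, - (a1 + b2), 1:] t = 0"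
    using alg_closed_imp_poly_has_root by blast
  then have "b1 * a2 + (t - a1) * b2 = t * (t - a1)"
    by (simp add: algebra_simps eq_neg_iff_add_eq_0)
  then show ?thesis
    using False by (intro exI[of _ t] exI[of _ b1] exI[of _ "t - a1"]) (simp add: algebra_simps)
qed

context acf_lie_algebra
begin

lemma abelian_plane_over_center:
  assumes xy: "[x; y] = 0" and x: "x \<notin> center" and y: "y \<notin> span (insert x center)"
  shows "dim center + 2 \<le> max_abelian_dim"
proof -
  let ?A = "span (insert x center)"
  have c: "abelian center" by (auto simp: abelian_def center_def)
  have comm: "[z; v] = 0" if "v \<in> center" for z v
    using that bracket_anticommute[of z v] by (simp add: center_def)
  have A: "abelian ?A"
    by (rule abelian_span_insert[OF subspace_center c]) (use comm in \<open>simp add: centralizer_def\<close>)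
  have "[y; a] = 0" if "a \<in> ?A" for a
  proof -
    obtain k where k: "a - k *s x \<in> center" using \<open>a \<in> ?A\<close> mem_span_insert[OF subspace_center] by blast
    have "[y; a - k *s x] = 0" using comm[OF k] .
    moreover have "[y; x] = 0" using xy bracket_anticommute[of y x] by simp
    ultimately show ?thesis by (simp add: bracket_simps)
  qed
  then have "abelian (span (insert y ?A))"
    by (intro abelian_span_insert A) (auto simp: centralizer_def)
  then have "dim (span (insert y ?A)) \<le> max_abelian_dim" by (intro dim_le_max_abelian_dim) auto
  then show ?thesis
    using dim_span_insert[OF subspace_center x] dim_span_insert[OF subspace_span y] by simp
qed

text \<open>
  For \<open>x\<close> in the second center, \<open>y \<mapsto> [x; y]\<close> takes values in the center, so its kernel has dimension at
  least four, more than the span of \<open>x\<close> and the center.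
\<close>

lemma plane_over_small_center:
  assumes nil: "nilpotent" and n: "dim UNIV = dim center + 4" and small: "dim center \<le> 2"
  shows "dim center + 2 \<le> max_abelian_dim"
proof -
  have "center \<noteq> UNIV" using n by auto
  then obtain x where x: "x \<notin> center" "\<And>y. [x; y] \<in> center"
    using nilpotent_second_center[OF nil] by blast
  let ?C = "{y \<in> UNIV. [x; y] = 0}"
  have "dim UNIV \<le> dim ?C + dim center"
    by (rule rank_nullity_le[OF subspace_UNIV subspace_center bracket_linear_right]) (use x in auto)
  then have "dim (span (insert x center)) < dim ?C"
    using dim_span_insert[OF subspace_center x(1)] n small by linarith
  then have "\<not> ?C \<subseteq> span (insert x center)" using dim_subset by (metis not_le)
  then obtain y where "[x; y] = 0" "y \<notin> span (insert x center)" by blast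
  then show ?thesis using abelian_plane_over_center x(1) by blast
qed

lemma span_independent3:
  assumes Z: "subspace Z" "dim Z \<le> 3" and uvw: "u \<in> Z" "v \<in> Z" "w \<in> Z" and ind: "independent3 u v w"
    and z: "z \<in> Z"
  obtains a b c where "z = a *s u + b *s v + c *s w"
proof -
  have ind': "a = 0 \<and> b = 0 \<and> c = 0" if "a *s u + b *s v + c *s w = 0" for a b c
    using ind that unfolding independent3_def by blast
  define S1 where "S1 = span (insert w {0})"
  define S2 where "S2 = span (insert v S1)"
  define S3 where "S3 = span (insert u S2)"
  have sub: "subspace S1" "subspace S2" "subspace S3" by (auto simp: S1_def S2_def S3_def)
  have w: "w \<notin> {0}" using ind'[of 0 0 1] by auto
  have v: "v \<notin> S1"
  proof
    assume "v \<in> S1"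
    then obtain c where "v - c *s w = 0" using mem_span_insert[OF subspace_single_0] S1_def by blast
    then show False using ind'[of 0 1 "- c"] by simp
  qed
  have u: "u \<notin> S2"
  proof
    assume "u \<in> S2"
    then obtain b c where "u - b *s v - c *s w = 0"
      using mem_span_insert[OF subspace_single_0] mem_span_insert[OF sub(1)] S1_def S2_def by blast
    then show False using ind'[of 1 "- b" "- c"] by simp
  qed
  have "dim S3 = 3"
    using dim_span_insert[OF subspace_single_0 w] dim_span_insert[OF sub(1) v] dim_span_insert[OF sub(2) u]
    by (simp add: S1_def S2_def S3_def)
  moreover have "S3 \<subseteq> Z"
    unfolding S3_def S2_def S1_def
    by (intro span_minimal insert_subsetI) (use Z uvw subspace_0 in auto)
  ultimately have "S3 = Z" using subspace_dim_equal[OF sub(3) Z(1)] Z(2) by simp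
  then have "z \<in> S3" using z by simp
  then obtain a b c where "z - a *s u - b *s v - c *s w \<in> {0}"
    using mem_span_insert[OF subspace_single_0] mem_span_insert[OF sub(1)] mem_span_insert[OF sub(2)]
      S1_def S2_def S3_def by blast
  then have "z = a *s u + b *s v + c *s w" by (simp add: algebra_simps)
  then show thesis by (rule that)
qed

text \<open>
  Let \<open>a, b\<close> complete \<open>x, w\<close> to a basis modulo the center. Either \<open>[x; a], [x; b], [x; w]\<close> are dependent
  and \<open>x\<close> itself commutes with something new, or they form a basis of the center; then modulo \<open>[x; w]\<close>,
  bracketing the span of \<open>a, b\<close> with \<open>w\<close> is an endomorphism of this span followed by bracketing with \<open>x\<close>, and
  an eigenvector of eigenvalue \<open>t\<close> commutes with \<open>w - t x\<close> modulo \<open>[x; w]\<close>.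
\<close>

lemma plane_over_center_from_second_center:
  assumes n: "dim UNIV = dim center + 4" and Z: "dim center = 3"
    and x: "x \<notin> center" "\<And>y. [x; y] \<in> center"
    and w: "w \<notin> span (insert x center)" "\<And>y. [w; y] \<in> center"
  shows "dim center + 2 \<le> max_abelian_dim"
proof -
  define S1 where "S1 = span (insert x center)"
  define S2 where "S2 = span (insert w S1)"
  have sub: "subspace S1" "subspace S2" by (auto simp: S1_def S2_def)
  have d2: "dim S2 = dim center + 2"
    using dim_span_insert[OF subspace_center x(1)] dim_span_insert[OF sub(1), of w] w(1)
    by (simp add: S1_def S2_def)
  have S12: "center \<subseteq> S2" "x \<in> S2" "w \<in> S2"
    by (auto simp: S1_def S2_def intro: span_base)
  have "dim S2 \<noteq> dim UNIV" using d2 n by linarith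
  then have "S2 \<noteq> UNIV" by metis
  then obtain a where a: "a \<notin> S2" by blast
  have "dim (span (insert a S2)) \<noteq> dim UNIV" using dim_span_insert[OF sub(2) a] d2 n by linarith
  then have "span (insert a S2) \<noteq> UNIV" by metis
  then obtain b where b: "b \<notin> span (insert a S2)" by blast
  have outside: "c1 *s a + c2 *s b + s \<notin> S2" if s: "s \<in> S2" and c: "c1 \<noteq> 0 \<or> c2 \<noteq> 0" for c1 c2 s
  proof
    assume "c1 *s a + c2 *s b + s \<in> S2"
    then have "c1 *s a + c2 *s b + s - s \<in> S2" using s subspace_diff[OF sub(2)] by blast
    then have in2: "c1 *s a + c2 *s b \<in> S2" by simp
    show False
    proof (cases "c2 = 0")
      case True
      then have "inverse c1 *s (c1 *s a) \<in> S2" using in2 subspace_scale[OF sub(2), of "c1 *s a"] by simp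
      then show False using a c True by simp
    next
      case False
      have "inverse c2 *s (c1 *s a + c2 *s b) \<in> S2" by (rule subspace_scale[OF sub(2) in2])
      then have "b - (- (inverse c2 * c1)) *s a \<in> S2" using False by (simp add: scale_right_distrib add.commute)
      then show False using b mem_span_insert[OF sub(2)] by blast
    qed
  qed
  have finish: ?thesis if pq: "[p; q] = 0" "p \<notin> center" "p \<in> S2" "q \<notin> S2" for p q
  proof (rule abelian_plane_over_center[OF pq(1,2)])
    have "span (insert p center) \<subseteq> S2" by (intro span_minimal) (use pq S12 sub in auto)
    then show "q \<notin> span (insert p center)" using pq(4) by blast
  qed
  show ?thesis
  proof (cases "[x; w] = 0")
    case True
    then show ?thesis using abelian_plane_over_center x(1) w(1) by blast
  next
    case xw: False
    show ?thesis
    proof (cases "independent3 [x; a] [x; b] [x; w]")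
      case False
      then obtain c1 c2 c3 where c: "c1 *s [x; a] + c2 *s [x; b] + c3 *s [x; w] = 0"
        "c1 \<noteq> 0 \<or> c2 \<noteq> 0 \<or> c3 \<noteq> 0" by (auto simp: independent3_def)
      then have "c1 \<noteq> 0 \<or> c2 \<noteq> 0" using xw by auto
      then have "c1 *s a + c2 *s b + c3 *s w \<notin> S2"
        by (intro outside) (use sub S12 in \<open>auto intro: subspace_scale\<close>)
      moreover have "[x; c1 *s a + c2 *s b + c3 *s w] = 0" using c(1) by (simp add: bracket_simps)
      ultimately show ?thesis using finish x(1) S12 by blast
    next
      case True
      have Z': "dim center \<le> 3" using Z by simp
      obtain a1 a2 a3 where aa: "[w; a] = a1 *s [x; a] + a2 *s [x; b] + a3 *s [x; w]"
        by (rule span_independent3[OF subspace_center Z' x(2) x(2) x(2) True w(2)])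
      obtain b1 b2 b3 where bb: "[w; b] = b1 *s [x; a] + b2 *s [x; b] + b3 *s [x; w]"
        by (rule span_independent3[OF subspace_center Z' x(2) x(2) x(2) True w(2)])
      obtain t c1 c2 where c: "c1 \<noteq> 0 \<or> c2 \<noteq> 0" and
        ev: "c1 * a1 + c2 * b1 = t * c1" "c1 * a2 + c2 * b2 = t * c2"
        using eigenvector_2x2[of a1 b1 a2 b2] by blast
      \<comment> \<open>The multiple of \<open>x\<close> cancels the component of \<open>[w - t x; q]\<close> along \<open>[x; w]\<close>.\<close>
      define q where "q = c1 *s a + c2 *s b + (c1 * a3 + c2 * b3) *s x"
      have "[w - t *s x; q] = (c1 * a1 + c2 * b1) *s [x; a] + (c1 * a2 + c2 * b2) *s [x; b]
          - (t * c1) *s [x; a] - (t * c2) *s [x; b]"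
        unfolding q_def using bracket_anticommute[of w x] by (simp add: bracket_simps aa bb algebra_simps)
      also have "\<dots> = 0" unfolding ev by simp
      finally have "[w - t *s x; q] = 0" .
      moreover have "w - t *s x \<notin> center" using w(1) mem_span_insert[OF subspace_center] by blast
      moreover have "w - t *s x \<in> S2" using S12 sub by (auto intro: subspace_diff subspace_scale)
      moreover have "q \<notin> S2"
        unfolding q_def by (intro outside) (use c S12 sub in \<open>auto intro: subspace_scale\<close>)
      ultimately show ?thesis using finish by blast
    qed
  qed
qed

text \<open>
  By the Jacobi identity the second center commutes with \<open>[L, L]\<close>, so a bracket outside the span of \<open>x\<close>
  and the center provides the second vector. If there is none, brackets modulo the center are multiples
  of \<open>x\<close> given by an alternating form; its radical has odd dimension, hence exceeds the span of
  \<open>x\<close> and the center, and it lies in the second center.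
\<close>

lemma plane_over_center_dim_3:
  assumes nil: "nilpotent" and n: "dim UNIV = dim center + 4" and Z: "dim center = 3"
  shows "dim center + 2 \<le> max_abelian_dim"
proof -
  have "center \<noteq> UNIV" using n by auto
  then obtain x where x: "x \<notin> center" "\<And>y. [x; y] \<in> center"
    using nilpotent_second_center[OF nil] by blast
  let ?S = "span (insert x center)"
  have dS: "dim ?S = dim center + 1" by (rule dim_span_insert[OF subspace_center x(1)])
  show ?thesis
  proof (cases "\<forall>a b. [a; b] \<in> ?S")
    case False
    then obtain a b where ab: "[a; b] \<notin> ?S" by blast
    have comm: "[z; v] = 0" if "v \<in> center" for z v
      using that bracket_anticommute[of z v] by (simp add: center_def)
    have "[b; x] \<in> center" using x(2)[of b] bracket_anticommute[of b x] subspace_neg[OF subspace_center] by simp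
    then have "[x; [a; b]] = 0" using jacobi[of x a b] comm x(2) by simp
    then show ?thesis using abelian_plane_over_center x(1) ab by blast
  next
    case True
    obtain \<phi> where "Vector_Spaces.linear scale (*) \<phi>"
      and \<phi>0: "\<And>z. z \<in> center \<Longrightarrow> \<phi> z = 0" "\<phi> x = 1"
      using separate_point[OF subspace_center x(1)] by blast
    then have \<phi>: "\<phi> \<in> dual" "\<And>z. z \<in> center \<Longrightarrow> \<phi> z = 0" "\<phi> x = 1"
      by (simp_all add: dual_def)
    have \<phi>ker: "[a; b] \<in> center" if "\<phi> [a; b] = 0" for a b
    proof -
      obtain k where k: "[a; b] - k *s x \<in> center" using True mem_span_insert[OF subspace_center] by blast
      then have "k = 0" using \<phi>(2)[OF k] \<phi>(1,3) that by (simp add: dual_simps)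
      then show ?thesis using k by simp
    qed
    have "?S \<subseteq> stabilizer \<phi>"
    proof (intro span_minimal)
      show "insert x center \<subseteq> stabilizer \<phi>"
        using center_subset_stabilizer[OF \<phi>(1)] \<phi>(2) x(2) by (auto simp: stabilizer_def)
    qed (rule subspace_stabilizer[OF \<phi>(1)])
    then have ge: "4 \<le> dim (stabilizer \<phi>)" using dim_subset[of ?S "stabilizer \<phi>"] dS Z by simp
    obtain k where "dim UNIV = dim (stabilizer \<phi>) + 2 * k"
      using even_codim_stabilizer[OF \<phi>(1)] by blast
    then have "dim (stabilizer \<phi>) \<noteq> 4" using n Z by presburger
    then have "\<not> stabilizer \<phi> \<subseteq> ?S" using dim_subset[of "stabilizer \<phi>" ?S] dS Z ge by auto
    then obtain w where w: "w \<in> stabilizer \<phi>" "w \<notin> ?S" by blast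
    have "[w; y] \<in> center" for y using \<phi>ker w(1) by (simp add: stabilizer_def)
    then show ?thesis using plane_over_center_from_second_center[OF n Z x w(2)] by blast
  qed
qed

text \<open>
  The dichotomy for a hyperplane through \<open>F\<close>; an abelian hyperplane of it has codimension 2 in \<open>L\<close>.
\<close>

lemma max_abelian_dim_index_codim_4:
  assumes n: "dim UNIV = index + 4" and F: "frobenius_semiradical \<noteq> UNIV"
  shows "dim UNIV \<le> max_abelian_dim + 3"
    and "nilpotent \<Longrightarrow> abelian frobenius_semiradical \<Longrightarrow> index \<le> 3 \<Longrightarrow> dim UNIV \<le> max_abelian_dim + 2"
proof -
  obtain H where H: "subspace H" "frobenius_semiradical \<subseteq> H" "dim UNIV = dim H + 1"
  proof -
    have "frobenius_semiradical \<subset> UNIV" using F by blast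
    then show thesis using hyperplane_through[OF subspace_semiradical subspace_UNIV] that by blast
  qed
  have dich: "(\<exists>A. subspace A \<and> A \<subseteq> H \<and> abelian A \<and> dim H \<le> dim A + 1) \<or> (\<exists>K. free_modulo K H)"
    by (rule pfaffian_dichotomy[OF H(1)]) (use pfaffian_zero_hyperplane[OF n H(1,2)] H(3) in auto)
  show "dim UNIV \<le> max_abelian_dim + 3" using dich
  proof (elim disjE exE conjE)
    fix A assume "subspace A" "abelian A" "dim H \<le> dim A + 1"
    then show ?thesis using dim_le_max_abelian_dim[of A] H(3) by simp
  next
    fix K assume "free_modulo K H"
    then obtain A where "subspace A" "abelian A" "dim H = dim A + 2" by (rule free_modulo_abelian)
    then show ?thesis using dim_le_max_abelian_dim[of A] H(3) by simp
  qed
  assume nil: "nilpotent" and ab: "abelian frobenius_semiradical" and i: "index \<le> 3"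
  show "dim UNIV \<le> max_abelian_dim + 2" using dich
  proof (elim disjE exE conjE)
    fix A assume "subspace A" "abelian A" "dim H \<le> dim A + 1"
    then show ?thesis using dim_le_max_abelian_dim[of A] H(3) by simp
  next
    fix K assume K: "free_modulo K H"
    have c: "dim UNIV = dim center + 4" by (rule dim_center_if_free_hyperplane[OF n H K ab])
    then consider "dim center \<le> 2" | "dim center = 3" using i n by linarith
    then have "dim center + 2 \<le> max_abelian_dim"
      using plane_over_small_center[OF nil c] plane_over_center_dim_3[OF nil c] by cases
    then show ?thesis using c by simp
  qed
qed

section \<open>Hypersurfaces that are graphs\<close>

lemma poly_functions_power: "p \<in> poly_functions \<Longrightarrow> (\<lambda>\<xi>. p \<xi> ^ k) \<in> poly_functions"
  by (induction k) (auto intro: poly_functions.intros)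

lemma irreducible_closed_subset_dual: "irreducible_closed Z \<Longrightarrow> Z \<subseteq> dual"
  by (auto simp: irreducible_closed_def zariski_closed_def)

lemma irreducible_closed_dual: "irreducible_closed dual"
  unfolding irreducible_closed_def
proof (intro conjI allI impI)
  show "zariski_closed dual" unfolding zariski_closed_def by (rule exI[of _ "{}"]) simp
  show "dual \<noteq> {}" using zero_in_dual by blast
  fix A B assume A: "zariski_closed A" and B: "zariski_closed B" and AB: "dual = A \<union> B"
  obtain P where P: "P \<subseteq> poly_functions" "A = {\<xi> \<in> dual. \<forall>p\<in>P. p \<xi> = 0}"
    using A unfolding zariski_closed_def by (elim exE conjE)
  obtain Q where Q: "Q \<subseteq> poly_functions" "B = {\<xi> \<in> dual. \<forall>p\<in>Q. p \<xi> = 0}"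
    using B unfolding zariski_closed_def by (elim exE conjE)
  show "dual = A \<or> dual = B"
  proof (rule ccontr)
    assume "\<not> ?thesis"
    then obtain \<xi> \<eta> where \<xi>: "\<xi> \<in> dual" "\<xi> \<notin> A" and \<eta>: "\<eta> \<in> dual" "\<eta> \<notin> B" using AB by blast
    obtain p where p: "p \<in> P" "p \<xi> \<noteq> 0" using \<xi> unfolding P(2) by auto
    obtain q where q: "q \<in> Q" "q \<eta> \<noteq> 0" using \<eta> unfolding Q(2) by auto
    have pq: "p \<in> poly_functions" "q \<in> poly_functions" using p(1) q(1) P(1) Q(1) by auto
    obtain \<zeta> where \<zeta>: "\<zeta> \<in> dual" "p \<zeta> \<noteq> 0" "q \<zeta> \<noteq> 0"
      by (rule poly_functions_common_nonzero[OF pq(1) \<xi>(1) p(2) pq(2) \<eta>(1) q(2)])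
    then have "\<zeta> \<notin> A" "\<zeta> \<notin> B" using p(1) q(1) unfolding P(2) Q(2) by auto
    then show False using AB \<zeta>(1) by blast
  qed
qed

lemma codim_irreducible_ge_1:
  assumes "irreducible_closed Z" "Z \<noteq> dual"
  shows "1 \<le> codim_irreducible Z"
proof -
  have "Z \<subset> dual" using assms irreducible_closed_subset_dual by blast
  then have "\<exists>C. C 0 = Z \<and> (\<forall>i\<le>1. irreducible_closed (C i)) \<and> (\<forall>i<1. C i \<subset> C (Suc i))"
    using assms(1) irreducible_closed_dual
    by (intro exI[of _ "\<lambda>i :: nat. if i = 0 then Z else dual"]) auto
  then have "enat 1 \<le> codim_irreducible Z"
    unfolding codim_irreducible_def by (intro Sup_upper) blast
  then show ?thesis by (simp add: one_enat_def)
qed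

text \<open>
  The codimension of the singular functionals is always at least one, because regular functionals exist.
\<close>

lemma singularI:
  assumes Z: "irreducible_closed Z" "Z \<subseteq> dual_sing" "codim_irreducible Z \<le> 1"
  shows "singular"
  unfolding singular_def
proof (rule antisym)
  show "codim dual_sing \<le> 1"
    unfolding codim_def by (rule INF_lower2[of Z]) (use Z in auto)
  show "1 \<le> codim dual_sing"
    unfolding codim_def
  proof (rule INF_greatest)
    fix Z assume "Z \<in> {Z. irreducible_closed Z \<and> Z \<subseteq> dual_sing}"
    moreover have "\<not> dual \<subseteq> dual_sing"
    proof -
      obtain \<xi> where "\<xi> \<in> dual_reg" by (rule dual_reg_nonempty)
      then show ?thesis using dual_reg_subset by (auto simp: dual_sing_def)
    qed
    ultimately show "1 \<le> codim_irreducible Z" by (intro codim_irreducible_ge_1) auto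
  qed
qed

lemma irreducible_closed_prime:
  assumes Z: "irreducible_closed Z" and p: "p \<in> poly_functions" and q: "q \<in> poly_functions"
    and pq: "\<And>\<xi>. \<xi> \<in> Z \<Longrightarrow> p \<xi> * q \<xi> = 0"
  shows "(\<forall>\<xi>\<in>Z. p \<xi> = 0) \<or> (\<forall>\<xi>\<in>Z. q \<xi> = 0)"
proof -
  have "zariski_closed Z" using Z by (simp add: irreducible_closed_def)
  then obtain P where P: "P \<subseteq> poly_functions" "Z = {\<xi> \<in> dual. \<forall>p\<in>P. p \<xi> = 0}"
    unfolding zariski_closed_def by (elim exE conjE)
  have closed: "zariski_closed {\<xi> \<in> Z. f \<xi> = 0}" if f: "f \<in> poly_functions" for f
    unfolding zariski_closed_def
  proof (intro exI conjI)
    show "insert f P \<subseteq> poly_functions" using f P(1) by simp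
    show "{\<xi> \<in> Z. f \<xi> = 0} = {\<xi> \<in> dual. \<forall>p\<in>insert f P. p \<xi> = 0}" unfolding P(2) by auto
  qed
  have "Z = {\<xi> \<in> Z. p \<xi> = 0} \<union> {\<xi> \<in> Z. q \<xi> = 0}" using pq by auto
  then have "Z = {\<xi> \<in> Z. p \<xi> = 0} \<or> Z = {\<xi> \<in> Z. q \<xi> = 0}"
    using Z closed[OF p] closed[OF q] unfolding irreducible_closed_def by blast
  then show ?thesis by blast
qed

definition shift :: "('v \<Rightarrow> 'k) \<Rightarrow> ('v \<Rightarrow> 'k) \<Rightarrow> 'k \<Rightarrow> 'v \<Rightarrow> 'k" where
  "shift e \<xi> t = (\<lambda>x. \<xi> x + t * e x)"

lemma shift_dual: "\<xi> \<in> dual \<Longrightarrow> e \<in> dual \<Longrightarrow> shift e \<xi> t \<in> dual"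
  unfolding shift_def by (rule dual_line)

lemma shift_zero: "shift e \<xi> 0 = \<xi>"
  by (simp add: shift_def)

definition degree_bound :: "('v \<Rightarrow> 'k) \<Rightarrow> (('v \<Rightarrow> 'k) \<Rightarrow> 'k) \<Rightarrow> nat \<Rightarrow> bool" where
  "degree_bound e f d \<longleftrightarrow> (\<forall>\<xi>\<in>dual. \<exists>P. degree P \<le> d \<and> (\<forall>t. f (shift e \<xi> t) = poly P t))"

lemma degree_bound_exists:
  assumes "f \<in> poly_functions"
  shows "\<exists>d. degree_bound e f d"
  using assms
proof induction
  case (const c)
  have "degree_bound e (\<lambda>\<xi>. c) 0"
    unfolding degree_bound_def by (intro ballI exI[of _ "[:c:]"]) simp
  then show ?case by blast
next
  case (eval_at x)
  have "degree_bound e (\<lambda>\<xi>. \<xi> x) 1"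
    unfolding degree_bound_def
  proof
    fix \<xi> assume "\<xi> \<in> dual"
    show "\<exists>P. degree P \<le> 1 \<and> (\<forall>t. shift e \<xi> t x = poly P t)"
      by (rule exI[of _ "[:\<xi> x, e x:]"]) (simp add: shift_def)
  qed
  then show ?case by blast
next
  case (add p q)
  then obtain m n where m: "degree_bound e p m" and n: "degree_bound e q n" by blast
  have "degree_bound e (\<lambda>\<xi>. p \<xi> + q \<xi>) (max m n)"
    unfolding degree_bound_def
  proof
    fix \<xi> assume \<xi>: "\<xi> \<in> dual"
    obtain P where P: "degree P \<le> m" "\<And>t. p (shift e \<xi> t) = poly P t"
      using m \<xi> unfolding degree_bound_def by blast
    obtain Q where Q: "degree Q \<le> n" "\<And>t. q (shift e \<xi> t) = poly Q t"
      using n \<xi> unfolding degree_bound_def by blast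
    show "\<exists>R. degree R \<le> max m n \<and> (\<forall>t. p (shift e \<xi> t) + q (shift e \<xi> t) = poly R t)"
      using P Q by (intro exI[of _ "P + Q"]) (auto intro: degree_add_le)
  qed
  then show ?case by blast
next
  case (mult p q)
  then obtain m n where m: "degree_bound e p m" and n: "degree_bound e q n" by blast
  have "degree_bound e (\<lambda>\<xi>. p \<xi> * q \<xi>) (m + n)"
    unfolding degree_bound_def
  proof
    fix \<xi> assume \<xi>: "\<xi> \<in> dual"
    obtain P where P: "degree P \<le> m" "\<And>t. p (shift e \<xi> t) = poly P t"
      using m \<xi> unfolding degree_bound_def by blast
    obtain Q where Q: "degree Q \<le> n" "\<And>t. q (shift e \<xi> t) = poly Q t"
      using n \<xi> unfolding degree_bound_def by blast
    have "degree (P * Q) \<le> m + n" using degree_mult_le[of P Q] P(1) Q(1) by linarith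
    then show "\<exists>R. degree R \<le> m + n \<and> (\<forall>t. p (shift e \<xi> t) * q (shift e \<xi> t) = poly R t)"
      using P Q by (intro exI[of _ "P * Q"]) auto
  qed
  then show ?case by blast
qed

end

text \<open>
  The function \<open>q\<close> has degree one in the direction \<open>e\<close>, with leading coefficient \<open>u\<close>; where \<open>u\<close> does not
  vanish, its zero set is the graph of the rational function \<open>- q / u\<close> over the quotient by \<open>e\<close>. The closure of
  this graph is irreducible of codimension one.
\<close>

locale graph_hypersurface = acf_lie_algebra scale Basis bracket
  for scale :: "'k::{alg_closed_field, field_char_0} \<Rightarrow> 'v::ab_group_add \<Rightarrow> 'v"
    and Basis :: "'v set"
    and bracket :: "'v \<Rightarrow> 'v \<Rightarrow> 'v" +
  fixes q u :: "('v \<Rightarrow> 'k) \<Rightarrow> 'k" and e \<eta> :: "'v \<Rightarrow> 'k"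
  assumes q: "q \<in> poly_functions" and u: "u \<in> poly_functions"
    and e: "e \<in> dual" and \<eta>: "\<eta> \<in> dual" "u \<eta> \<noteq> 0"
    and q_shift: "\<xi> \<in> dual \<Longrightarrow> q (shift e \<xi> t) = q \<xi> + t * u \<xi>"
    and u_shift: "\<xi> \<in> dual \<Longrightarrow> u (shift e \<xi> t) = u \<xi>"
begin

definition project :: "('v \<Rightarrow> 'k) \<Rightarrow> 'v \<Rightarrow> 'k" where
  "project \<xi> = shift e \<xi> (- (q \<xi> / u \<xi>))"

definition graph :: "('v \<Rightarrow> 'k) set" where
  "graph = {\<xi> \<in> dual. q \<xi> = 0 \<and> u \<xi> \<noteq> 0}"

definition graph_closure :: "('v \<Rightarrow> 'k) set" where
  "graph_closure = {\<xi> \<in> dual. \<forall>p\<in>poly_functions. (\<forall>\<gamma>\<in>graph. p \<gamma> = 0) \<longrightarrow> p \<xi> = 0}"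

lemma project_in_graph: "\<xi> \<in> dual \<Longrightarrow> u \<xi> \<noteq> 0 \<Longrightarrow> project \<xi> \<in> graph"
  by (simp add: project_def graph_def q_shift u_shift shift_dual e)

lemma graph_nonempty: "graph \<noteq> {}"
  using project_in_graph \<eta> by blast

lemma graph_subset: "graph \<subseteq> graph_closure"
  by (auto simp: graph_def graph_closure_def)

text \<open>
  Substituting \<open>project \<xi>\<close> into a polynomial function \<open>f\<close> gives a rational function with a power of \<open>u\<close> as
  denominator, and \<open>r\<close> is its numerator; this is pseudo-division of \<open>f\<close> by \<open>q\<close>.
\<close>

lemma clear_denominators:
  assumes "f \<in> poly_functions"
  shows "\<exists>k. \<exists>r\<in>poly_functions. \<exists>h\<in>poly_functions. \<forall>\<xi>\<in>dual.
    u \<xi> ^ k * f \<xi> = q \<xi> * h \<xi> + r \<xi> \<and> (u \<xi> \<noteq> 0 \<longrightarrow> r \<xi> = u \<xi> ^ k * f (project \<xi>))"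
  using assms
proof induction
  case (const c)
  show ?case
    by (intro exI[of _ 0] bexI[of _ "\<lambda>\<xi>. c"] bexI[of _ "\<lambda>\<xi>. 0"]) (auto intro: poly_functions.intros)
next
  case (eval_at x)
  have "(\<lambda>\<xi>. u \<xi> * \<xi> x + (- e x) * q \<xi>) \<in> poly_functions"
    by (intro poly_functions.intros u q)
  then show ?case
    by (intro exI[of _ 1] bexI[of _ "\<lambda>\<xi>. u \<xi> * \<xi> x + (- e x) * q \<xi>"] bexI[of _ "\<lambda>\<xi>. e x"])
      (auto intro: poly_functions.intros simp: project_def shift_def field_simps)
next
  case (add f g)
  obtain k r h where f: "r \<in> poly_functions" "h \<in> poly_functions"
    "\<And>\<xi>. \<xi> \<in> dual \<Longrightarrow> u \<xi> ^ k * f \<xi> = q \<xi> * h \<xi> + r \<xi>"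
    "\<And>\<xi>. \<xi> \<in> dual \<Longrightarrow> u \<xi> \<noteq> 0 \<Longrightarrow> r \<xi> = u \<xi> ^ k * f (project \<xi>)"
    using add.IH(1) by metis
  obtain l s i where g: "s \<in> poly_functions" "i \<in> poly_functions"
    "\<And>\<xi>. \<xi> \<in> dual \<Longrightarrow> u \<xi> ^ l * g \<xi> = q \<xi> * i \<xi> + s \<xi>"
    "\<And>\<xi>. \<xi> \<in> dual \<Longrightarrow> u \<xi> \<noteq> 0 \<Longrightarrow> s \<xi> = u \<xi> ^ l * g (project \<xi>)"
    using add.IH(2) by metis
  let ?r = "\<lambda>\<xi>. u \<xi> ^ l * r \<xi> + u \<xi> ^ k * s \<xi>"
  let ?h = "\<lambda>\<xi>. u \<xi> ^ l * h \<xi> + u \<xi> ^ k * i \<xi>"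
  have "?r \<in> poly_functions" "?h \<in> poly_functions"
    by (intro poly_functions.intros poly_functions_power u f g)+
  moreover have "u \<xi> ^ (k + l) * (f \<xi> + g \<xi>) = q \<xi> * ?h \<xi> + ?r \<xi>" if \<xi>: "\<xi> \<in> dual" for \<xi>
  proof -
    have "u \<xi> ^ (k + l) * (f \<xi> + g \<xi>) = u \<xi> ^ l * (u \<xi> ^ k * f \<xi>) + u \<xi> ^ k * (u \<xi> ^ l * g \<xi>)"
      by (simp add: power_add algebra_simps)
    then show ?thesis unfolding f(3)[OF \<xi>] g(3)[OF \<xi>] by (simp add: algebra_simps)
  qed
  moreover have "?r \<xi> = u \<xi> ^ (k + l) * (f (project \<xi>) + g (project \<xi>))"
    if \<xi>: "\<xi> \<in> dual" "u \<xi> \<noteq> 0" for \<xi>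
    unfolding f(4)[OF \<xi>] g(4)[OF \<xi>] by (simp add: power_add algebra_simps)
  ultimately show ?case by (intro exI[of _ "k + l"] bexI[of _ ?r] bexI[of _ ?h]) auto
next
  case (mult f g)
  obtain k r h where f: "r \<in> poly_functions" "h \<in> poly_functions"
    "\<And>\<xi>. \<xi> \<in> dual \<Longrightarrow> u \<xi> ^ k * f \<xi> = q \<xi> * h \<xi> + r \<xi>"
    "\<And>\<xi>. \<xi> \<in> dual \<Longrightarrow> u \<xi> \<noteq> 0 \<Longrightarrow> r \<xi> = u \<xi> ^ k * f (project \<xi>)"
    using mult.IH(1) by metis
  obtain l s i where g: "s \<in> poly_functions" "i \<in> poly_functions"
    "\<And>\<xi>. \<xi> \<in> dual \<Longrightarrow> u \<xi> ^ l * g \<xi> = q \<xi> * i \<xi> + s \<xi>"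
    "\<And>\<xi>. \<xi> \<in> dual \<Longrightarrow> u \<xi> \<noteq> 0 \<Longrightarrow> s \<xi> = u \<xi> ^ l * g (project \<xi>)"
    using mult.IH(2) by metis
  let ?r = "\<lambda>\<xi>. r \<xi> * s \<xi>"
  let ?h = "\<lambda>\<xi>. q \<xi> * (h \<xi> * i \<xi>) + (h \<xi> * s \<xi> + r \<xi> * i \<xi>)"
  have "?r \<in> poly_functions" "?h \<in> poly_functions"
    by (intro poly_functions.intros q f g)+
  moreover have "u \<xi> ^ (k + l) * (f \<xi> * g \<xi>) = q \<xi> * ?h \<xi> + ?r \<xi>" if \<xi>: "\<xi> \<in> dual" for \<xi>
  proof -
    have "u \<xi> ^ (k + l) * (f \<xi> * g \<xi>) = (u \<xi> ^ k * f \<xi>) * (u \<xi> ^ l * g \<xi>)"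
      by (simp add: power_add algebra_simps)
    then show ?thesis unfolding f(3)[OF \<xi>] g(3)[OF \<xi>] by (simp add: algebra_simps)
  qed
  moreover have "?r \<xi> = u \<xi> ^ (k + l) * (f (project \<xi>) * g (project \<xi>))"
    if \<xi>: "\<xi> \<in> dual" "u \<xi> \<noteq> 0" for \<xi>
    unfolding f(4)[OF \<xi>] g(4)[OF \<xi>] by (simp add: power_add algebra_simps)
  ultimately show ?case by (intro exI[of _ "k + l"] bexI[of _ ?r] bexI[of _ ?h]) auto
qed

text \<open>
  The graph is the image of the open set \<open>u \<noteq> 0\<close> under \<open>project\<close>. A closed set missing some of the graph is
  avoided by all projections of a nonempty open set, and two such open sets meet.
\<close>

lemma graph_closure_irreducible: "irreducible_closed graph_closure"
  unfolding irreducible_closed_def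
proof (intro conjI allI impI)
  show "zariski_closed graph_closure"
    unfolding zariski_closed_def
    by (rule exI[of _ "{p \<in> poly_functions. \<forall>\<gamma>\<in>graph. p \<gamma> = 0}"]) (auto simp: graph_closure_def)
  show "graph_closure \<noteq> {}" using graph_nonempty graph_subset by blast
  define escapes :: "('v \<Rightarrow> 'k) set \<Rightarrow> (('v \<Rightarrow> 'k) \<Rightarrow> 'k) \<Rightarrow> bool" where
    "escapes A r \<longleftrightarrow> r \<in> poly_functions \<and> (\<exists>\<xi>\<in>dual. r \<xi> * u \<xi> \<noteq> 0) \<and>
      (\<forall>\<xi>\<in>dual. r \<xi> \<noteq> 0 \<longrightarrow> u \<xi> \<noteq> 0 \<longrightarrow> project \<xi> \<notin> A)" for A r
  have escape: "\<exists>r. escapes A r"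
    if A: "zariski_closed A" "A \<subseteq> graph_closure" "A \<noteq> graph_closure" for A
  proof -
    obtain P where P: "P \<subseteq> poly_functions" "A = {\<xi> \<in> dual. \<forall>p\<in>P. p \<xi> = 0}"
      using A(1) unfolding zariski_closed_def by (elim exE conjE)
    obtain \<xi> where \<xi>: "\<xi> \<in> graph_closure" "\<xi> \<notin> A" using A by blast
    then obtain p where p: "p \<in> P" "p \<xi> \<noteq> 0" unfolding P(2) by (auto simp: graph_closure_def)
    have pp: "p \<in> poly_functions" using p(1) P(1) by blast
    obtain \<gamma> where \<gamma>: "\<gamma> \<in> graph" "p \<gamma> \<noteq> 0"
      using \<xi>(1) pp p(2) unfolding graph_closure_def by blast
    obtain k r h where r: "r \<in> poly_functions"
      "\<And>\<xi>. \<xi> \<in> dual \<Longrightarrow> u \<xi> ^ k * p \<xi> = q \<xi> * h \<xi> + r \<xi>"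
      "\<And>\<xi>. \<xi> \<in> dual \<Longrightarrow> u \<xi> \<noteq> 0 \<Longrightarrow> r \<xi> = u \<xi> ^ k * p (project \<xi>)"
      using clear_denominators[OF pp] by metis
    have \<gamma>': "\<gamma> \<in> dual" "q \<gamma> = 0" "u \<gamma> \<noteq> 0" using \<gamma>(1) by (auto simp: graph_def)
    have "r \<gamma> * u \<gamma> \<noteq> 0" using r(2)[OF \<gamma>'(1)] \<gamma>' \<gamma>(2) by auto
    then have nz: "\<exists>\<xi>\<in>dual. r \<xi> * u \<xi> \<noteq> 0" using \<gamma>'(1) by (rule bexI)
    have "\<forall>\<xi>\<in>A. p \<xi> = 0" using p(1) unfolding P(2) by blast
    then have "project \<xi> \<notin> A" if "\<xi> \<in> dual" "r \<xi> \<noteq> 0" "u \<xi> \<noteq> 0" for \<xi>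
      using r(3)[OF that(1,3)] that(2) by auto
    then have "escapes A r" unfolding escapes_def using r(1) nz by simp
    then show ?thesis by blast
  qed
  fix A B assume A: "zariski_closed A" and B: "zariski_closed B" and AB: "graph_closure = A \<union> B"
  show "graph_closure = A \<or> graph_closure = B"
  proof (rule ccontr)
    assume neg: "\<not> ?thesis"
    obtain r where "escapes A r" using escape[OF A] AB neg by auto
    then have r: "r \<in> poly_functions" "\<exists>\<xi>\<in>dual. r \<xi> * u \<xi> \<noteq> 0"
      "\<forall>\<xi>\<in>dual. r \<xi> \<noteq> 0 \<longrightarrow> u \<xi> \<noteq> 0 \<longrightarrow> project \<xi> \<notin> A"
      by (simp_all add: escapes_def)
    obtain r' where "escapes B r'" using escape[OF B] AB neg by auto
    then have r': "r' \<in> poly_functions" "\<exists>\<xi>\<in>dual. r' \<xi> * u \<xi> \<noteq> 0"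
      "\<forall>\<xi>\<in>dual. r' \<xi> \<noteq> 0 \<longrightarrow> u \<xi> \<noteq> 0 \<longrightarrow> project \<xi> \<notin> B"
      by (simp_all add: escapes_def)
    obtain \<alpha> where \<alpha>: "\<alpha> \<in> dual" "r \<alpha> * u \<alpha> \<noteq> 0" using r(2) by (rule bexE)
    obtain \<beta> where \<beta>: "\<beta> \<in> dual" "r' \<beta> * u \<beta> \<noteq> 0" using r'(2) by (rule bexE)
    obtain \<zeta> where \<zeta>: "\<zeta> \<in> dual" "r \<zeta> * u \<zeta> \<noteq> 0" "r' \<zeta> * u \<zeta> \<noteq> 0"
      by (rule poly_functions_common_nonzero[OF poly_functions.mult[OF r(1) u] \<alpha>
            poly_functions.mult[OF r'(1) u] \<beta>])
    have "project \<zeta> \<notin> A \<union> B" using r(3) r'(3) \<zeta> by simp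
    moreover have "project \<zeta> \<in> graph_closure"
      using project_in_graph[OF \<zeta>(1)] \<zeta>(2) graph_subset by auto
    ultimately show False using AB by blast
  qed
qed

lemma graph_closure_subset: "\<xi> \<in> graph_closure \<Longrightarrow> q \<xi> = 0"
  using q by (auto simp: graph_closure_def graph_def)

lemma divide_by_q:
  assumes f: "f \<in> poly_functions" and 0: "\<And>\<gamma>. \<gamma> \<in> graph \<Longrightarrow> f \<gamma> = 0"
  shows "\<exists>k. \<exists>h\<in>poly_functions. \<forall>\<xi>\<in>dual. u \<xi> ^ Suc k * f \<xi> = q \<xi> * (u \<xi> * h \<xi>)"
proof -
  obtain k r h where r: "h \<in> poly_functions"
    "\<And>\<xi>. \<xi> \<in> dual \<Longrightarrow> u \<xi> ^ k * f \<xi> = q \<xi> * h \<xi> + r \<xi>"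
    "\<And>\<xi>. \<xi> \<in> dual \<Longrightarrow> u \<xi> \<noteq> 0 \<Longrightarrow> r \<xi> = u \<xi> ^ k * f (project \<xi>)"
    using clear_denominators[OF f] by metis
  have "u \<xi> ^ Suc k * f \<xi> = q \<xi> * (u \<xi> * h \<xi>)" if \<xi>: "\<xi> \<in> dual" for \<xi>
  proof (cases "u \<xi> = 0")
    case False
    then have "r \<xi> = 0" using r(3)[OF \<xi>] 0 project_in_graph[OF \<xi>] by simp
    then have "u \<xi> ^ k * f \<xi> = q \<xi> * h \<xi>" using r(2)[OF \<xi>] by simp
    then show ?thesis by (simp add: algebra_simps)
  qed simp
  then show ?thesis using r(1) by blast
qed

text \<open>
  A function vanishing on the graph is, up to powers of \<open>u\<close>, divisible by \<open>q\<close>. If it vanishes on the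
  irreducible set \<open>Z\<close>, then \<open>q\<close> or the quotient does, and the quotient has smaller degree in the
  direction \<open>e\<close>.
\<close>

lemma q_vanishes_on_proper_closed:
  assumes Z: "irreducible_closed Z" "graph_closure \<subseteq> Z"
    and f: "f \<in> poly_functions" "degree_bound e f d" "\<forall>\<xi>\<in>Z. f \<xi> = 0" "\<exists>\<xi>\<in>dual. f \<xi> \<noteq> 0"
  shows "\<forall>\<xi>\<in>Z. q \<xi> = 0"
  using f
proof (induction d arbitrary: f rule: less_induct)
  case (less d)
  have "f \<gamma> = 0" if "\<gamma> \<in> graph" for \<gamma> using less.prems(3) Z(2) graph_subset that by blast
  then obtain k h where h: "h \<in> poly_functions"
    and eq: "\<And>\<xi>. \<xi> \<in> dual \<Longrightarrow> u \<xi> ^ Suc k * f \<xi> = q \<xi> * (u \<xi> * h \<xi>)"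
    using divide_by_q[OF less.prems(1)] by metis
  let ?g = "\<lambda>\<xi>. u \<xi> * h \<xi>"
  have g: "?g \<in> poly_functions" by (intro poly_functions.intros u h)
  obtain \<xi>0 where \<xi>0: "\<xi>0 \<in> dual" "f \<xi>0 \<noteq> 0" using less.prems(4) by (rule bexE)
  obtain \<zeta> where \<zeta>: "\<zeta> \<in> dual" "f \<zeta> \<noteq> 0" "u \<zeta> \<noteq> 0"
    by (rule poly_functions_common_nonzero[OF less.prems(1) \<xi>0 u \<eta>])
  have gnz: "?g \<zeta> \<noteq> 0"
  proof
    assume "?g \<zeta> = 0"
    then show False using eq[OF \<zeta>(1)] \<zeta> by simp
  qed
  have lower: "\<exists>H. (H = 0 \<or> degree H + 1 \<le> d) \<and> (\<forall>t. ?g (shift e \<xi> t) = poly H t)" if \<xi>: "\<xi> \<in> dual" for \<xi>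
  proof (cases "u \<xi> = 0")
    case True
    then show ?thesis using u_shift[OF \<xi>] by (intro exI[of _ 0]) simp
  next
    case False
    obtain P where P: "degree P \<le> d" "\<And>t. f (shift e \<xi> t) = poly P t"
      using less.prems(2) \<xi> unfolding degree_bound_def by blast
    obtain H where H: "\<And>t. ?g (shift e \<xi> t) = poly H t"
      using poly_function_on_line[OF g] unfolding shift_def by metis
    have "poly (smult (u \<xi> ^ Suc k) P) t = poly ([:q \<xi>, u \<xi>:] * H) t" for t
    proof -
      have "poly (smult (u \<xi> ^ Suc k) P) t = u (shift e \<xi> t) ^ Suc k * f (shift e \<xi> t)"
        by (simp only: poly_smult P(2) u_shift[OF \<xi>])
      also have "\<dots> = q (shift e \<xi> t) * (u (shift e \<xi> t) * h (shift e \<xi> t))"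
        by (rule eq[OF shift_dual[OF \<xi> e]])
      also have "\<dots> = (q \<xi> + t * u \<xi>) * poly H t"
        by (simp only: H q_shift[OF \<xi>])
      also have "\<dots> = poly ([:q \<xi>, u \<xi>:] * H) t" by (simp add: algebra_simps)
      finally show ?thesis .
    qed
    then have "smult (u \<xi> ^ Suc k) P = [:q \<xi>, u \<xi>:] * H" using poly_eq_poly_eq_iff by blast
    then have "degree P = degree ([:q \<xi>, u \<xi>:] * H)" using False by (metis degree_smult_eq power_not_zero)
    moreover have "degree ([:q \<xi>, u \<xi>:] * H) = degree H + 1" if "H \<noteq> 0"
    proof -
      have "[:q \<xi>, u \<xi>:] \<noteq> 0" "degree [:q \<xi>, u \<xi>:] = 1" using False by simp_all
      then show ?thesis using degree_mult_eq[of "[:q \<xi>, u \<xi>:]" H] that by simp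
    qed
    ultimately have "H = 0 \<or> degree H + 1 \<le> d" using P(1) by metis
    then show ?thesis using H by blast
  qed
  have "d \<noteq> 0"
  proof
    assume "d = 0"
    then have "?g (shift e \<zeta> 0) = 0" using lower[OF \<zeta>(1)] by auto
    then show False using gnz by (simp add: shift_zero)
  qed
  consider "\<forall>\<xi>\<in>Z. q \<xi> = 0" | "\<forall>\<xi>\<in>Z. ?g \<xi> = 0"
  proof -
    have "q \<xi> * ?g \<xi> = 0" if "\<xi> \<in> Z" for \<xi>
      using eq[of \<xi>] that less.prems(3) irreducible_closed_subset_dual[OF Z(1)] by auto
    then show thesis using irreducible_closed_prime[OF Z(1) q g] that by blast
  qed
  then show ?case
  proof cases
    case 2
    have "degree_bound e ?g (d - 1)"
      unfolding degree_bound_def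
    proof
      fix \<xi> assume "\<xi> \<in> dual"
      then obtain H where H: "H = 0 \<or> degree H + 1 \<le> d" "\<forall>t. ?g (shift e \<xi> t) = poly H t"
        using lower by blast
      have "degree H \<le> d - 1" using H(1) by auto
      then show "\<exists>P. degree P \<le> d - 1 \<and> (\<forall>t. ?g (shift e \<xi> t) = poly P t)" using H(2) by blast
    qed
    moreover have "\<exists>\<xi>\<in>dual. ?g \<xi> \<noteq> 0" using gnz \<zeta>(1) by (intro bexI[of _ \<zeta>])
    ultimately show ?thesis using less.IH[of "d - 1" ?g] g 2 \<open>d \<noteq> 0\<close> by simp
  qed
qed

text \<open>
  A proper \<open>Z\<close> would lie in the zero set of \<open>q\<close>. There, and hence on \<open>Z\<close>, each function vanishing on the graph is
  annihilated by a power of \<open>u\<close>; as \<open>u\<close> does not vanish on all of \<open>Z\<close>, the function vanishes on \<open>Z\<close>.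
\<close>

lemma closed_above_graph_closure:
  assumes Z: "irreducible_closed Z" "graph_closure \<subset> Z"
  shows "Z = dual"
proof (rule ccontr)
  assume "Z \<noteq> dual"
  have "zariski_closed Z" using Z(1) by (simp add: irreducible_closed_def)
  then obtain P where P: "P \<subseteq> poly_functions" "Z = {\<xi> \<in> dual. \<forall>p\<in>P. p \<xi> = 0}"
    unfolding zariski_closed_def by (elim exE conjE)
  then obtain \<xi> where \<xi>: "\<xi> \<in> dual" "\<xi> \<notin> Z" using \<open>Z \<noteq> dual\<close> by blast
  then obtain f where f: "f \<in> P" "f \<xi> \<noteq> 0" unfolding P(2) by auto
  have fp: "f \<in> poly_functions" using f(1) P(1) by blast
  obtain d where d: "degree_bound e f d" using degree_bound_exists[OF fp] by blast
  have fZ: "\<forall>\<xi>\<in>Z. f \<xi> = 0" using f(1) unfolding P(2) by blast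
  have qZ: "\<forall>\<xi>\<in>Z. q \<xi> = 0"
    by (rule q_vanishes_on_proper_closed[OF Z(1) psubset_imp_subset[OF Z(2)] fp d fZ])
      (use \<xi>(1) f(2) in blast)
  have "Z \<subseteq> graph_closure"
    unfolding graph_closure_def
  proof (intro subsetI CollectI conjI ballI impI)
    fix \<zeta> assume \<zeta>: "\<zeta> \<in> Z"
    then show "\<zeta> \<in> dual" using irreducible_closed_subset_dual[OF Z(1)] by blast
    fix p assume p: "p \<in> poly_functions" "\<forall>\<gamma>\<in>graph. p \<gamma> = 0"
    then obtain k h where eq: "\<And>\<xi>. \<xi> \<in> dual \<Longrightarrow> u \<xi> ^ Suc k * p \<xi> = q \<xi> * (u \<xi> * h \<xi>)"
      using divide_by_q[OF p(1)] by metis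
    have "u \<xi> ^ Suc k * p \<xi> = 0" if "\<xi> \<in> Z" for \<xi>
      using eq[of \<xi>] that qZ irreducible_closed_subset_dual[OF Z(1)] by auto
    \<comment> \<open>The first alternative fails at points of the graph.\<close>
    then have "(\<forall>\<xi>\<in>Z. u \<xi> ^ Suc k = 0) \<or> (\<forall>\<xi>\<in>Z. p \<xi> = 0)"
      by (intro irreducible_closed_prime[OF Z(1) poly_functions_power[OF u] p(1)])
    moreover obtain \<gamma> where "\<gamma> \<in> graph" using graph_nonempty by blast
    moreover have "\<gamma> \<in> Z" using \<open>\<gamma> \<in> graph\<close> graph_subset Z(2) by blast
    moreover have "u \<gamma> \<noteq> 0" using \<open>\<gamma> \<in> graph\<close> by (simp add: graph_def)
    ultimately show "p \<zeta> = 0" using \<zeta> power_not_zero by blast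
  qed
  then show False using Z(2) by blast
qed

lemma codim_graph_closure: "codim_irreducible graph_closure \<le> 1"
  unfolding codim_irreducible_def
proof (rule Sup_least)
  fix c assume "c \<in> {enat m |m. \<exists>C. C 0 = graph_closure \<and> (\<forall>i\<le>m. irreducible_closed (C i)) \<and>
      (\<forall>i<m. C i \<subset> C (Suc i))}"
  then obtain m C where c: "c = enat m" and C: "C 0 = graph_closure"
    "\<And>i. i \<le> m \<Longrightarrow> irreducible_closed (C i)" "\<And>i. i < m \<Longrightarrow> C i \<subset> C (Suc i)"
    by blast
  have "m \<le> 1"
  proof (rule ccontr)
    assume "\<not> m \<le> 1"
    then have "C 1 = dual" "C 1 \<subset> C 2" "C 2 \<subseteq> dual"
      using closed_above_graph_closure[of "C 1"] C(1) C(2)[of 1] C(2)[of 2] C(3)[of 0] C(3)[of 1]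
        irreducible_closed_subset_dual by (auto simp: numeral_2_eq_2)
    then show False by blast
  qed
  then show "c \<le> 1" unfolding c one_enat_def by simp
qed

lemma singular_if_contains_hypersurface:
  assumes "\<And>\<xi>. \<xi> \<in> dual \<Longrightarrow> q \<xi> = 0 \<Longrightarrow> \<xi> \<in> dual_sing"
  shows "singular"
  using singularI[OF graph_closure_irreducible _ codim_graph_closure] assms graph_closure_subset
    irreducible_closed_subset_dual[OF graph_closure_irreducible] by blast

end

context acf_lie_algebra
begin

lemma singular_if_contains_hyperplane:
  assumes v: "v \<noteq> 0" and sing: "\<And>\<xi>. \<xi> \<in> dual \<Longrightarrow> \<xi> v = 0 \<Longrightarrow> \<xi> \<in> dual_sing"
  shows "singular"
proof -
  obtain e where e: "e \<in> dual" "e v \<noteq> 0" using dual_nonzero[OF v] .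
  interpret graph_hypersurface scale Basis bracket "\<lambda>\<xi>. \<xi> v" "\<lambda>\<xi>. e v" e e
    by unfold_locales (use e in \<open>auto simp: shift_def intro: poly_functions.intros\<close>)
  show ?thesis using sing by (rule singular_if_contains_hypersurface)
qed

lemma quadratic_root:
  fixes A B C :: 'k
  assumes "A \<noteq> 0"
  obtains t where "C + t * B + t\<^sup>2 * A = 0"
proof -
  have "degree [:C, B, A:] > 0" using assms by simp
  then obtain t where "poly [:C, B, A:] t = 0" using alg_closed_imp_poly_has_root by blast
  then show thesis using that[of t] by (simp add: algebra_simps power2_eq_square)
qed

text \<open>
  Let \<open>q\<close> be the quadratic form. A direction \<open>e\<close> with \<open>q e = 0\<close> that is not in the radical of \<open>q\<close> makes the quadric a graph. If there is no
  such direction, \<open>q\<close> is a multiple of the square of a linear form and the quadric is a hyperplane.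
\<close>

lemma singular_if_contains_quadric:
  assumes nz: "\<eta> \<in> dual" "\<eta> a * \<eta> d - \<eta> b * \<eta> c \<noteq> 0"
    and sing: "\<And>\<xi>. \<xi> \<in> dual \<Longrightarrow> \<xi> a * \<xi> d - \<xi> b * \<xi> c = 0 \<Longrightarrow> \<xi> \<in> dual_sing"
  shows "singular"
proof -
  define q where "q = (\<lambda>\<xi> :: 'v \<Rightarrow> 'k. \<xi> a * \<xi> d - \<xi> b * \<xi> c)"
  define B where "B = (\<lambda>e \<xi> :: 'v \<Rightarrow> 'k. e a * \<xi> d + \<xi> a * e d - e b * \<xi> c - \<xi> b * e c)"
  have expand: "q (shift e \<xi> t) = q \<xi> + t * B e \<xi> + t\<^sup>2 * q e" for e \<xi> t
    by (simp add: q_def B_def shift_def algebra_simps power2_eq_square)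
  have B_shift: "B e (shift e' \<xi> t) = B e \<xi> + t * B e e'" for e e' \<xi> t
    by (simp add: B_def shift_def algebra_simps)
  have B_self: "B e e = 2 * q e" for e by (simp add: B_def q_def algebra_simps)
  have B_sym: "B e \<xi> = B \<xi> e" for e \<xi> by (simp add: B_def algebra_simps)
  have q_poly: "q \<in> poly_functions"
  proof -
    have "(\<lambda>\<xi>. \<xi> a * \<xi> d + (-1) * (\<xi> b * \<xi> c)) \<in> poly_functions" by (intro poly_functions.intros)
    then show ?thesis by (simp add: q_def)
  qed
  have B_poly: "B e \<in> poly_functions" for e
  proof -
    have "(\<lambda>\<xi>. (e a * \<xi> d + e d * \<xi> a) + ((- e b) * \<xi> c + (- e c) * \<xi> b)) \<in> poly_functions"
      by (intro poly_functions.intros)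
    then show ?thesis by (simp add: B_def algebra_simps)
  qed
  have q\<eta>: "q \<eta> \<noteq> 0" using nz(2) by (simp add: q_def)
  show ?thesis
  proof (cases "\<exists>e\<in>dual. q e = 0 \<and> (\<exists>\<zeta>\<in>dual. B e \<zeta> \<noteq> 0)")
    case True
    then obtain e \<zeta> where e: "e \<in> dual" "q e = 0" and \<zeta>: "\<zeta> \<in> dual" "B e \<zeta> \<noteq> 0" by blast
    interpret graph_hypersurface scale Basis bracket q "B e" e \<zeta>
      by unfold_locales (use e \<zeta> in \<open>simp_all add: expand B_shift B_self q_poly B_poly\<close>)
    show ?thesis
      by (rule singular_if_contains_hypersurface) (use sing in \<open>simp add: q_def\<close>)
  next
    case False
    define v where "v = \<eta> a *s d + \<eta> d *s a - \<eta> b *s c - \<eta> c *s b"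
    have B\<eta>: "\<xi> v = B \<eta> \<xi>" if "\<xi> \<in> dual" for \<xi>
      using that by (simp add: v_def B_def dual_simps algebra_simps)
    have "\<eta> v \<noteq> 0" using B\<eta>[OF nz(1)] B_self q\<eta> by simp
    then have "v \<noteq> 0" using dual_zero[OF nz(1)] by auto
    moreover have "\<xi> \<in> dual_sing" if \<xi>: "\<xi> \<in> dual" "\<xi> v = 0" for \<xi>
    proof -
      \<comment> \<open>The line through \<open>\<xi>\<close> in the direction \<open>\<eta>\<close> meets the quadric in a point, which is then in the radical; this forces the point to be \<open>\<xi>\<close> itself.\<close>
      obtain t where t: "q \<xi> + t * B \<eta> \<xi> + t\<^sup>2 * q \<eta> = 0" using quadratic_root[OF q\<eta>] by blast
      let ?e = "shift \<eta> \<xi> t"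
      have "?e \<in> dual" by (rule shift_dual[OF \<xi>(1) nz(1)])
      moreover have "q ?e = 0" using t expand by simp
      ultimately have "B ?e \<eta> = 0" using False nz(1) by blast
      then have "B \<eta> \<xi> + t * (2 * q \<eta>) = 0" using B_shift[of \<eta> \<eta> \<xi> t] B_self B_sym by metis
      then have "t = 0" using B\<eta>[OF \<xi>(1)] \<xi>(2) q\<eta> by simp
      then have "q \<xi> = 0" using t by simp
      then show ?thesis using sing[OF \<xi>(1)] by (simp add: q_def)
    qed
    ultimately show ?thesis by (rule singular_if_contains_hyperplane)
  qed
qed

section \<open>Uniqueness of the commutative polarization\<close>

text \<open>
  The center is a line spanned by \<open>z\<close>. A functional vanishing on \<open>z\<close> is stabilized by the whole second
  center, so it is singular.
\<close>

lemma index_1_singular: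
  assumes nil: "nilpotent" and i: "index = 1" and n: "2 \<le> dim UNIV"
  shows "singular"
proof -
  have "0 < dim UNIV" using n by linarith
  then obtain z where z: "z \<in> center" "z \<noteq> 0" by (rule nilpotent_center_nontrivial[OF nil])
  obtain \<xi>0 where "\<xi>0 \<in> dual_reg" by (rule dual_reg_nonempty)
  then have "dim center \<le> 1"
    using dim_subset[OF center_subset_stabilizer[of \<xi>0]] i by (simp add: dual_reg_def)
  moreover have "span {z} \<subseteq> center" using z(1) subspace_center by (intro span_minimal) auto
  ultimately have span_z: "span {z} = center"
    by (intro subspace_dim_equal) (use z subspace_center in auto)
  have "dim center \<noteq> dim UNIV" using \<open>dim center \<le> 1\<close> n by linarith
  then have "center \<noteq> UNIV" by metis
  then obtain x where x: "x \<notin> center" "\<And>y. [x; y] \<in> center"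
    using nilpotent_second_center[OF nil] by blast
  have "\<xi> \<in> dual_sing" if \<xi>: "\<xi> \<in> dual" "\<xi> z = 0" for \<xi>
  proof -
    have "\<xi> c = 0" if "c \<in> center" for c
    proof -
      have "c \<in> span {z}" using that span_z by simp
      then obtain k where "c = k *s z" by (auto simp: span_singleton)
      then show ?thesis using \<xi> by (simp add: dual_simps)
    qed
    then have "x \<in> stabilizer \<xi>" using x(2) by (simp add: stabilizer_def)
    then have "span (insert x center) \<subseteq> stabilizer \<xi>"
      using center_subset_stabilizer[OF \<xi>(1)] subspace_stabilizer[OF \<xi>(1)] by (intro span_minimal) auto
    then have "dim center + 1 \<le> dim (stabilizer \<xi>)"
      using dim_subset[of "span (insert x center)"] dim_span_insert[OF subspace_center x(1)] by simp
    moreover have "dim center = 1" using z(2) dim_span[of "{z}"] unfolding span_z by simp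
    ultimately show ?thesis using \<xi>(1) i by (simp add: dual_sing_def dual_reg_def)
  qed
  then show ?thesis by (rule singular_if_contains_hyperplane[OF z(2)])
qed

lemma not_all_singular: "\<not> (\<forall>\<xi>\<in>dual. \<xi> \<in> dual_sing)"
  using dual_reg_nonempty by (auto simp: dual_sing_def dual_reg_def)

lemma singular_if_hyperplane_of_zeros:
  assumes "\<And>\<xi>. \<xi> \<in> dual \<Longrightarrow> \<xi> v = 0 \<Longrightarrow> \<xi> \<in> dual_sing"
  shows "singular"
proof (cases "v = 0")
  case True
  then have "\<forall>\<xi>\<in>dual. \<xi> \<in> dual_sing" using assms dual_zero by blast
  then show ?thesis using not_all_singular by blast
next
  case False
  then show ?thesis using assms by (rule singular_if_contains_hyperplane)
qed

text \<open>
  Adding \<open>x\<close> to \<open>P\<close> gives a subspace that is isotropic for \<open>\<xi>\<close> and too large for a regular functional.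
\<close>

lemma polarization_stabilized_singular:
  assumes P: "commutative_polarization P" and \<xi>: "\<xi> \<in> dual" and x: "x \<notin> P"
    and 0: "\<And>p. p \<in> P \<Longrightarrow> \<xi> [x; p] = 0"
  shows "\<xi> \<in> dual_sing"
proof -
  have sP: "subspace P" "abelian P" "2 * dim P = dim UNIV + index"
    using P commutative_polarization_iff by auto
  let ?A = "span (insert x P)"
  have dec: "\<exists>k. \<exists>p\<in>P. a = p + k *s x" if "a \<in> ?A" for a
    using that mem_span_insert[OF sP(1)] by (metis diff_add_cancel)
  show ?thesis
  proof (rule isotropic_implies_singular[OF \<xi>])
    show "subspace ?A" by simp
    show "\<xi> [a; b] = 0" if ab: "a \<in> ?A" "b \<in> ?A" for a b
    proof -
      obtain k p where a: "p \<in> P" "a = p + k *s x" using dec[OF ab(1)] by blast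
      obtain l r where b: "r \<in> P" "b = r + l *s x" using dec[OF ab(2)] by blast
      have "[p; r] = 0" using a(1) b(1) sP(2) by (simp add: abelian_def)
      moreover have "\<xi> [p; x] = 0" using 0[OF a(1)] dual_anticommute[OF \<xi>, of p x] by simp
      ultimately show ?thesis
        unfolding a(2) b(2) using 0[OF b(1)] \<xi> by (simp add: bracket_simps dual_simps)
    qed
    show "dim UNIV + index < 2 * dim ?A" using dim_span_insert[OF sP(1) x] sP(3) by simp
  qed
qed

text \<open>
  For \<open>p\<close> in \<open>P\<close> outside \<open>F\<close> and \<open>x\<close> outside \<open>P\<close>, the hyperplane \<open>\<xi> [x; p] = 0\<close> consists of
  singular functionals: \<open>\<xi>\<close> would otherwise be a regular functional stabilized by \<open>p\<close>.
\<close>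

lemma singular_if_semiradical_smaller_codim_2:
  assumes n: "dim UNIV = index + 2" and P: "commutative_polarization P"
    and F: "frobenius_semiradical \<noteq> P"
  shows "singular"
proof -
  have sP: "subspace P" "abelian P" "2 * dim P = dim UNIV + index"
    using P commutative_polarization_iff by auto
  obtain p where p: "p \<in> P" "p \<notin> frobenius_semiradical"
    using polarization_contains_semiradical[OF P] F by blast
  have "dim P \<noteq> dim UNIV" using n sP(3) by linarith
  then have "P \<noteq> UNIV" by metis
  then obtain x where x: "x \<notin> P" by blast
  have "dim (span (insert x P)) = dim UNIV" using dim_span_insert[OF sP(1) x] n sP(3) by linarith
  then have UNIV: "span (insert x P) = UNIV" by (intro subspace_dim_equal) auto
  have "\<xi> \<in> dual_sing" if \<xi>: "\<xi> \<in> dual" "\<xi> [x; p] = 0" for \<xi>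
  proof (rule ccontr)
    assume "\<xi> \<notin> dual_sing"
    then have reg: "\<xi> \<in> dual_reg" using \<xi> by (simp add: dual_sing_def)
    have "\<xi> [p; y] = 0" for y
    proof -
      have "y \<in> span (insert x P)" using UNIV by simp
      then obtain k where k: "y - k *s x \<in> P" using mem_span_insert[OF sP(1)] by blast
      have "[p; y - k *s x] = 0" using sP(2) p(1) k by (simp add: abelian_def)
      then have "[p; y] = k *s [p; x]" by (simp add: bracket_simps)
      then show ?thesis using \<xi> dual_anticommute[OF \<xi>(1), of p x] by (simp add: dual_simps)
    qed
    then have "p \<in> stabilizer \<xi>" by (simp add: stabilizer_def)
    then show False using stabilizer_subset_semiradical[OF reg] p(2) by blast
  qed
  then show ?thesis by (rule singular_if_hyperplane_of_zeros)
qed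

lemma kernel_vector_2x2:
  fixes a b c d :: 'k
  assumes "a * d - b * c = 0"
  obtains s t where "s \<noteq> 0 \<or> t \<noteq> 0" "s * a + t * c = 0" "s * b + t * d = 0"
proof (cases "a = 0 \<and> c = 0")
  case True
  show thesis
  proof (cases "b = 0 \<and> d = 0")
    case False
    then show thesis using True that[of d "- b"] by auto
  qed (use True that[of 1 0] in simp)
next
  case False
  then show thesis using that[of c "- a"] assms by (auto simp: algebra_simps)
qed

text \<open>
  Let \<open>x1, x2\<close> span a complement of \<open>P\<close>, let \<open>G\<close> be a hyperplane of \<open>P\<close> containing \<open>F\<close>, and let \<open>p\<close> be
  in \<open>P\<close> outside \<open>G\<close>. The matrix with rows \<open>\<xi> [x1; g]\<close> and \<open>\<xi> [x2; g]\<close>, for \<open>g\<close> in \<open>G\<close>, has rank at most one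
  for all \<open>\<xi>\<close>. Such a matrix of linear forms has a constant row combination that vanishes, or only one
  column up to constant column operations. In the first case the singular functionals contain the
  hyperplane where that row combination vanishes on \<open>p\<close> too, in the second the quadric given by the
  remaining \<open>2 \<times> 2\<close> determinant.
\<close>

lemma singular_if_semiradical_smaller_codim_4:
  assumes n: "dim UNIV = index + 4" and P: "commutative_polarization P"
    and F: "frobenius_semiradical \<noteq> P"
  shows "singular"
proof -
  have sP: "subspace P" "abelian P" "2 * dim P = dim UNIV + index"
    using P commutative_polarization_iff by auto
  have "frobenius_semiradical \<subset> P" using polarization_contains_semiradical[OF P] F by blast
  then obtain G where G: "subspace G" "frobenius_semiradical \<subseteq> G" "G \<subseteq> P" "dim P = dim G + 1"
    by (rule hyperplane_through[OF subspace_semiradical sP(1)])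
  have "G \<noteq> P" using G(4) by auto
  then obtain p where p: "p \<in> P" "p \<notin> G" using G(3) by blast
  have "dim (span (insert p G)) = dim P" using dim_span_insert[OF G(1) p(2)] G(4) by simp
  moreover have "span (insert p G) \<subseteq> P" by (intro span_minimal) (use p G sP in auto)
  ultimately have Pspan: "span (insert p G) = P" by (intro subspace_dim_equal) (use sP in auto)
  have "dim P \<noteq> dim UNIV" using n sP(3) by linarith
  then have "P \<noteq> UNIV" by metis
  then obtain x1 where x1: "x1 \<notin> P" by blast
  have "dim (span (insert x1 P)) \<noteq> dim UNIV" using dim_span_insert[OF sP(1) x1] n sP(3) by linarith
  then have "span (insert x1 P) \<noteq> UNIV" by metis
  then obtain x2 where x2: "x2 \<notin> span (insert x1 P)" by blast
  have outside: "s *s x1 + t *s x2 \<notin> P" if st: "s \<noteq> 0 \<or> t \<noteq> 0" for s t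
  proof
    assume in': "s *s x1 + t *s x2 \<in> P"
    show False
    proof (cases "t = 0")
      case True
      then have "inverse s *s (s *s x1) \<in> P" using in' subspace_scale[OF sP(1), of "s *s x1"] by simp
      then show False using x1 st True by simp
    next
      case False
      have "inverse t *s (s *s x1 + t *s x2) \<in> P" by (rule subspace_scale[OF sP(1) in'])
      then have "x2 - (- (inverse t * s)) *s x1 \<in> P" using False by (simp add: scale_right_distrib add.commute)
      then show False using x2 mem_span_insert[OF sP(1)] by blast
    qed
  qed
  \<comment> \<open>The minors below are Pfaffians of vectors in the hyperplane \<open>?H\<close>, since \<open>G\<close> is abelian.\<close>
  let ?H = "span (insert x2 (span (insert x1 G)))"
  have "dim ?H \<le> dim G + 2"
    using dim_span_insert_le[of x2 "span (insert x1 G)"] dim_span_insert_le[of x1 G] by linarith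
  then have dH: "dim ?H < dim UNIV" using n sP(3) G(4) by linarith
  have inH: "x1 \<in> ?H" "x2 \<in> ?H" "G \<subseteq> ?H" by (auto intro: span_base)
  have minor: "\<xi> [x1; g] * \<xi> [x2; g'] = \<xi> [x2; g] * \<xi> [x1; g']"
    if \<xi>: "\<xi> \<in> dual" and g: "g \<in> G" "g' \<in> G" for \<xi> g g'
  proof -
    have "pfaffian \<xi> x1 x2 g g' = 0"
      by (rule pfaffian_zero_hyperplane[OF n subspace_span _ dH \<xi>]) (use G(2) inH g in auto)
    moreover have "[g; g'] = 0" using g G(3) sP(2) by (auto simp: abelian_def)
    ultimately show ?thesis using dual_zero[OF \<xi>] by (simp add: pfaffian_def mult.commute)
  qed
  have row_case: ?thesis if st: "s \<noteq> 0 \<or> t \<noteq> 0" and 0: "\<And>g. g \<in> G \<Longrightarrow> [s *s x1 + t *s x2; g] = 0" for s t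
  proof (rule singular_if_hyperplane_of_zeros)
    fix \<xi> assume \<xi>: "\<xi> \<in> dual" "\<xi> [s *s x1 + t *s x2; p] = 0"
    show "\<xi> \<in> dual_sing"
    proof (rule polarization_stabilized_singular[OF P \<xi>(1) outside[OF st]])
      fix r assume "r \<in> P"
      then obtain k where k: "r - k *s p \<in> G" using Pspan mem_span_insert[OF G(1)] by blast
      have "[s *s x1 + t *s x2; r] = k *s [s *s x1 + t *s x2; p]"
        using 0[OF k] unfolding bracket_diff_right bracket_scale_right by simp
      then show "\<xi> [s *s x1 + t *s x2; r] = 0" using \<xi> by (simp add: dual_simps)
    qed
  qed
  show ?thesis
  proof (cases "\<exists>g\<in>G. independent2 [x1; g] [x2; g]")
    case True
    then obtain g where g: "g \<in> G" "independent2 [x1; g] [x2; g]" by blast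
    have row: "\<exists>c. [x1; g' - c *s g] = 0 \<and> [x2; g' - c *s g] = 0" if g': "g' \<in> G" for g'
    proof -
      have "\<xi> [x1; g'] * \<xi> [x2; g] = \<xi> [x2; g'] * \<xi> [x1; g]" if "\<xi> \<in> dual" for \<xi>
        by (rule minor[OF that g' g(1)])
      then obtain c where "[x1; g'] = c *s [x1; g]" "[x2; g'] = c *s [x2; g]"
        by (rule syzygy2[OF g(2)])
      then show ?thesis by (intro exI[of _ c]) (simp add: bracket_simps)
    qed
    have sing: "\<xi> \<in> dual_sing"
      if \<xi>: "\<xi> \<in> dual" and det: "\<xi> [x1; p] * \<xi> [x2; g] - \<xi> [x1; g] * \<xi> [x2; p] = 0" for \<xi>
    proof -
      obtain s t where st: "s \<noteq> 0 \<or> t \<noteq> 0" "s * \<xi> [x1; p] + t * \<xi> [x2; p] = 0"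
        "s * \<xi> [x1; g] + t * \<xi> [x2; g] = 0"
        by (rule kernel_vector_2x2[OF det])
      show ?thesis
      proof (rule polarization_stabilized_singular[OF P \<xi> outside[OF st(1)]])
        fix r assume "r \<in> P"
        then obtain k where k: "r - k *s p \<in> G" using Pspan mem_span_insert[OF G(1)] by blast
        obtain c where c: "[x1; r - k *s p - c *s g] = 0" "[x2; r - k *s p - c *s g] = 0"
          using row[OF k] by blast
        have "[x1; r] = k *s [x1; p] + c *s [x1; g]" "[x2; r] = k *s [x2; p] + c *s [x2; g]"
          using c by (simp_all add: bracket_simps algebra_simps)
        then have "\<xi> [s *s x1 + t *s x2; r] = k * (s * \<xi> [x1; p] + t * \<xi> [x2; p])
            + c * (s * \<xi> [x1; g] + t * \<xi> [x2; g])"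
          using \<xi> by (simp add: bracket_simps dual_simps algebra_simps)
        then show "\<xi> [s *s x1 + t *s x2; r] = 0" using st by simp
      qed
    qed
    obtain \<eta> where \<eta>: "\<eta> \<in> dual_reg" by (rule dual_reg_nonempty)
    then have \<eta>': "\<eta> \<in> dual" "\<eta> \<notin> dual_sing" by (auto simp: dual_reg_def dual_sing_def)
    then have "\<eta> [x1; p] * \<eta> [x2; g] - \<eta> [x1; g] * \<eta> [x2; p] \<noteq> 0" using sing by blast
    then show ?thesis using singular_if_contains_quadric[OF \<eta>'(1)] sing by blast
  next
    case False
    show ?thesis
    proof (cases "\<forall>g\<in>G. [x1; g] = 0")
      case True
      then show ?thesis using row_case[of 1 0] by simp
    next
      case nz: False
      then obtain g where g: "g \<in> G" "[x1; g] \<noteq> 0" by blast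
      then obtain s t where st: "s \<noteq> 0 \<or> t \<noteq> 0" "s *s [x1; g] + t *s [x2; g] = 0"
        using \<open>\<not> (\<exists>g\<in>G. independent2 [x1; g] [x2; g])\<close> unfolding independent2_def by blast
      have "[s *s x1 + t *s x2; g'] = 0" if g': "g' \<in> G" for g'
      proof -
        have "\<xi> [s *s x1 + t *s x2; g'] * \<xi> [x1; g] = 0" if \<xi>: "\<xi> \<in> dual" for \<xi>
        proof -
          have "s * \<xi> [x1; g] + t * \<xi> [x2; g] = 0"
            using st(2) \<xi> dual_add dual_scale dual_zero by metis
          moreover have "\<xi> [s *s x1 + t *s x2; g'] * \<xi> [x1; g]
              = \<xi> [x1; g'] * (s * \<xi> [x1; g] + t * \<xi> [x2; g])"
            using minor[OF \<xi> g' g(1)] \<xi> by (simp add: bracket_simps dual_simps algebra_simps)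
          ultimately show ?thesis by simp
        qed
        then show ?thesis using product_zero g(2) by blast
      qed
      then show ?thesis using row_case[OF st(1)] by blast
    qed
  qed
qed

lemma semiradical_eq_polarization:
  assumes nil: "nilpotent" and n: "dim UNIV = index + 2 * s" and s: "s \<le> 2 \<or> index = 1"
    and P: "commutative_polarization P" and nonsing: "\<not> singular"
  shows "P = frobenius_semiradical"
proof (cases "s = 0")
  case True
  obtain \<xi> where \<xi>: "\<xi> \<in> dual_reg" by (rule dual_reg_nonempty)
  then have "stabilizer \<xi> = UNIV"
    using n True subspace_dim_equal[OF subspace_stabilizer[of \<xi>] subspace_UNIV] by (simp add: dual_reg_def)
  then show ?thesis
    using stabilizer_subset_semiradical[OF \<xi>] polarization_contains_semiradical[OF P] by blast
next
  case False
  then consider "s = 1" | "s = 2" | "index = 1" using s by linarith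
  then show ?thesis
  proof cases
    case 1
    then show ?thesis using singular_if_semiradical_smaller_codim_2[OF _ P] n nonsing by auto
  next
    case 2
    then show ?thesis using singular_if_semiradical_smaller_codim_4[OF _ P] n nonsing by auto
  next
    case 3
    then show ?thesis using index_1_singular[OF nil] n False nonsing by auto
  qed
qed

section \<open>The bounds in dimension at most eight\<close>

lemma abelian_if_index_eq_dim:
  assumes "dim UNIV = index" shows "abelian UNIV"
proof -
  have "[x; y] = 0" for x y
  proof (rule dual_separates)
    fix \<xi> assume \<xi>: "\<xi> \<in> dual"
    have "stabilizer \<xi> = UNIV"
      using subspace_dim_equal[OF subspace_stabilizer[OF \<xi>] subspace_UNIV] index_le[OF \<xi>] assms by simp
    then show "\<xi> [x; y] = \<xi> 0" using dual_zero[OF \<xi>] by (auto simp: stabilizer_def)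
  qed
  then show ?thesis by (simp add: abelian_def)
qed

lemma semiradical_not_UNIV:
  assumes "abelian frobenius_semiradical" "index < dim UNIV"
  shows "frobenius_semiradical \<noteq> UNIV"
proof
  assume "frobenius_semiradical = UNIV"
  then have "stabilizer \<xi> = UNIV" if "\<xi> \<in> dual" for \<xi>
    using assms(1) dual_zero[OF that] by (simp add: stabilizer_def abelian_def)
  moreover obtain \<xi> where "\<xi> \<in> dual_reg" by (rule dual_reg_nonempty)
  ultimately show False using assms(2) by (auto simp: dual_reg_def)
qed

lemma twice_max_abelian_dim_le: "2 * max_abelian_dim \<le> dim UNIV + index"
proof -
  obtain A where "subspace A" "abelian A" "dim A = max_abelian_dim" by (rule max_abelian_dim_attained)
  then show ?thesis using twice_dim_abelian_le[of A] by simp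
qed

lemma rentschler_iff: "rentschler \<longleftrightarrow> dim UNIV + index \<le> 2 * max_abelian_dim + 2"
proof -
  have "rentschler \<longleftrightarrow> real (dim UNIV + index) \<le> real (2 * max_abelian_dim + 2)"
    unfolding rentschler_def magic_number_def by (simp add: field_simps)
  then show ?thesis by (simp only: of_nat_le_iff)
qed

lemma max_abelian_dim_eq_magic_iff:
  "real max_abelian_dim = magic_number \<longleftrightarrow> 2 * max_abelian_dim = dim UNIV + index"
proof -
  have "real max_abelian_dim = magic_number \<longleftrightarrow> real (2 * max_abelian_dim) = real (dim UNIV + index)"
    unfolding magic_number_def by (simp add: field_simps)
  then show ?thesis by (simp only: of_nat_eq_iff)
qed

lemma max_abelian_dim_eq_magic_minus_1_iff:
  "real max_abelian_dim = magic_number - 1 \<longleftrightarrow> 2 * max_abelian_dim + 2 = dim UNIV + index"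
proof -
  have "real max_abelian_dim = magic_number - 1 \<longleftrightarrow> real (2 * max_abelian_dim + 2) = real (dim UNIV + index)"
    unfolding magic_number_def by (simp add: field_simps)
  then show ?thesis by (simp only: of_nat_eq_iff)
qed

text \<open>
  This is the bound \<open>\<alpha>(L) < c(L)\<close> for nonabelian \<open>F\<close>: an abelian subspace of dimension \<open>c(L)\<close> would be
  a polarization, and contain \<open>F\<close>.
\<close>

lemma semiradical_abelian_if_max:
  assumes "2 * max_abelian_dim = dim UNIV + index"
  shows "abelian frobenius_semiradical"
proof -
  obtain A where "subspace A" "abelian A" "dim A = max_abelian_dim" by (rule max_abelian_dim_attained)
  then have "commutative_polarization A" "abelian A" using assms by (simp_all add: commutative_polarization_iff)
  then show ?thesis using abelian_subset polarization_contains_semiradical by blast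
qed

lemma polarizations_of_nonsingular:
  assumes nil: "nilpotent" and n: "dim UNIV = index + 2 * s" and s: "s \<le> 2 \<or> index = 1"
    and max: "2 * max_abelian_dim = dim UNIV + index" and nonsing: "\<not> singular"
  shows "{P. commutative_polarization P} = {frobenius_semiradical}"
proof -
  obtain A where "subspace A" "abelian A" "dim A = max_abelian_dim" by (rule max_abelian_dim_attained)
  then have A: "commutative_polarization A" using max by (simp add: commutative_polarization_iff)
  have eq: "P = frobenius_semiradical" if "commutative_polarization P" for P
    by (rule semiradical_eq_polarization[OF nil n s that nonsing])
  have "commutative_polarization frobenius_semiradical" using A unfolding eq[OF A] .
  then show ?thesis using eq by blast
qed

lemma dimension_at_most_7:
  assumes nil: "nilpotent" and n: "dim UNIV \<le> 7" and rank: "dim UNIV = index + 2 * s"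
  shows "dim UNIV + index \<le> 2 * max_abelian_dim + 2"
    and "abelian frobenius_semiradical \<Longrightarrow> dim UNIV + index \<le> 2 * max_abelian_dim"
    and "s \<le> 2 \<or> index = 1"
proof -
  have pos: "0 < index" if "s \<noteq> 0"
    using index_pos[OF nil] that rank by linarith
  \<comment> \<open>A nonzero center gives \<open>0 < index\<close> and thus excludes the other values of \<open>s\<close>.\<close>
  have cases: "s = 0 \<or> s = 1 \<or> (s = 2 \<and> 0 < index \<and> index \<le> 3) \<or> (s = 3 \<and> index = 1)"
    using pos n rank by (cases "s = 0") (simp, linarith)
  have ge3: "3 \<le> max_abelian_dim" if "4 \<le> dim UNIV"
    by (rule nilpotent_max_abelian_dim_ge[OF nil]) (use that in linarith)
  have ge4: "4 \<le> max_abelian_dim" if "7 \<le> dim UNIV"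
    by (rule nilpotent_max_abelian_dim_ge[OF nil]) (use that in linarith)
  have s0: "dim UNIV \<le> max_abelian_dim" if "s = 0"
    using dim_le_max_abelian_dim[OF subspace_UNIV] abelian_if_index_eq_dim rank that by simp
  show "s \<le> 2 \<or> index = 1" using cases by linarith
  show "dim UNIV + index \<le> 2 * max_abelian_dim + 2"
    using cases
  proof (elim disjE conjE)
    assume "s = 0"
    then show ?thesis using s0 rank by linarith
  next
    assume "s = 1"
    then show ?thesis using max_abelian_dim_index_codim_2(1) rank by simp
  next
    assume "s = 2" "0 < index" "index \<le> 3"
    then show ?thesis using ge3 ge4 rank by linarith
  next
    assume "s = 3" "index = 1"
    then show ?thesis using ge4 rank by linarith
  qed
  assume ab: "abelian frobenius_semiradical"
  show "dim UNIV + index \<le> 2 * max_abelian_dim"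
    using cases
  proof (elim disjE conjE)
    assume "s = 0"
    then show ?thesis using s0 rank by linarith
  next
    assume "s = 1"
    then show ?thesis using max_abelian_dim_index_codim_2(2)[OF _ ab] rank by simp
  next
    assume s: "s = 2" "0 < index" "index \<le> 3"
    then have "frobenius_semiradical \<noteq> UNIV" by (intro semiradical_not_UNIV[OF ab]) (use rank in linarith)
    then show ?thesis using max_abelian_dim_index_codim_4(2)[OF _ _ nil ab s(3)] s rank by simp
  next
    assume "s = 3" "index = 1"
    then show ?thesis using ge4 rank by linarith
  qed
qed

lemma dimension_8:
  assumes nil: "nilpotent" and n: "dim UNIV = 8" and i: "index \<noteq> 4 \<or> frobenius_semiradical \<noteq> UNIV"
  shows "dim UNIV + index \<le> 2 * max_abelian_dim + 2"
proof -
  obtain s where rank: "dim UNIV = index + 2 * s" by (rule even_codim_index)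
  have pos: "0 < index" by (rule index_pos[OF nil]) (use n in linarith)
  have ge4: "4 \<le> max_abelian_dim"
    by (rule nilpotent_max_abelian_dim_ge[OF nil]) (use n in linarith)
  have "s = 0 \<or> s = 1 \<or> s = 2 \<or> s = 3" using pos n rank by linarith
  then show ?thesis
  proof (elim disjE)
    assume "s = 0"
    then have "dim UNIV \<le> max_abelian_dim"
      using dim_le_max_abelian_dim[OF subspace_UNIV] abelian_if_index_eq_dim rank by simp
    then show ?thesis using rank by linarith
  next
    assume "s = 1"
    then show ?thesis using max_abelian_dim_index_codim_2(1) rank by simp
  next
    assume s: "s = 2"
    then have "dim UNIV = index + 4" "frobenius_semiradical \<noteq> UNIV" using rank n i by simp_all
    then show ?thesis using max_abelian_dim_index_codim_4(1) by simp
  next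
    assume "s = 3"
    then show ?thesis using ge4 rank n by linarith
  qed
qed

end

theorem theorem6p2:
  fixes scale :: "'k::{alg_closed_field, field_char_0} \<Rightarrow> 'v::ab_group_add \<Rightarrow> 'v"
    and Basis :: "'v set"
    and bracket :: "'v \<Rightarrow> 'v \<Rightarrow> 'v"
    and n :: nat
  assumes L: "lie_algebra scale Basis bracket"
    and nilp: "lie_algebra.nilpotent scale bracket"
    and n: "vector_space.dim scale (UNIV :: 'v set) = n"
  shows
    "(n \<le> 7 \<longrightarrow>
        lie_algebra.rentschler scale bracket \<and>
        (lie_algebra.abelian bracket (lie_algebra.frobenius_semiradical scale bracket) \<longrightarrow>
           real (lie_algebra.max_abelian_dim scale bracket) = lie_algebra.magic_number scale bracket \<and>
           (\<not> lie_algebra.singular scale bracket \<longrightarrow>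
              {P. lie_algebra.commutative_polarization scale bracket P}
                = {lie_algebra.frobenius_semiradical scale bracket})) \<and>
        (\<not> lie_algebra.abelian bracket (lie_algebra.frobenius_semiradical scale bracket) \<longrightarrow>
           real (lie_algebra.max_abelian_dim scale bracket) = lie_algebra.magic_number scale bracket - 1))
     \<and> (n = 8 \<longrightarrow>
          lie_algebra.index scale bracket \<noteq> 4 \<or>
          (lie_algebra.index scale bracket = 4 \<and> \<not> lie_algebra.quasi_quadratic scale bracket) \<longrightarrow>
          lie_algebra.rentschler scale bracket)"
proof -
  interpret acf_lie_algebra scale Basis bracket
    by (rule acf_lie_algebra.intro[OF L])
  obtain s where rank: "dim UNIV = index + 2 * s" by (rule even_codim_index)
  show ?thesis
  proof (intro conjI impI)
    assume n7: "n \<le> 7"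
    then have le7: "dim UNIV \<le> 7" using n by simp
    note small = dimension_at_most_7[OF nilp le7 rank]
    show "rentschler" using small(1) by (simp only: rentschler_iff)
    show "real max_abelian_dim = magic_number - 1" if "\<not> abelian frobenius_semiradical"
    proof -
      have "2 * max_abelian_dim \<noteq> dim UNIV + index" using semiradical_abelian_if_max that by blast
      then have "2 * max_abelian_dim + 2 = dim UNIV + index"
        using twice_max_abelian_dim_le small(1) rank by presburger
      then show ?thesis by (simp only: max_abelian_dim_eq_magic_minus_1_iff)
    qed
    assume ab: "abelian frobenius_semiradical"
    have max: "2 * max_abelian_dim = dim UNIV + index"
      using small(2)[OF ab] twice_max_abelian_dim_le by linarith
    then show "real max_abelian_dim = magic_number" by (simp only: max_abelian_dim_eq_magic_iff)
    show "{P. commutative_polarization P} = {frobenius_semiradical}" if "\<not> singular"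
      by (rule polarizations_of_nonsingular[OF nilp rank small(3) max that])
  next
    assume "n = 8" and i: "index \<noteq> 4 \<or> index = 4 \<and> \<not> quasi_quadratic"
    then have "dim UNIV = 8" "index \<noteq> 4 \<or> frobenius_semiradical \<noteq> UNIV"
      using n by (auto simp: quasi_quadratic_def)
    then show "rentschler" using dimension_8[OF nilp] by (simp only: rentschler_iff)
  qed
qed

end
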